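(* Let $n\geqslant 1$ be an integer and $\sigma>0$ a real constant. Let $u_0,u_1,\theta_0\in L^2(\mathbb{R}^n)\cap L^1(\mathbb{R}^n)$, and let $(u,\theta)$ be the solution of the Cauchy problem $$\begin{cases} u_{tt}+\Delta^2u+\Delta\theta=0,\\ \theta_t-\Delta\theta+\sigma\theta-\Delta u_t=0,\\ (u,u_t,\theta)(0,x)=(u_0,u_1,\theta_0)(x),\end{cases}\qquad (t,x)\in(0,\infty)\times\mathbb{R}^n .$$ Then the component $u$ satisfies, for $t\gg1$, $$\mathcal{D}_n(t)\,|P_{u_1}|\lesssim\|u(t,\cdot)\|_{L^2}\lesssim\mathcal{D}_n(t)\,\|(u_0,u_1,\theta_0)\|_{(L^2\cap L^1)^3},$$ where $$\mathcal{D}_n(t):=\begin{cases}t^{1-\frac n4}&\text{if } n\leqslant3,\\ \sqrt{\ln t}&\text{if } n=4,\\ t^{\frac12-\frac n8}&\text{if } n\geqslant5,\end{cases}\qquad P_{u_1}:=\int_{\mathbb{R}^n}u_1(x)\,\mathrm{d}x .$$ Precisely: there exist constants $C,c>0$ and $T_0>1$ depending only on $n$ and $\sigma$ such that the upper bound $\|u(t,\cdot)\|_{L^2}\leqslant C\,\mathcal{D}_n(t)\,\|(u_0,u_1,\theta_0)\|_{(L^2\cap L^1)^3}$ holds for all such data and all $t\geqslant T_0$, and for all such data there is $T_1>1$ (which may depend on the data) such that $\|u(t,\cdot)\|_{L^2}\geqslant c\,\mathcal{D}_n(t)\,|P_{u_1}|$ for all $t\geqslant T_1$. In particular, if $P_{u_1}\neq0$,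 then $\|u(t,\cdot)\|_{L^2}\simeq\mathcal{D}_n(t)$ for $t\gg1$, i.e. the ratio $\|u(t,\cdot)\|_{L^2}/\mathcal{D}_n(t)$ is bounded above and below by positive constants (possibly depending on the data) for all sufficiently large $t$.
   Context: Here $u$ (vertical displacement) and $\theta$ (temperature) are scalar unknowns. The solution is understood via the spatial Fourier transform: for a.e. $\xi\in\mathbb{R}^n$, $(\widehat u,\widehat\theta)(t,\xi)$ solves the linear ODE system $\widehat u_{tt}+|\xi|^4\widehat u-|\xi|^2\widehat\theta=0$, $\widehat\theta_t+(|\xi|^2+\sigma)\widehat\theta+|\xi|^2\widehat u_t=0$ for $t>0$, with $(\widehat u,\widehat u_t,\widehat\theta)(0,\xi)=(\widehat u_0,\widehat u_1,\widehat\theta_0)(\xi)$. The norm on data is $\|(u_0,u_1,\theta_0)\|_{(L^2\cap L^1)^3}:=\sum_{f\in\{u_0,u_1,\theta_0\}}\left(\|f\|_{L^2}+\|f\|_{L^1}\right)$. The relation $f\lesssim g$ means $f\leqslant Cg$ for some positive constant $C$, $f\simeq g$ means $g\lesssim f\lesssim g$, and "for $t\gg1$" means for all sufficiently large $t$. *)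

theory Defs
  imports "HOL-Analysis.Analysis"
begin

text \<open>
  Lebesgue spaces of complex-valued functions (real-valued functions are a special case).
  Elements are concrete functions rather than classes modulo null sets. The two norms are
  meaningful only for integrable, respectively square integrable, arguments.
\<close>

definition in_L1 :: "('a::euclidean_space \<Rightarrow> complex) \<Rightarrow> bool" where
  "in_L1 f \<longleftrightarrow> integrable lebesgue f"

definition in_L2 :: "('a::euclidean_space \<Rightarrow> complex) \<Rightarrow> bool" where
  "in_L2 f \<longleftrightarrow> f \<in> borel_measurable lebesgue \<and> integrable lebesgue (\<lambda>x. (norm (f x))\<^sup>2)"

definition L1_norm :: "('a::euclidean_space \<Rightarrow> complex) \<Rightarrow> real" where
  "L1_norm f = (\<integral>x. norm (f x) \<partial>lebesgue)"

definition L2_norm :: "('a::euclidean_space \<Rightarrow> complex) \<Rightarrow> real" where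
  "L2_norm f = sqrt (\<integral>x. (norm (f x))\<^sup>2 \<partial>lebesgue)"

definition data_norm ::
  "('a::euclidean_space \<Rightarrow> complex) \<Rightarrow> ('a \<Rightarrow> complex) \<Rightarrow> ('a \<Rightarrow> complex) \<Rightarrow> real" where
  "data_norm u0 u1 \<theta>0 =
     (L2_norm u0 + L1_norm u0) + (L2_norm u1 + L1_norm u1) + (L2_norm \<theta>0 + L1_norm \<theta>0)"

text \<open>
  The Fourier transform of an integrable function, normalised so that its value at the origin
  is the integral of the function.
\<close>

definition fourier :: "('a::euclidean_space \<Rightarrow> complex) \<Rightarrow> 'a \<Rightarrow> complex" where
  "fourier f \<xi> = (\<integral>x. exp (- (\<i> * complex_of_real (x \<bullet> \<xi>))) * f x \<partial>lebesgue)"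

text \<open>
  \<open>g\<close> is (a representative of) the Fourier transform of the \<open>L\<^sup>2\<close> function \<open>f\<close>, i.e. the limit
  in \<open>L\<^sup>2\<close> of the Fourier transforms of the truncations of \<open>f\<close> to balls. The truncations are
  integrable; the distance is measured by a nonnegative integral with values in \<open>[0, \<infinity>]\<close>, so
  convergence cannot hold for the spurious reason that a Bochner integral is undefined.
\<close>

definition L2_fourier :: "('a::euclidean_space \<Rightarrow> complex) \<Rightarrow> ('a \<Rightarrow> complex) \<Rightarrow> bool" where
  "L2_fourier f g \<longleftrightarrow> in_L2 f \<and> in_L2 g \<and>
     ((\<lambda>R::real. \<integral>\<^sup>+\<xi>. ennreal
          ((norm (fourier (\<lambda>x. indicator (cball 0 R) x * f x) \<xi> - g \<xi>))\<^sup>2) \<partial>lebesgue)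
        \<longlongrightarrow> 0) at_top"

text \<open>
  The linear system at a frequency of modulus \<open>r\<close>, for \<open>t > 0\<close>, with Cauchy data \<open>(a, b, c)\<close>
  for \<open>(U, U\<^sub>t, \<Theta>)\<close> attained continuously as \<open>t \<rightarrow> 0\<close>. The auxiliary function \<open>V\<close> is \<open>U\<^sub>t\<close>.
\<close>

definition frequency_ode_solution ::
  "real \<Rightarrow> real \<Rightarrow> complex \<Rightarrow> complex \<Rightarrow> complex \<Rightarrow> (real \<Rightarrow> complex) \<Rightarrow> (real \<Rightarrow> complex) \<Rightarrow> bool"
where
  "frequency_ode_solution \<sigma> r a b c U \<Theta> \<longleftrightarrow>
     (\<exists>V :: real \<Rightarrow> complex.
        continuous_on {0..} U \<and> continuous_on {0..} V \<and> continuous_on {0..} \<Theta> \<and>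
        U 0 = a \<and> V 0 = b \<and> \<Theta> 0 = c \<and>
        (\<forall>t>0.
           (U has_vector_derivative V t) (at t) \<and>
           (\<exists>A. (V has_vector_derivative A) (at t) \<and>
                A + of_real (r ^ 4) * U t - of_real (r\<^sup>2) * \<Theta> t = 0) \<and>
           (\<exists>B. (\<Theta> has_vector_derivative B) (at t) \<and>
                B + of_real (r\<^sup>2 + \<sigma>) * \<Theta> t + of_real (r\<^sup>2) * V t = 0)))"

text \<open>
  \<open>(u, \<theta>)\<close> solves the Cauchy problem
  \<open>u\<^sub>t\<^sub>t + \<Delta>\<^sup>2u + \<Delta>\<theta> = 0\<close>, \<open>\<theta>\<^sub>t - \<Delta>\<theta> + \<sigma>\<theta> - \<Delta>u\<^sub>t = 0\<close>, \<open>(u, u\<^sub>t, \<theta>)(0) = (u\<^sub>0, u\<^sub>1, \<theta>\<^sub>0)\<close>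
  in the sense of the spatial Fourier transform: the transforms of \<open>u(t)\<close> and \<open>\<theta>(t)\<close> have
  representatives which, at almost every frequency, solve the transformed system.
\<close>

definition plate_solution ::
  "real \<Rightarrow> ('a::euclidean_space \<Rightarrow> complex) \<Rightarrow> ('a \<Rightarrow> complex) \<Rightarrow> ('a \<Rightarrow> complex) \<Rightarrow>
   (real \<Rightarrow> 'a \<Rightarrow> complex) \<Rightarrow> (real \<Rightarrow> 'a \<Rightarrow> complex) \<Rightarrow> bool"
where
  "plate_solution \<sigma> u0 u1 \<theta>0 u \<theta> \<longleftrightarrow>
     (\<exists>U \<Theta>. (\<forall>t\<ge>0. L2_fourier (u t) (U t) \<and> L2_fourier (\<theta> t) (\<Theta> t)) \<and>
        (AE \<xi> in lebesgue.
           frequency_ode_solution \<sigma> (norm \<xi>) (fourier u0 \<xi>) (fourier u1 \<xi>) (fourier \<theta>0 \<xi>)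
             (\<lambda>t. U t \<xi>) (\<lambda>t. \<Theta> t \<xi>)))"

definition decay_rate :: "nat \<Rightarrow> real \<Rightarrow> real" where
  "decay_rate n t =
     (if n \<le> 3 then t powr (1 - real n / 4)
      else if n = 4 then sqrt (ln t)
      else t powr (1 / 2 - real n / 8))"

end

theory Submission
  imports
    Defs
    "HOL-Probability.Characteristic_Functions"
    "HOL-Real_Asymp.Real_Asymp"
begin

text \<open>
  In Fourier variables the problem splits into one linear system for each frequency \<open>\<xi>\<close>, which
  depends only on \<open>r = |\<xi>|\<close>, and by Plancherel's theorem the norm of \<open>u(t)\<close> is a fixed multiple
  of the \<open>L\<^sup>2\<close> norm of the transform \<open>U(t)\<close>. For small \<open>r\<close> the system has one eigenvalue near
  \<open>-\<sigma>\<close> and two near \<open>\<plusminus>\<i>r\<^sup>2 - r\<^sup>4/(2\<sigma>)\<close>, so that \<open>U(t)\<close> resembles the slowly damped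
  oscillation \<open>u\<^sub>1 sin(r\<^sup>2t)/r\<^sup>2\<close>, where \<open>u\<^sub>1\<close> stands for its transform. The three rates are the
  \<open>L\<^sup>2\<close> norms of this profile: up to \<open>r = t\<^bsup>-1/2\<^esup>\<close> it has size \<open>t\<close>, from there up to
  \<open>r = t\<^bsup>-1/4\<^esup>\<close> it has amplitude \<open>r\<^bsup>-2\<^esup>\<close>, and beyond this scale it is damped. Its square is
  integrated against \<open>r\<^bsup>n-1\<^esup>\<close>. For \<open>n \<le> 3\<close> the first scale dominates, for \<open>n \<ge> 5\<close> the second one,
  and for \<open>n = 4\<close> all dyadic shells between them contribute equally, which gives the logarithm.

  Upper bound. Let \<open>\<Theta>\<close> be the transform of the temperature. A Lyapunov functional shows that the
  energy \<open>|U\<^sub>t|\<^sup>2 + r\<^sup>4|U|\<^sup>2 + |\<Theta>|\<^sup>2\<close> decays like \<open>exp(-c r\<^sup>4t/(r\<^sup>2+\<sigma>))\<close> (\<open>energy_decay\<close>); this bounds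
  \<open>r\<^sup>2|U|\<close>, and for \<open>r\<^sup>2t \<le> 1\<close> integrating \<open>U\<^sub>t\<close> gives \<open>|U| \<lesssim> t\<close>. For small \<open>r\<close>, where the bound on \<open>U\<close>
  is singular, the transforms of the data are estimated by the \<open>L\<^sup>1\<close> norms; the rest is controlled by the
  \<open>L\<^sup>2\<close> norms. What remains is to integrate explicit radial kernels (\<open>dominating_kernel_exists\<close>).

  Lower bound. While \<open>r\<^sup>4t\<close> is small compared with \<open>\<sigma>\<close>, the combinations \<open>U\<^sub>t \<plusminus> \<i>r\<^sup>2U\<close> rotate
  almost freely, and \<open>r\<^sup>2U\<close> differs from \<open>u\<^sub>1 sin(r\<^sup>2t)\<close> by an error that is either small relative to
  \<open>u\<^sub>1\<close> or of order \<open>r\<^sup>2\<close> (\<open>frequency_profile\<close>). On a suitable shell of frequencies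
  (\<open>frequency_window_exists\<close>) \<open>sin\<^sup>2\<close> averages to one half (\<open>sine_square_shell\<close>), and \<open>u\<^sub>1\<close> is close to
  its value at the origin, the integral \<open>P\<close> of \<open>u\<^sub>1\<close> in physical space. The shell is chosen such that
  its volume is negligible against the squared rate, which disposes of the errors of order \<open>r\<^sup>2\<close>.

  Plancherel's theorem is proved for integrable square integrable functions by a Gaussian
  regularisation (\<open>plancherel\<close>) and extended to the \<open>L\<^sup>2\<close> transform by approximation
  (\<open>plancherel_L2\<close>).
\<close>


section \<open>A single Fourier mode\<close>

text \<open>
  One Fourier mode as a first order system, with \<open>V\<close> in the role of \<open>U\<^sub>t\<close>.
\<close>

locale thermoelastic_mode =
  fixes \<sigma> r :: real and U V \<Theta> :: "real \<Rightarrow> complex"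
  assumes \<sigma>: "\<sigma> > 0"
    and cont: "continuous_on {0..} U" "continuous_on {0..} V" "continuous_on {0..} \<Theta>"
    and DU: "t > 0 \<Longrightarrow> (U has_vector_derivative V t) (at t)"
    and DV: "t > 0 \<Longrightarrow> (V has_vector_derivative (r\<^sup>2 *\<^sub>R \<Theta> t - r^4 *\<^sub>R U t)) (at t)"
    and D\<Theta>: "t > 0 \<Longrightarrow> (\<Theta> has_vector_derivative (- (r\<^sup>2 + \<sigma>) *\<^sub>R \<Theta> t - r\<^sup>2 *\<^sub>R V t)) (at t)"

lemma frequency_ode_solution_mode:
  assumes "\<sigma> > 0" "frequency_ode_solution \<sigma> r a b c U \<Theta>"
  obtains V where "thermoelastic_mode \<sigma> r U V \<Theta>" "U 0 = a" "V 0 = b" "\<Theta> 0 = c"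
proof -
  obtain V where V: "continuous_on {0..} U" "continuous_on {0..} V" "continuous_on {0..} \<Theta>"
    "U 0 = a" "V 0 = b" "\<Theta> 0 = c"
    and D: "\<And>t. t > 0 \<Longrightarrow> (U has_vector_derivative V t) (at t)"
     "\<And>t. t > 0 \<Longrightarrow> \<exists>A. (V has_vector_derivative A) (at t) \<and>
                A + of_real (r ^ 4) * U t - of_real (r\<^sup>2) * \<Theta> t = 0"
     "\<And>t. t > 0 \<Longrightarrow> \<exists>B. (\<Theta> has_vector_derivative B) (at t) \<and>
                B + of_real (r\<^sup>2 + \<sigma>) * \<Theta> t + of_real (r\<^sup>2) * V t = 0"
    using assms(2) unfolding frequency_ode_solution_def by blast
  have 1: "(V has_vector_derivative (r\<^sup>2 *\<^sub>R \<Theta> t - r^4 *\<^sub>R U t)) (at t)" if t: "t > 0" for t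
  proof -
    obtain A where A: "(V has_vector_derivative A) (at t)"
      "A + of_real (r ^ 4) * U t - of_real (r\<^sup>2) * \<Theta> t = 0" using D(2)[OF t] by blast
    have "A = r\<^sup>2 *\<^sub>R \<Theta> t - r^4 *\<^sub>R U t"
    proof -
      have "A = (A + of_real (r ^ 4) * U t - of_real (r\<^sup>2) * \<Theta> t)
          + of_real (r\<^sup>2) * \<Theta> t - of_real (r ^ 4) * U t" by simp
      thus ?thesis unfolding A(2) scaleR_conv_of_real by simp
    qed
    with A(1) show ?thesis by simp
  qed
  have 2: "(\<Theta> has_vector_derivative (- (r\<^sup>2 + \<sigma>) *\<^sub>R \<Theta> t - r\<^sup>2 *\<^sub>R V t)) (at t)" if t: "t > 0" for t
  proof -
    obtain B where B: "(\<Theta> has_vector_derivative B) (at t)"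
      "B + of_real (r\<^sup>2 + \<sigma>) * \<Theta> t + of_real (r\<^sup>2) * V t = 0" using D(3)[OF t] by blast
    have "B = - (r\<^sup>2 + \<sigma>) *\<^sub>R \<Theta> t - r\<^sup>2 *\<^sub>R V t"
    proof -
      have "B = (B + of_real (r\<^sup>2 + \<sigma>) * \<Theta> t + of_real (r\<^sup>2) * V t)
          - of_real (r\<^sup>2 + \<sigma>) * \<Theta> t - of_real (r\<^sup>2) * V t" by simp
      thus ?thesis unfolding B(2) scaleR_conv_of_real by (simp add: ring_distribs)
    qed
    with B(1) show ?thesis by simp
  qed
  have "thermoelastic_mode \<sigma> r U V \<Theta>"
    by (rule thermoelastic_mode.intro[OF assms(1) V(1-3) D(1) 1 2])
  thus ?thesis using V(4-6) that by blast
qed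

text \<open>
  This bounds the derivative of the Lyapunov functional of \<open>energy_decay\<close>, divided by \<open>r\<^sup>2 + \<sigma>\<close>. There
  \<open>v\<close>, \<open>w\<close>, \<open>h\<close> are the norms of \<open>V\<close>, \<open>r\<^sup>2U\<close>, \<open>\<Theta>\<close>, the numbers \<open>x\<close> and \<open>y\<close> are the inner products of
  \<open>\<Theta>\<close> with \<open>V\<close> and with \<open>r\<^sup>2U\<close>, and \<open>r\<^sup>2 = 16\<epsilon>(r\<^sup>2 + \<sigma>)\<close>. The dissipation of \<open>h\<close> absorbs both inner
  products because they carry the factors \<open>\<epsilon>\<close> and \<open>\<epsilon>\<^sup>2\<close>.
\<close>

lemma lyapunov_algebra:
  fixes \<epsilon> v w h x y :: real
  assumes e: "0 \<le> \<epsilon>" "\<epsilon> \<le> 1/16" and x: "\<bar>x\<bar> \<le> h * v" and y: "\<bar>y\<bar> \<le> h * w"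
  shows "- h\<^sup>2 + \<epsilon> * (- 8 * \<epsilon> * v\<^sup>2 - 8 * \<epsilon> * w\<^sup>2 + 16 * \<epsilon> * h\<^sup>2 - x - 8 * \<epsilon> * y)
     \<le> - 3 * \<epsilon>\<^sup>2 * (v\<^sup>2 + w\<^sup>2 + h\<^sup>2)"
proof -
  have "0 \<le> 2 * (\<epsilon> * v - h / 4)\<^sup>2" by simp
  hence 1: "\<epsilon> * (h * v) \<le> 2 * \<epsilon>\<^sup>2 * v\<^sup>2 + h\<^sup>2 / 8" by (simp add: power2_eq_square algebra_simps)
  have "\<epsilon> * - x \<le> \<epsilon> * (h * v)" using e x by (intro mult_left_mono) auto
  with 1 have X: "- (\<epsilon> * x) \<le> 2 * \<epsilon>\<^sup>2 * v\<^sup>2 + h\<^sup>2 / 8" by simp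
  have "0 \<le> (h - w)\<^sup>2" by simp
  hence "2 * (h * w) \<le> h\<^sup>2 + w\<^sup>2" by (simp add: power2_eq_square algebra_simps)
  hence "- y \<le> (h\<^sup>2 + w\<^sup>2) / 2" using y by (simp add: abs_le_iff)
  hence "\<epsilon>\<^sup>2 * (- y) \<le> \<epsilon>\<^sup>2 * ((h\<^sup>2 + w\<^sup>2) / 2)" by (intro mult_left_mono) auto
  hence Y: "- (\<epsilon>\<^sup>2 * y) \<le> (\<epsilon>\<^sup>2 * h\<^sup>2 + \<epsilon>\<^sup>2 * w\<^sup>2) / 2" by (simp add: algebra_simps)
  have "\<epsilon>\<^sup>2 \<le> (1/16)\<^sup>2" using e by (intro power_mono) auto
  hence C: "\<epsilon>\<^sup>2 * h\<^sup>2 \<le> (1/256) * h\<^sup>2" by (intro mult_right_mono) (auto simp: power2_eq_square)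
  have lin: "- H - 8 * A - 8 * B + 16 * C - p - 8 * q \<le> - 3 * A - 3 * B - 3 * C"
    if "C \<le> (1/256) * H" "0 \<le> C" "0 \<le> A" "0 \<le> B" "- p \<le> 2 * A + H / 8" "- q \<le> (C + B) / 2"
    for A B C H p q :: real
    using that by argo
  have "- h\<^sup>2 + \<epsilon> * (- 8 * \<epsilon> * v\<^sup>2 - 8 * \<epsilon> * w\<^sup>2 + 16 * \<epsilon> * h\<^sup>2 - x - 8 * \<epsilon> * y)
     = - h\<^sup>2 - 8 * (\<epsilon>\<^sup>2 * v\<^sup>2) - 8 * (\<epsilon>\<^sup>2 * w\<^sup>2) + 16 * (\<epsilon>\<^sup>2 * h\<^sup>2) - \<epsilon> * x - 8 * (\<epsilon>\<^sup>2 * y)"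
    by (simp add: power2_eq_square algebra_simps)
  also have "\<dots> \<le> - 3 * (\<epsilon>\<^sup>2 * v\<^sup>2) - 3 * (\<epsilon>\<^sup>2 * w\<^sup>2) - 3 * (\<epsilon>\<^sup>2 * h\<^sup>2)"
    by (rule lin) (use C X Y in \<open>simp_all add: mult.assoc\<close>)
  also have "\<dots> = - 3 * \<epsilon>\<^sup>2 * (v\<^sup>2 + w\<^sup>2 + h\<^sup>2)" by (simp add: algebra_simps)
  finally show ?thesis .
qed

lemma lyapunov_equivalent:
  fixes v w h :: complex and \<epsilon> :: real
  assumes e: "0 \<le> \<epsilon>" "\<epsilon> \<le> 1/16"
  defines "L \<equiv> ((norm v)\<^sup>2 + (norm w)\<^sup>2 + (norm h)\<^sup>2) / 2 + \<epsilon> * (h \<bullet> v + (w \<bullet> v) / 2)"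
  shows "L \<le> 3/4 * ((norm v)\<^sup>2 + (norm w)\<^sup>2 + (norm h)\<^sup>2)"
    and "((norm v)\<^sup>2 + (norm w)\<^sup>2 + (norm h)\<^sup>2) / 4 \<le> L"
proof -
  let ?E = "(norm v)\<^sup>2 + (norm w)\<^sup>2 + (norm h)\<^sup>2"
  have am: "\<bar>x \<bullet> y\<bar> \<le> ((norm x)\<^sup>2 + (norm y)\<^sup>2) / 2" for x y :: complex
  proof -
    have "0 \<le> (norm x - norm y)\<^sup>2" by simp
    hence "norm x * norm y \<le> ((norm x)\<^sup>2 + (norm y)\<^sup>2) / 2"
      by (simp add: power2_eq_square algebra_simps)
    with Cauchy_Schwarz_ineq2[of x y] show ?thesis by linarith
  qed
  have "\<bar>h \<bullet> v + (w \<bullet> v) / 2\<bar> \<le> ?E"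
  proof -
    have "\<bar>h \<bullet> v + (w \<bullet> v) / 2\<bar> \<le> \<bar>h \<bullet> v\<bar> + \<bar>w \<bullet> v\<bar> / 2"
      using abs_triangle_ineq[of "h \<bullet> v" "(w \<bullet> v) / 2"] by simp
    also have "\<dots> \<le> ((norm h)\<^sup>2 + (norm v)\<^sup>2) / 2 + ((norm w)\<^sup>2 + (norm v)\<^sup>2) / 2 / 2"
      using am[of h v] am[of w v] by (intro add_mono divide_right_mono) auto
    also have "\<dots> \<le> ?E"
      using zero_le_power2[of "norm w"] zero_le_power2[of "norm h"] zero_le_power2[of "norm v"]
      by (simp add: field_simps)
    finally show ?thesis .
  qed
  hence "\<epsilon> * \<bar>h \<bullet> v + (w \<bullet> v) / 2\<bar> \<le> (1/16) * ?E"
    using e by (intro mult_mono) auto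
  moreover have "\<bar>\<epsilon> * (h \<bullet> v + (w \<bullet> v) / 2)\<bar> = \<epsilon> * \<bar>h \<bullet> v + (w \<bullet> v) / 2\<bar>"
    using e by (simp add: abs_mult)
  ultimately have "\<bar>\<epsilon> * (h \<bullet> v + (w \<bullet> v) / 2)\<bar> \<le> ?E / 16" by simp
  moreover have "0 \<le> ?E" by simp
  ultimately show "L \<le> 3/4 * ?E" "?E / 4 \<le> L" unfolding L_def by linarith+
qed

lemma gronwall_exponential:
  fixes L :: "real \<Rightarrow> real"
  assumes cont: "continuous_on {0..} L" and t: "t \<ge> 0"
    and D: "\<And>s. s > 0 \<Longrightarrow> \<exists>l. (L has_real_derivative l) (at s) \<and> l \<le> - \<gamma> * L s"
  shows "L t \<le> L 0 * exp (- \<gamma> * t)"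
proof -
  have "(\<lambda>s. exp (\<gamma> * s) * L s) t \<le> (\<lambda>s. exp (\<gamma> * s) * L s) 0"
  proof (rule DERIV_nonpos_imp_decreasing_open[OF t])
    fix s :: real assume s: "0 < s" "s < t"
    then obtain l where l: "(L has_real_derivative l) (at s)" "l \<le> - \<gamma> * L s" using D by blast
    have "((\<lambda>s. exp (\<gamma> * s) * L s) has_real_derivative exp (\<gamma> * s) * (\<gamma> * L s + l)) (at s)"
      by (auto intro!: derivative_eq_intros l(1) simp: algebra_simps)
    moreover have "exp (\<gamma> * s) * (\<gamma> * L s + l) \<le> 0"
      using l(2) by (intro mult_nonneg_nonpos) auto
    ultimately show "\<exists>y. ((\<lambda>s. exp (\<gamma> * s) * L s) has_real_derivative y) (at s) \<and> y \<le> 0" by blast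
  next
    show "continuous_on {0..t} (\<lambda>s. exp (\<gamma> * s) * L s)"
      using continuous_on_subset[OF cont] by (intro continuous_intros) auto
  qed
  hence "exp (\<gamma> * t) * L t \<le> L 0" by simp
  thus ?thesis by (simp add: exp_minus field_simps)
qed

lemma has_real_derivative_inner:
  fixes f g :: "real \<Rightarrow> 'b::real_inner"
  assumes "(f has_vector_derivative f') (at x)" "(g has_vector_derivative g') (at x)"
  shows "((\<lambda>t. f t \<bullet> g t) has_real_derivative (f x \<bullet> g' + f' \<bullet> g x)) (at x)"
  using bounded_bilinear.has_vector_derivative[OF bounded_bilinear_inner assms]
  unfolding has_real_derivative_iff_has_vector_derivative .

text \<open>
  The energy by itself only dissipates \<open>\<Theta>\<close>. The cross terms \<open>\<epsilon>(\<Theta> \<bullet> V + r\<^sup>2U \<bullet> V/2)\<close> pass this on to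
  \<open>V\<close> and \<open>U\<close>: the derivative of the first contains \<open>-r\<^sup>2|V|\<^sup>2\<close>, and the second trades half of that for
  \<open>-r\<^sup>2|r\<^sup>2U|\<^sup>2/2\<close>. Their derivatives also contain \<open>(r\<^sup>2 + \<sigma>)(\<Theta> \<bullet> V)\<close>, which forces \<open>\<epsilon>\<close> to be of size
  \<open>r\<^sup>2/(r\<^sup>2 + \<sigma>)\<close> and limits the rate to a multiple of \<open>r\<^sup>4/(r\<^sup>2 + \<sigma>)\<close>. That is comparable to \<open>r\<^sup>4/\<sigma>\<close>
  for small \<open>r\<close> and bounded below for \<open>r \<ge> 1\<close>.
\<close>

lemma (in thermoelastic_mode) energy_decay:
  assumes t: "t \<ge> 0"
  shows "(norm (V t))\<^sup>2 + r^4 * (norm (U t))\<^sup>2 + (norm (\<Theta> t))\<^sup>2 \<le>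
    3 * ((norm (V 0))\<^sup>2 + r^4 * (norm (U 0))\<^sup>2 + (norm (\<Theta> 0))\<^sup>2) * exp (- (r^4 / (64 * (r\<^sup>2 + \<sigma>))) * t)"
proof -
  define \<rho> where "\<rho> = r\<^sup>2 + \<sigma>"
  \<comment> \<open>the largest weight of the cross terms that the dissipation can absorb, up to a constant\<close>
  define \<epsilon> where "\<epsilon> = r\<^sup>2 / (16 * \<rho>)"
  define W where "W t = r\<^sup>2 *\<^sub>R U t" for t
  have \<rho>: "\<rho> > 0" using \<sigma> by (simp add: \<rho>_def add_nonneg_pos)
  have q: "r\<^sup>2 = 16 * \<epsilon> * \<rho>" using \<rho> by (simp add: \<epsilon>_def)
  have e: "0 \<le> \<epsilon>" "\<epsilon> \<le> 1/16" using \<rho> \<sigma> by (auto simp: \<epsilon>_def divide_le_eq) (simp add: \<rho>_def)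
  define E where "E t = (norm (V t))\<^sup>2 + (norm (W t))\<^sup>2 + (norm (\<Theta> t))\<^sup>2" for t
  define L where "L t = E t / 2 + \<epsilon> * (\<Theta> t \<bullet> V t + (W t \<bullet> V t) / 2)" for t
  have EL: "L t \<le> 3/4 * E t" "E t / 4 \<le> L t" for t
    using lyapunov_equivalent[OF e, of "V t" "W t" "\<Theta> t"] by (auto simp: L_def E_def)
  have r4: "r^4 = r\<^sup>2 * r\<^sup>2" by (simp add: power2_eq_square power4_eq_xxxx)
  have DW: "(W has_vector_derivative r\<^sup>2 *\<^sub>R V t) (at t)" if "t > 0" for t
    unfolding W_def using DU[OF that] by (auto intro!: derivative_eq_intros)
  have DV': "(V has_vector_derivative (r\<^sup>2 *\<^sub>R \<Theta> t - r\<^sup>2 *\<^sub>R W t)) (at t)" if "t > 0" for t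
    using DV[OF that] unfolding W_def scaleR_scaleR r4[symmetric] .
  have D\<Theta>': "(\<Theta> has_vector_derivative (- \<rho> *\<^sub>R \<Theta> t - r\<^sup>2 *\<^sub>R V t)) (at t)" if "t > 0" for t
    using D\<Theta>[OF that] by (simp add: \<rho>_def)
  have contW: "continuous_on {0..} W" unfolding W_def using cont by (intro continuous_intros)
  have "L t \<le> L 0 * exp (- (r^4 / (64 * \<rho>)) * t)"
  proof (rule gronwall_exponential[OF _ t])
    show "continuous_on {0..} L" unfolding L_def E_def using cont contW by (intro continuous_intros) auto
    fix s :: real assume s: "s > 0"
    define v w h where "v = V s" and "w = W s" and "h = \<Theta> s"
    let ?l = "(v \<bullet> (r\<^sup>2 *\<^sub>R h - r\<^sup>2 *\<^sub>R w)) + (w \<bullet> r\<^sup>2 *\<^sub>R v) + (h \<bullet> (- \<rho> *\<^sub>R h - r\<^sup>2 *\<^sub>R v))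
        + \<epsilon> * ((h \<bullet> (r\<^sup>2 *\<^sub>R h - r\<^sup>2 *\<^sub>R w) + (- \<rho> *\<^sub>R h - r\<^sup>2 *\<^sub>R v) \<bullet> v)
            + (w \<bullet> (r\<^sup>2 *\<^sub>R h - r\<^sup>2 *\<^sub>R w) + (r\<^sup>2 *\<^sub>R v) \<bullet> v) / 2)"
    have Leq: "L = (\<lambda>t. (V t \<bullet> V t + W t \<bullet> W t + \<Theta> t \<bullet> \<Theta> t) / 2 + \<epsilon> * (\<Theta> t \<bullet> V t + (W t \<bullet> V t) / 2))"
      unfolding L_def E_def by (simp add: dot_square_norm)
    have dL: "(L has_real_derivative ?l) (at s)"
    proof -
      have "(L has_real_derivative
          ((V s \<bullet> (r\<^sup>2 *\<^sub>R \<Theta> s - r\<^sup>2 *\<^sub>R W s) + (r\<^sup>2 *\<^sub>R \<Theta> s - r\<^sup>2 *\<^sub>R W s) \<bullet> V s)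
           + (W s \<bullet> r\<^sup>2 *\<^sub>R V s + r\<^sup>2 *\<^sub>R V s \<bullet> W s)
           + (\<Theta> s \<bullet> (- \<rho> *\<^sub>R \<Theta> s - r\<^sup>2 *\<^sub>R V s) + (- \<rho> *\<^sub>R \<Theta> s - r\<^sup>2 *\<^sub>R V s) \<bullet> \<Theta> s)) / 2
          + \<epsilon> * ((\<Theta> s \<bullet> (r\<^sup>2 *\<^sub>R \<Theta> s - r\<^sup>2 *\<^sub>R W s) + (- \<rho> *\<^sub>R \<Theta> s - r\<^sup>2 *\<^sub>R V s) \<bullet> V s)
            + (W s \<bullet> (r\<^sup>2 *\<^sub>R \<Theta> s - r\<^sup>2 *\<^sub>R W s) + r\<^sup>2 *\<^sub>R V s \<bullet> V s) / 2)) (at s)"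
        unfolding Leq
        by (intro DERIV_add DERIV_cdivide DERIV_cmult has_real_derivative_inner
            DW[OF s] DV'[OF s] D\<Theta>'[OF s])
      thus ?thesis unfolding v_def w_def h_def
        by (rule DERIV_cong) (simp add: inner_commute field_simps)
    qed
    have "?l = \<rho> * (- (norm h)\<^sup>2 + \<epsilon> * (- 8 * \<epsilon> * (norm v)\<^sup>2 - 8 * \<epsilon> * (norm w)\<^sup>2 + 16 * \<epsilon> * (norm h)\<^sup>2
          - h \<bullet> v - 8 * \<epsilon> * (h \<bullet> w)))"
      unfolding q by (simp add: inner_diff_left inner_diff_right inner_commute dot_square_norm field_simps)
    also have "\<dots> \<le> \<rho> * (- 3 * \<epsilon>\<^sup>2 * ((norm v)\<^sup>2 + (norm w)\<^sup>2 + (norm h)\<^sup>2))"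
      using \<rho> by (intro mult_left_mono lyapunov_algebra e Cauchy_Schwarz_ineq2) auto
    also have "\<dots> = - (4 * \<rho> * \<epsilon>\<^sup>2) * (3/4 * E s)" by (simp add: E_def v_def w_def h_def algebra_simps)
    also have "\<dots> \<le> - (4 * \<rho> * \<epsilon>\<^sup>2) * L s" using EL(1)[of s] \<rho> by (intro mult_left_mono_neg) auto
    also have "4 * \<rho> * \<epsilon>\<^sup>2 = r^4 / (64 * \<rho>)" unfolding r4 q using \<rho> by (simp add: power2_eq_square field_simps)
    finally show "\<exists>l. (L has_real_derivative l) (at s) \<and> l \<le> - (r^4 / (64 * \<rho>)) * L s"
      using dL by blast
  qed
  also have "\<dots> \<le> (3/4 * E 0) * exp (- (r^4 / (64 * \<rho>)) * t)"
    using EL(1)[of 0] by (intro mult_right_mono) auto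
  finally have bound: "E t \<le> 3 * E 0 * exp (- (r^4 / (64 * \<rho>)) * t)" using EL(2)[of t] by simp
  have E_eq: "E t = (norm (V t))\<^sup>2 + r^4 * (norm (U t))\<^sup>2 + (norm (\<Theta> t))\<^sup>2" for t
    by (simp add: E_def W_def power_mult_distrib)
  show ?thesis using bound unfolding E_eq \<rho>_def .
qed

lemma frequency_decay:
  assumes \<sigma>: "\<sigma> > 0" and t: "t \<ge> 0" and sol: "frequency_ode_solution \<sigma> r a b c U \<Theta>"
  shows "r^4 * (norm (U t))\<^sup>2 \<le>
    3 * ((norm b)\<^sup>2 + r^4 * (norm a)\<^sup>2 + (norm c)\<^sup>2) * exp (- (r^4 / (64 * (r\<^sup>2 + \<sigma>))) * t)"
proof -
  obtain V where mode: "thermoelastic_mode \<sigma> r U V \<Theta>"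
    and ini: "U 0 = a" "V 0 = b" "\<Theta> 0 = c"
    using frequency_ode_solution_mode[OF \<sigma> sol] .
  interpret thermoelastic_mode \<sigma> r U V \<Theta> by (rule mode)
  have "r^4 * (norm (U t))\<^sup>2 \<le> (norm (V t))\<^sup>2 + r^4 * (norm (U t))\<^sup>2 + (norm (\<Theta> t))\<^sup>2" by simp
  also note energy_decay[OF t]
  finally show ?thesis unfolding ini .
qed

text \<open>
  The energy controls only \<open>r\<^sup>2U\<close>. For \<open>r\<^sup>2t \<le> 1\<close> it is better to use its bound on \<open>U\<^sub>t\<close> and integrate.
\<close>

lemma frequency_growth:
  assumes \<sigma>: "\<sigma> > 0" and t: "t \<ge> 0" and sol: "frequency_ode_solution \<sigma> r a b c U \<Theta>"
  shows "norm (U t) \<le> norm a + t * sqrt (3 * ((norm b)\<^sup>2 + r^4 * (norm a)\<^sup>2 + (norm c)\<^sup>2))"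
proof (cases "t = 0")
  case True
  have "U 0 = a" using sol by (auto simp: frequency_ode_solution_def)
  with True show ?thesis by simp
next
  case False
  with t have t: "t > 0" by simp
  obtain V where mode: "thermoelastic_mode \<sigma> r U V \<Theta>"
    and ini: "U 0 = a" "V 0 = b" "\<Theta> 0 = c"
    using frequency_ode_solution_mode[OF \<sigma> sol] .
  interpret thermoelastic_mode \<sigma> r U V \<Theta> by (rule mode)
  define E where "E = (norm b)\<^sup>2 + r^4 * (norm a)\<^sup>2 + (norm c)\<^sup>2"
  have E: "E \<ge> 0" by (simp add: E_def)
  have nV: "norm (V s) \<le> sqrt (3 * E)" if s: "s \<ge> 0" for s
  proof (rule real_le_rsqrt)
    have "(norm (V s))\<^sup>2 \<le> (norm (V s))\<^sup>2 + r^4 * (norm (U s))\<^sup>2 + (norm (\<Theta> s))\<^sup>2" by simp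
    also have "\<dots> \<le> 3 * E * exp (- (r^4 / (64 * (r\<^sup>2 + \<sigma>))) * s)"
      using energy_decay[OF s] unfolding ini E_def .
    also have "\<dots> \<le> 3 * E * 1" using E s \<sigma> by (intro mult_left_mono) auto
    finally show "(norm (V s))\<^sup>2 \<le> 3 * E" by simp
  qed
  have "norm (U t - U 0) \<le> t * sqrt (3 * E) - 0 * sqrt (3 * E)"
  proof (rule differentiable_bound_general[OF t, where f' = V and \<phi>' = "\<lambda>_. sqrt (3 * E)"])
    show "continuous_on {0..t} U" by (rule continuous_on_subset[OF cont(1)]) auto
    show "norm (V x) \<le> sqrt (3 * E)" if "0 < x" for x using nV[of x] that by simp
  qed (auto intro!: continuous_intros DU derivative_eq_intros)
  moreover have "norm (U t) \<le> norm (U 0) + norm (U t - U 0)" by (rule norm_triangle_sub)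
  ultimately show ?thesis unfolding ini E_def by linarith
qed

text \<open>
  The temperature relaxes at least at the rate \<open>\<sigma>\<close> and is driven by \<open>-r\<^sup>2V\<close>. Once its initial value has
  died out it is thus of size \<open>r\<^sup>2|V|\<close>, which makes its feedback on the displacement a term of order \<open>r\<^sup>4\<close>.
\<close>

lemma (in thermoelastic_mode) temperature_bound:
  assumes s: "0 < s" "s \<le> T"
    and M: "\<And>s. 0 \<le> s \<Longrightarrow> s \<le> T \<Longrightarrow> norm (V s) \<le> M"
  shows "norm (\<Theta> s) \<le> exp (- \<sigma> * s) * norm (\<Theta> 0) + r\<^sup>2 * M / \<sigma>"
proof -
  define \<rho> where "\<rho> = r\<^sup>2 + \<sigma>"
  have \<rho>: "\<rho> \<ge> \<sigma>" "\<rho> > 0" using \<sigma> by (simp_all add: \<rho>_def add_nonneg_pos)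
  have M0: "0 \<le> M" using M[of 0] s norm_ge_zero[of "V 0"] by linarith
  have "norm (exp (\<rho> * s) *\<^sub>R \<Theta> s - exp (\<rho> * 0) *\<^sub>R \<Theta> 0) \<le> (r\<^sup>2 * M / \<rho>) * exp (\<rho> * s) - (r\<^sup>2 * M / \<rho>) * exp (\<rho> * 0)"
  proof (rule differentiable_bound_general[OF s(1), where f' = "\<lambda>t. - (exp (\<rho> * t) * r\<^sup>2) *\<^sub>R V t"
      and \<phi>' = "\<lambda>t. r\<^sup>2 * M * exp (\<rho> * t)"])
    show "continuous_on {0..s} (\<lambda>s. exp (\<rho> * s) *\<^sub>R \<Theta> s)"
      using continuous_on_subset[OF cont(3)] by (intro continuous_intros) auto
    fix x :: real assume x: "0 < x" "x < s"
    show "((\<lambda>s. exp (\<rho> * s) *\<^sub>R \<Theta> s) has_vector_derivative - (exp (\<rho> * x) * r\<^sup>2) *\<^sub>R V x) (at x)"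
      by (rule derivative_eq_intros D\<Theta>[OF x(1)] refl)+ (simp add: \<rho>_def algebra_simps)
    show "((\<lambda>t. (r\<^sup>2 * M / \<rho>) * exp (\<rho> * t)) has_vector_derivative r\<^sup>2 * M * exp (\<rho> * x)) (at x)"
      unfolding has_real_derivative_iff_has_vector_derivative[symmetric]
      using \<rho> by (auto intro!: derivative_eq_intros)
    show "norm (- (exp (\<rho> * x) * r\<^sup>2) *\<^sub>R V x) \<le> r\<^sup>2 * M * exp (\<rho> * x)"
    proof -
      have "norm (- (exp (\<rho> * x) * r\<^sup>2) *\<^sub>R V x) = (exp (\<rho> * x) * r\<^sup>2) * norm (V x)" by simp
      also have "\<dots> \<le> (exp (\<rho> * x) * r\<^sup>2) * M" using M[of x] x s by (intro mult_left_mono) auto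
      finally show ?thesis by (simp add: mult_ac)
    qed
  qed (intro continuous_intros)
  hence 1: "norm (exp (\<rho> * s) *\<^sub>R \<Theta> s - \<Theta> 0) \<le> (r\<^sup>2 * M / \<rho>) * exp (\<rho> * s)"
    using M0 \<rho> by (auto elim!: order.trans)
  have "exp (\<rho> * s) * norm (\<Theta> s) = norm (exp (\<rho> * s) *\<^sub>R \<Theta> s)" by simp
  also have "\<dots> \<le> norm (\<Theta> 0) + norm (exp (\<rho> * s) *\<^sub>R \<Theta> s - \<Theta> 0)" by (rule norm_triangle_sub)
  also have "\<dots> \<le> norm (\<Theta> 0) + (r\<^sup>2 * M / \<rho>) * exp (\<rho> * s)" using 1 by simp
  finally have "norm (\<Theta> s) \<le> exp (- \<rho> * s) * norm (\<Theta> 0) + r\<^sup>2 * M / \<rho>"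
    by (simp add: exp_minus field_simps)
  also have "\<dots> \<le> exp (- \<sigma> * s) * norm (\<Theta> 0) + r\<^sup>2 * M / \<sigma>"
    using \<rho> \<sigma> s M0 by (intro add_mono mult_right_mono divide_left_mono) auto
  finally show ?thesis .
qed

text \<open>
  For \<open>\<Theta> = 0\<close> the combinations \<open>V \<plusminus> \<i>r\<^sup>2U\<close> rotate with angular velocity \<open>\<plusminus>r\<^sup>2\<close>. In the rotating frame
  their derivative has norm \<open>r\<^sup>2|\<Theta>|\<close>, and \<open>temperature_bound\<close> is integrated over \<open>[0, s]\<close>.
\<close>

lemma (in thermoelastic_mode) rotating_frame_bound:
  assumes s: "0 < s" "s \<le> T" and j: "j = \<i> \<or> j = - \<i>"
    and M: "\<And>s. 0 \<le> s \<Longrightarrow> s \<le> T \<Longrightarrow> norm (V s) \<le> M"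
  shows "norm ((V s + j * of_real (r\<^sup>2) * U s) - exp (j * of_real (r\<^sup>2 * s)) * (V 0 + j * of_real (r\<^sup>2) * U 0))
    \<le> r\<^sup>2 * norm (\<Theta> 0) / \<sigma> + r^4 * s * M / \<sigma>"
proof -
  define Z where "Z t = exp (- j * of_real r^2 * of_real t) * (V t + j * of_real r^2 * U t)" for t
  have j2: "j * j = -1" using j by auto
  have nexp: "norm (exp (- j * of_real r^2 * of_real t)) = 1" for t :: real
    using j by (auto simp: power2_eq_square norm_exp_eq_Re)
  define \<phi> where "\<phi> t = r\<^sup>2 * (- (norm (\<Theta> 0) / \<sigma>) * exp (- \<sigma> * t) + r\<^sup>2 * M / \<sigma> * t)" for t
  have "norm (Z s - Z 0) \<le> \<phi> s - \<phi> 0"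
  proof (rule differentiable_bound_general[OF s(1), where f' = "\<lambda>t. exp (- j * of_real r^2 * of_real t) * of_real r^2 * \<Theta> t"
      and \<phi>' = "\<lambda>t. r\<^sup>2 * (exp (- \<sigma> * t) * norm (\<Theta> 0) + r\<^sup>2 * M / \<sigma>)"])
    show "continuous_on {0..s} Z" unfolding Z_def
      using continuous_on_subset[OF cont(1), of "{0..s}"] continuous_on_subset[OF cont(2), of "{0..s}"]
      by (intro continuous_intros) auto
    show "continuous_on {0..s} \<phi>" unfolding \<phi>_def by (intro continuous_intros)
    fix x :: real assume x: "0 < x" "x < s"
    have De: "((\<lambda>t::real. exp (- j * of_real r^2 * of_real t)) has_vector_derivative
        (- j * of_real r^2) * exp (- j * of_real r^2 * of_real x)) (at x)"
      by (rule derivative_eq_intros refl has_vector_derivative_real_field)+ simp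
    have DV2: "(V has_vector_derivative (of_real r^2 * \<Theta> x - of_real r^4 * U x)) (at x)"
      using DV[OF x(1)] by (simp add: scaleR_conv_of_real)
    have DW: "((\<lambda>t. j * of_real r^2 * U t) has_vector_derivative j * of_real r^2 * V x) (at x)"
      by (rule derivative_eq_intros DU[OF x(1)] refl)+ simp
    have "(Z has_vector_derivative exp (- j * of_real r^2 * of_real x) * ((of_real r^2 * \<Theta> x - of_real r^4 * U x) + j * of_real r^2 * V x)
       + (- j * of_real r^2) * exp (- j * of_real r^2 * of_real x) * (V x + j * of_real r^2 * U x)) (at x)"
      unfolding Z_def by (rule has_vector_derivative_mult De has_vector_derivative_add DV2 DW)+
    moreover have "exp (- j * of_real r^2 * of_real x) * ((of_real r^2 * \<Theta> x - of_real r^4 * U x) + j * of_real r^2 * V x)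
       + (- j * of_real r^2) * exp (- j * of_real r^2 * of_real x) * (V x + j * of_real r^2 * U x)
       = exp (- j * of_real r^2 * of_real x) * (of_real r^2 * \<Theta> x - of_real r^4 * U x - (j * j) * of_real r^4 * U x)"
      by (simp add: algebra_simps power2_eq_square power4_eq_xxxx)
    ultimately show "(Z has_vector_derivative exp (- j * of_real r^2 * of_real x) * of_real r^2 * \<Theta> x) (at x)"
      by (simp add: j2 mult.assoc)
    show "(\<phi> has_vector_derivative r\<^sup>2 * (exp (- \<sigma> * x) * norm (\<Theta> 0) + r\<^sup>2 * M / \<sigma>)) (at x)"
      unfolding \<phi>_def has_real_derivative_iff_has_vector_derivative[symmetric]
      using \<sigma> by (auto intro!: derivative_eq_intros)
    have "norm (exp (- j * of_real r^2 * of_real x) * of_real r^2 * \<Theta> x) = r\<^sup>2 * norm (\<Theta> x)"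
      by (simp only: norm_mult nexp) (simp add: norm_power)
    also have "\<dots> \<le> r\<^sup>2 * (exp (- \<sigma> * x) * norm (\<Theta> 0) + r\<^sup>2 * M / \<sigma>)"
      using x s by (intro mult_left_mono temperature_bound[OF _ _ M]) auto
    finally show "norm (exp (- j * of_real r^2 * of_real x) * of_real r^2 * \<Theta> x) \<le> \<dots>" .
  qed
  also have "\<dots> = r\<^sup>2 * norm (\<Theta> 0) / \<sigma> * (1 - exp (- \<sigma> * s)) + r^4 * s * M / \<sigma>"
    using \<sigma> by (simp add: \<phi>_def power4_eq_xxxx power2_eq_square field_simps)
  also have "\<dots> \<le> r\<^sup>2 * norm (\<Theta> 0) / \<sigma> * 1 + r^4 * s * M / \<sigma>"
    using \<sigma> by (intro add_mono mult_left_mono) auto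
  finally have 1: "norm (Z s - Z 0) \<le> r\<^sup>2 * norm (\<Theta> 0) / \<sigma> + r^4 * s * M / \<sigma>" by simp
  have "norm (exp (j * of_real (r\<^sup>2 * s))) = 1" using j by (auto simp: norm_exp_eq_Re)
  hence "norm (Z s - Z 0) = norm (exp (j * of_real (r\<^sup>2 * s)) * (Z s - Z 0))" by (simp add: norm_mult)
  also have "exp (j * of_real (r\<^sup>2 * s)) * (Z s - Z 0) =
     exp (j * of_real (r\<^sup>2 * s)) * exp (- j * of_real r^2 * of_real s) * (V s + j * of_real (r\<^sup>2) * U s)
     - exp (j * of_real (r\<^sup>2 * s)) * (V 0 + j * of_real (r\<^sup>2) * U 0)"
    by (simp add: Z_def algebra_simps)
  also have "exp (j * of_real (r\<^sup>2 * s)) * exp (- j * of_real r^2 * of_real s) = 1"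
    by (simp add: exp_add[symmetric])
  finally show ?thesis using 1 by simp
qed

text \<open>
  The sine comes from the difference of the two rotating combinations. Their half sum bounds \<open>V\<close>: its
  maximum \<open>M\<close> on \<open>[0, T]\<close> is at most the size of the data plus \<open>(r\<^sup>4T/\<sigma>) M\<close>, and by the smallness
  assumption the last term can be absorbed. In the error, \<open>a\<close> and \<open>c\<close> carry the factor \<open>r\<^sup>2\<close>, and
  \<open>b\<close> carries the small factor \<open>r\<^sup>4T/\<sigma>\<close>.
\<close>

lemma frequency_profile:
  assumes \<sigma>: "\<sigma> > 0" and T: "T > 0" and small: "2 * r^4 * T \<le> \<sigma>"
    and sol: "frequency_ode_solution \<sigma> r a b c U \<Theta>"
  shows "norm (of_real (r\<^sup>2) * U T - of_real (sin (r\<^sup>2 * T)) * b)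
    \<le> 2 * r\<^sup>2 * (norm a + norm c / \<sigma>) + 2 * (r^4 * T) / \<sigma> * norm b"
proof -
  obtain V where mode: "thermoelastic_mode \<sigma> r U V \<Theta>"
    and ini: "U 0 = a" "V 0 = b" "\<Theta> 0 = c"
    using frequency_ode_solution_mode[OF \<sigma> sol] .
  interpret thermoelastic_mode \<sigma> r U V \<Theta> by (rule mode)
  have "continuous_on {0..T} (\<lambda>s. norm (V s))"
    using continuous_on_subset[OF cont(2), of "{0..T}"] by (intro continuous_intros) auto
  then obtain s where s: "s \<in> {0..T}" and smax: "\<And>s'. s' \<in> {0..T} \<Longrightarrow> norm (V s') \<le> norm (V s)"
    using continuous_attains_sup[of "{0..T}" "\<lambda>s. norm (V s)"] T by force
  define M where "M = norm (V s)"
  have M: "norm (V s') \<le> M" if "0 \<le> s'" "s' \<le> T" for s' using smax that by (simp add: M_def)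
  define q where "q = r\<^sup>2"
  define e where "e = r\<^sup>2 * norm c / \<sigma>"
  define k where "k = r^4 * T / \<sigma>"
  have k: "0 \<le> k" "k \<le> 1/2" using small \<sigma> T by (auto simp: k_def divide_le_eq)
  have q0: "q \<ge> 0" by (simp add: q_def)
  have e0: "e \<ge> 0" using \<sigma> by (simp add: e_def)
  have M0: "M \<ge> 0" by (simp add: M_def)
  have rot: "norm ((V t + j * of_real q * U t) - exp (j * of_real (q * t)) * (b + j * of_real q * a)) \<le> e + k * M"
    if t: "0 < t" "t \<le> T" and j: "j = \<i> \<or> j = - \<i>" for t j
  proof -
    have "r^4 * t * M / \<sigma> \<le> k * M"
      unfolding k_def using t \<sigma> M0 by (simp add: divide_right_mono mult_left_mono mult_right_mono)
    thus ?thesis using rotating_frame_bound[OF t j M] by (simp add: ini q_def e_def)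
  qed
  \<comment> \<open>each of the two rotating terms has norm at most \<open>norm b + q * norm a\<close>\<close>
  have nexp: "norm (exp (\<i> * of_real x)) = 1" "norm (exp (- \<i> * of_real x)) = 1" for x :: real
    by (auto simp: norm_exp_eq_Re)
  have amp: "norm (exp (\<i> * of_real x) * (b + \<i> * of_real q * a)) \<le> norm b + q * norm a"
     "norm (exp (- \<i> * of_real x) * (b + - \<i> * of_real q * a)) \<le> norm b + q * norm a" for x :: real
    using norm_triangle_ineq[of b "\<i> * of_real q * a"] norm_triangle_ineq[of b "- \<i> * of_real q * a"] q0
    by (auto simp: norm_mult nexp[simplified])
  have Mle: "M \<le> norm b + q * norm a + e + k * M"
  proof (cases "s = 0")
    case True thus ?thesis using ini q0 e0 k M0 by (simp add: M_def)
  next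
    case False
    hence s': "0 < s" "s \<le> T" using s by auto
    define P where "P = V s + \<i> * of_real q * U s"
    define N where "N = V s + - \<i> * of_real q * U s"
    have "norm P \<le> norm b + q * norm a + (e + k * M)"
      using rot[OF s', of \<i>, OF disjI1[OF refl]] amp(1)[of "q * s"]
        norm_triangle_sub[of P "exp (\<i> * of_real (q * s)) * (b + \<i> * of_real q * a)"]
      unfolding P_def by linarith
    moreover have "norm N \<le> norm b + q * norm a + (e + k * M)"
      using rot[OF s', of "-\<i>", OF disjI2[OF refl]] amp(2)[of "q * s"]
        norm_triangle_sub[of N "exp (- \<i> * of_real (q * s)) * (b + - \<i> * of_real q * a)"]
      unfolding N_def by linarith
    moreover have "2 * M \<le> norm P + norm N"
    proof -
      have "P + N = 2 * V s" by (simp add: P_def N_def)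
      hence "norm (P + N) = 2 * M" by (simp add: M_def norm_mult)
      thus ?thesis using norm_triangle_ineq[of P N] by simp
    qed
    ultimately show ?thesis by linarith
  qed
  moreover have "k * M \<le> 1/2 * M" using k M0 by (intro mult_right_mono) auto
  ultimately have M2: "M \<le> 2 * (norm b + q * norm a + e)" by (simp add: algebra_simps)
  have kM: "k * M \<le> q * norm a + e + 2 * k * norm b"
  proof -
    have "k * M \<le> k * (2 * (norm b + q * norm a + e))" using M2 k by (intro mult_left_mono) auto
    also have "\<dots> = 2 * k * norm b + (2 * k) * (q * norm a + e)" by (simp add: algebra_simps)
    also have "\<dots> \<le> 2 * k * norm b + 1 * (q * norm a + e)"
      using k q0 e0 by (intro add_mono mult_right_mono) auto
    finally show ?thesis by simp
  qed
  define P where "P = (V T + \<i> * of_real q * U T) - exp (\<i> * of_real (q * T)) * (b + \<i> * of_real q * a)"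
  define N where "N = (V T + - \<i> * of_real q * U T) - exp (- \<i> * of_real (q * T)) * (b + - \<i> * of_real q * a)"
  have PN: "norm P \<le> e + k * M" "norm N \<le> e + k * M"
    using rot[of T \<i>] rot[of T "-\<i>"] T by (auto simp: P_def N_def simp del: of_real_mult)
  have "of_real q * U T - of_real (sin (q * T)) * b = (P - N) / (2 * \<i>) + of_real (q * cos (q * T)) * a"
  proof -
    define X Y where "X = exp (\<i> * of_real (q * T))" and "Y = exp (- \<i> * of_real (q * T))"
    have "of_real (sin (q * T)) = (X - Y) / (2 * \<i>)"
      unfolding sin_of_real[symmetric] sin_exp_eq X_def Y_def by simp
    moreover have "of_real (q * cos (q * T)) = of_real q * ((X + Y) / 2)"
      unfolding of_real_mult cos_of_real[symmetric] cos_exp_eq X_def Y_def by simp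
    ultimately show ?thesis unfolding P_def N_def X_def[symmetric] Y_def[symmetric]
      by (simp only:) (simp add: field_simps)
  qed
  hence "norm (of_real q * U T - of_real (sin (q * T)) * b)
      \<le> norm ((P - N) / (2 * \<i>)) + norm (of_real (q * cos (q * T)) * a)" by (metis norm_triangle_ineq)
  also have "norm ((P - N) / (2 * \<i>)) \<le> e + k * M"
    using norm_triangle_ineq4[of P N] PN by (simp add: norm_divide norm_mult)
  also have "norm (of_real (q * cos (q * T)) * a) \<le> q * norm a"
    using q0 by (simp add: norm_mult abs_mult mult_left_le mult_right_mono)
  also note kM
  also have "e + (q * norm a + e + 2 * k * norm b) + q * norm a = 2 * r\<^sup>2 * (norm a + norm c / \<sigma>) + 2 * (r^4 * T) / \<sigma> * norm b"
    by (simp add: e_def k_def q_def algebra_simps)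
  finally show ?thesis by (simp add: q_def)
qed

section \<open>Gaussians and continuity of translations\<close>

definition gaussian :: "'a::euclidean_space \<Rightarrow> real" where
  "gaussian x = exp (- (norm x)\<^sup>2 / 2)"

lemma gaussian_measurable [measurable]: "gaussian \<in> borel_measurable borel"
  unfolding gaussian_def by measurable

lemma gaussian_nonneg [simp]: "0 \<le> gaussian x" and gaussian_le_1 [simp]: "gaussian x \<le> 1"
  by (simp_all add: gaussian_def)

text \<open>
  This is the characteristic function of the standard normal distribution without its normalising
  factor.
\<close>

lemma fourier_gaussian_real:
  fixes x :: real
  shows "integrable lborel (\<lambda>y::real. exp (- (\<i> * of_real (x * y))) * of_real (exp (- y\<^sup>2 / 2)))" (is ?I)
    and "(\<integral>y. exp (- (\<i> * of_real (x * y))) * of_real (exp (- y\<^sup>2 / 2)) \<partial>lborel)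
       = complex_of_real (sqrt (2 * pi) * exp (- x\<^sup>2 / 2))" (is ?E)
proof -
  have eq: "exp (- (\<i> * of_real (x * y))) * of_real (exp (- y\<^sup>2 / 2))
    = complex_of_real (sqrt (2 * pi)) * (std_normal_density y *\<^sub>R iexp ((- x) * y))" for y :: real
    by (simp add: std_normal_density_def scaleR_conv_of_real)
  have int: "integrable lborel (\<lambda>y. std_normal_density y *\<^sub>R iexp ((- x) * y))"
  proof (rule Bochner_Integration.integrable_bound)
    show "integrable lborel std_normal_density"
      using integrable_std_normal_moment[of 0] by simp
  qed (auto intro!: AE_I2)
  show ?I unfolding eq by (intro integrable_mult_right int)
  have "(\<integral>y. std_normal_density y *\<^sub>R iexp ((- x) * y) \<partial>lborel) = char std_normal_distribution (- x)"
    unfolding char_def by (subst integral_density) auto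
  also have "\<dots> = of_real (exp (- x\<^sup>2 / 2))" by (simp add: char_std_normal_distribution)
  finally show ?E unfolding eq by (subst integral_mult_right_zero) simp
qed

lemma
  fixes x :: "'a::euclidean_space"
  shows integrable_fourier_gaussian:
      "integrable lborel (\<lambda>y. exp (- (\<i> * of_real (x \<bullet> y))) * of_real (gaussian y))" (is ?I)
    and fourier_gaussian:
      "(\<integral>y. exp (- (\<i> * of_real (x \<bullet> y))) * of_real (gaussian y) \<partial>lborel)
       = complex_of_real (sqrt (2 * pi) ^ DIM('a) * gaussian x)" (is ?E)
proof -
  let ?P = "\<Pi>\<^sub>M b\<in>(Basis :: 'a set). (lborel :: real measure)"
  let ?h = "\<lambda>f :: 'a \<Rightarrow> real. \<Sum>b\<in>Basis. f b *\<^sub>R b"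
  let ?F = "\<lambda>y :: 'a. exp (- (\<i> * of_real (x \<bullet> y))) * complex_of_real (gaussian y)"
  let ?g = "\<lambda>b (t::real). exp (- (\<i> * of_real ((x \<bullet> b) * t))) * complex_of_real (exp (- t\<^sup>2 / 2))"
  interpret product_sigma_finite "\<lambda>_ :: 'a. lborel :: real measure" ..
  have F: "?F (?h f) = (\<Prod>b\<in>Basis. ?g b (f b))" for f
  proof -
    have 1: "x \<bullet> ?h f = (\<Sum>b\<in>Basis. (x \<bullet> b) * f b)"
      by (simp add: inner_sum_right mult.commute)
    have "(norm (?h f))\<^sup>2 = (\<Sum>b\<in>Basis. (?h f \<bullet> b)\<^sup>2)"
      unfolding power2_norm_eq_inner by (subst euclidean_inner) (simp only: power2_eq_square)
    also have "\<dots> = (\<Sum>b\<in>Basis. (f b)\<^sup>2)"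
      by (intro sum.cong refl) (simp add: inner_sum_left_Basis)
    finally have 2: "(norm (?h f))\<^sup>2 = (\<Sum>b\<in>Basis. (f b)\<^sup>2)" .
    have 3: "exp (- (\<i> * of_real (\<Sum>b\<in>Basis. (x \<bullet> b) * f b)))
        = (\<Prod>b\<in>Basis. exp (- (\<i> * of_real ((x \<bullet> b) * f b))))"
      by (simp only: of_real_sum sum_distrib_left sum_negf[symmetric] exp_sum[OF finite_Basis])
    have 4: "exp (- (\<Sum>b\<in>Basis. (f b)\<^sup>2) / 2) = (\<Prod>b\<in>Basis. exp (- (f b)\<^sup>2 / 2))"
      by (simp only: sum_negf[symmetric] sum_divide_distrib exp_sum[OF finite_Basis])
    show ?thesis
      unfolding gaussian_def 1 2 3 4 by (simp only: of_real_prod prod.distrib)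
  qed
  have M: "?F \<in> borel_measurable borel" by measurable
  have h: "?h \<in> measurable ?P borel" by measurable
  have "integrable ?P (\<lambda>f. \<Prod>b\<in>Basis. ?g b (f b))"
    by (intro product_integrable_prod fourier_gaussian_real) auto
  thus ?I unfolding lborel_eq[where 'a = 'a] by (subst integrable_distr_eq[OF h M]) (simp only: F)
  have "(\<integral>y. ?F y \<partial>lborel) = (\<integral>f. (\<Prod>b\<in>Basis. ?g b (f b)) \<partial>?P)"
    unfolding lborel_eq[where 'a = 'a] by (subst integral_distr[OF h M]) (simp only: F)
  also have "\<dots> = (\<Prod>b\<in>Basis. \<integral>t. ?g b t \<partial>lborel)"
    by (intro product_integral_prod fourier_gaussian_real) auto
  also have "\<dots> = (\<Prod>b\<in>(Basis::'a set). complex_of_real (sqrt (2 * pi) * exp (- (x \<bullet> b)\<^sup>2 / 2)))"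
    by (simp only: fourier_gaussian_real)
  also have "\<dots> = of_real (sqrt (2 * pi) ^ DIM('a) * exp (\<Sum>b\<in>Basis. - (x \<bullet> b)\<^sup>2 / 2))"
    by (simp only: of_real_prod[symmetric] prod.distrib prod_constant exp_sum[OF finite_Basis])
  also have "(\<Sum>b\<in>Basis. - (x \<bullet> b)\<^sup>2 / 2) = - (norm x)\<^sup>2 / 2"
  proof -
    have "(norm x)\<^sup>2 = (\<Sum>b\<in>Basis. (x \<bullet> b)\<^sup>2)"
      unfolding power2_norm_eq_inner by (subst euclidean_inner) (simp only: power2_eq_square)
    thus ?thesis by (simp only: sum_negf sum_divide_distrib[symmetric])
  qed
  finally show ?E by (simp add: gaussian_def)
qed

lemma
  shows integrable_gaussian: "integrable lborel (gaussian :: 'a::euclidean_space \<Rightarrow> real)"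
    and integral_gaussian: "(\<integral>x. gaussian (x::'a) \<partial>lborel) = sqrt (2 * pi) ^ DIM('a)"
proof -
  have "integrable lborel (\<lambda>y::'a. complex_of_real (gaussian y))"
    using integrable_fourier_gaussian[of "0::'a"] by simp
  thus "integrable lborel (gaussian :: 'a \<Rightarrow> real)" by (simp add: complex_of_real_integrable_eq)
  have "complex_of_real (\<integral>x. gaussian (x::'a) \<partial>lborel) = of_real (sqrt (2 * pi) ^ DIM('a))"
    using fourier_gaussian[of "0::'a"] by (simp add: gaussian_def)
  thus "(\<integral>x. gaussian (x::'a) \<partial>lborel) = sqrt (2 * pi) ^ DIM('a)" unfolding of_real_eq_iff .
qed

lemma nn_integral_lborel_affine:
  fixes t :: "'a::euclidean_space"
  assumes c: "c \<noteq> 0" and [measurable]: "f \<in> borel_measurable borel"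
  shows "(\<integral>\<^sup>+x. f x \<partial>lborel) = ennreal (\<bar>c\<bar> ^ DIM('a)) * (\<integral>\<^sup>+x. f (t + c *\<^sub>R x) \<partial>lborel)"
proof -
  have "(\<integral>\<^sup>+x. f x \<partial>lborel)
      = (\<integral>\<^sup>+x. f x \<partial>density (distr lborel borel (\<lambda>x. t + c *\<^sub>R x)) (\<lambda>_. \<bar>c\<bar> ^ DIM('a)))"
    using lborel_affine[OF c, of t] by simp
  also have "\<dots> = (\<integral>\<^sup>+x. ennreal (\<bar>c\<bar> ^ DIM('a)) * f (t + c *\<^sub>R x) \<partial>lborel)"
    by (subst nn_integral_density) (auto simp: nn_integral_distr)
  finally show ?thesis by (simp add: nn_integral_cmult)
qed

lemma integral_lborel_affine:
  fixes t :: "'a::euclidean_space" and f :: "'a \<Rightarrow> 'b::{banach, second_countable_topology}"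
  assumes c: "c \<noteq> 0" and [measurable]: "f \<in> borel_measurable borel"
  shows "(\<integral>x. f x \<partial>lborel) = \<bar>c\<bar> ^ DIM('a) *\<^sub>R (\<integral>x. f (t + c *\<^sub>R x) \<partial>lborel)"
proof -
  have "(\<integral>x. f x \<partial>lborel)
      = (\<integral>x. f x \<partial>density (distr lborel borel (\<lambda>x. t + c *\<^sub>R x)) (\<lambda>_. \<bar>c\<bar> ^ DIM('a)))"
    using lborel_affine[OF c, of t] by simp
  also have "\<dots> = (\<integral>x. \<bar>c\<bar> ^ DIM('a) *\<^sub>R f (t + c *\<^sub>R x) \<partial>lborel)"
    by (subst integral_density) (auto simp: integral_distr)
  finally show ?thesis by simp
qed

lemma
  fixes t :: "'a::euclidean_space" and f :: "'a \<Rightarrow> 'b::{banach, second_countable_topology}"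
  assumes f: "integrable lborel f"
  shows integrable_lborel_translate: "integrable lborel (\<lambda>x. f (x - t))"
    and integral_lborel_translate: "(\<integral>x. f (x - t) \<partial>lborel) = (\<integral>x. f x \<partial>lborel)"
proof -
  have [measurable]: "f \<in> borel_measurable borel" using f by auto
  have "(\<integral>\<^sup>+x. norm (f x) \<partial>lborel) = (\<integral>\<^sup>+x. norm (f (x - t)) \<partial>lborel)"
    by (subst nn_integral_lborel_affine[where c = 1 and t = "- t"]) simp_all
  with f show "integrable lborel (\<lambda>x. f (x - t))" by (simp add: integrable_iff_bounded)
  show "(\<integral>x. f (x - t) \<partial>lborel) = (\<integral>x. f x \<partial>lborel)"
    by (subst (2) integral_lborel_affine[where c = 1 and t = "- t"]) simp_all
qed

lemma integrable_lborel_prod: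
  fixes f g :: "'a::euclidean_space \<Rightarrow> complex"
  assumes "integrable lborel f" "integrable lborel g"
  shows "integrable (lborel \<Otimes>\<^sub>M lborel) (\<lambda>(x, y). f x * g y)"
proof -
  have [measurable]: "f \<in> borel_measurable borel" "g \<in> borel_measurable borel" using assms by auto
  show ?thesis
    by (rule lborel_pair.Fubini_integrable) (use assms in \<open>auto simp: norm_mult\<close>)
qed

text \<open>
  For the kernel \<open>exp(-\<i> x \<bullet> y)\<close> this is the multiplication formula: the Fourier transform may be moved
  from one factor of an integral to the other one.
\<close>

lemma bounded_kernel_swap:
  fixes f g :: "'a::euclidean_space \<Rightarrow> complex" and e :: "'a \<Rightarrow> 'a \<Rightarrow> complex"
  assumes "integrable lborel f" "integrable lborel g"
    and [measurable]: "case_prod e \<in> borel_measurable (lborel \<Otimes>\<^sub>M lborel)" and e: "\<And>x y. norm (e x y) \<le> 1"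
  shows "(\<integral>y. (\<integral>x. e x y * f x \<partial>lborel) * g y \<partial>lborel) = (\<integral>x. f x * (\<integral>y. e x y * g y \<partial>lborel) \<partial>lborel)"
proof -
  have [measurable]: "f \<in> borel_measurable borel" "g \<in> borel_measurable borel" using assms by auto
  have "integrable (lborel \<Otimes>\<^sub>M lborel) (\<lambda>(x, y). e x y * f x * g y)"
  proof (rule Bochner_Integration.integrable_bound[OF integrable_lborel_prod[OF assms(1,2)]])
    show "AE z in lborel \<Otimes>\<^sub>M lborel. norm (case z of (x, y) \<Rightarrow> e x y * f x * g y) \<le> norm (case z of (x, y) \<Rightarrow> f x * g y)"
      using e by (intro AE_I2) (auto simp: norm_mult mult.assoc intro!: mult_left_le_one_le)
  qed measurable
  from lborel_pair.Fubini_integral[OF this]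
  have "(\<integral>y. \<integral>x. e x y * f x * g y \<partial>lborel \<partial>lborel) = (\<integral>x. \<integral>y. e x y * f x * g y \<partial>lborel \<partial>lborel)" .
  moreover have "(\<integral>x. e x y * f x * g y \<partial>lborel) = (\<integral>x. e x y * f x \<partial>lborel) * g y" for y
    by (rule integral_mult_left_zero)
  moreover have "(\<integral>y. e x y * f x * g y \<partial>lborel) = f x * (\<integral>y. e x y * g y \<partial>lborel)" for x
    by (subst integral_mult_right_zero[symmetric]) (simp add: mult_ac)
  ultimately show ?thesis by simp
qed

text \<open>
  The functions on which translations act continuously are closed in \<open>L\<^sup>1\<close>, because a translation
  preserves the \<open>L\<^sup>1\<close> distance of two functions.
\<close>

lemma translation_L1_approx:
  fixes f :: "'a::euclidean_space \<Rightarrow> 'b::{banach, second_countable_topology}"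
  assumes f: "integrable lborel f"
    and approx: "\<And>e::real. e > 0 \<Longrightarrow> \<exists>g. integrable lborel g \<and> (\<integral>x. norm (f x - g x) \<partial>lborel) \<le> e
        \<and> (\<lambda>k. \<integral>x. norm (g x - g (x - w k)) \<partial>lborel) \<longlonglongrightarrow> 0"
  shows "(\<lambda>k::nat. \<integral>x. norm (f x - f (x - w k)) \<partial>lborel) \<longlonglongrightarrow> 0"
proof (rule LIMSEQ_I)
  fix e :: real assume e: "e > 0"
  obtain g where g: "integrable lborel g" "(\<integral>x. norm (f x - g x) \<partial>lborel) \<le> e / 3"
    and lim: "(\<lambda>k. \<integral>x. norm (g x - g (x - w k)) \<partial>lborel) \<longlonglongrightarrow> 0"
    using approx[of "e/3"] e by auto
  obtain K where K: "\<And>k. k \<ge> K \<Longrightarrow> norm ((\<integral>x. norm (g x - g (x - w k)) \<partial>lborel) - 0) < e / 3"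
    using LIMSEQ_D[OF lim, of "e/3"] e by auto
  have "norm ((\<integral>x. norm (f x - f (x - w k)) \<partial>lborel) - 0) < e" if "k \<ge> K" for k
  proof -
    note tr = integrable_lborel_translate
    have d: "integrable lborel (\<lambda>x. norm (f x - g x))" using f g by auto
    have "(\<integral>x. norm (f x - f (x - w k)) \<partial>lborel)
      \<le> (\<integral>x. norm (f x - g x) + norm (g x - g (x - w k)) + norm (f (x - w k) - g (x - w k)) \<partial>lborel)"
    proof (rule integral_mono)
      show "norm (f x - f (x - w k)) \<le> norm (f x - g x) + norm (g x - g (x - w k)) + norm (f (x - w k) - g (x - w k))" for x
        using norm_triangle_ineq[of "f x - g x + (g x - g (x - w k))" "g (x - w k) - f (x - w k)"]
          norm_triangle_ineq[of "f x - g x" "g x - g (x - w k)"]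
        by (simp add: norm_minus_commute)
    qed (use f g tr[OF f] tr[OF g(1)] tr[OF d] in \<open>auto intro!: Bochner_Integration.integrable_add\<close>)
    also have "\<dots> = (\<integral>x. norm (f x - g x) \<partial>lborel) + (\<integral>x. norm (g x - g (x - w k)) \<partial>lborel)
        + (\<integral>x. norm (f (x - w k) - g (x - w k)) \<partial>lborel)"
      using f g tr[OF f] tr[OF g(1)] tr[OF d] by (subst Bochner_Integration.integral_add | auto)+
    also have "(\<integral>x. norm (f (x - w k) - g (x - w k)) \<partial>lborel) = (\<integral>x. norm (f x - g x) \<partial>lborel)"
      by (rule integral_lborel_translate[OF d])
    also have "(\<integral>x. norm (f x - g x) \<partial>lborel) + (\<integral>x. norm (g x - g (x - w k)) \<partial>lborel)
        + (\<integral>x. norm (f x - g x) \<partial>lborel) < e" using g(2) K[OF that] by auto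
    finally show ?thesis by simp
  qed
  thus "\<exists>K. \<forall>k\<ge>K. norm ((\<integral>x. norm (f x - f (x - w k)) \<partial>lborel) - 0) < e" by blast
qed

text \<open>
  If \<open>x \<in> U\<close> then \<open>x - w k \<in> U\<close> for large \<open>k\<close>, since \<open>U\<close> is open. Hence the product of the two
  indicators converges everywhere to the indicator of \<open>U\<close>. This suffices because both indicators have the
  same integral, and \<open>|p - q| = p + q - 2pq\<close> for \<open>p\<close>, \<open>q\<close> in \<open>{0, 1}\<close>.
\<close>

lemma translation_L1_open:
  fixes w :: "nat \<Rightarrow> 'a::euclidean_space"
  assumes U: "open U" "emeasure lborel U < \<infinity>" and w: "w \<longlonglongrightarrow> 0"
  shows "(\<lambda>k. \<integral>x. norm (indicator U x *\<^sub>R c - indicator U (x - w k) *\<^sub>R c) \<partial>lborel) \<longlonglongrightarrow> 0"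
proof -
  let ?i = "indicator U :: 'a \<Rightarrow> real"
  have [measurable]: "U \<in> sets borel" using U by auto
  have int: "integrable lborel ?i" using U by (auto intro!: integrable_real_indicator)
  note intw = integrable_lborel_translate[OF int]
  have "(\<lambda>k. \<integral>x. ?i x * ?i (x - w k) \<partial>lborel) \<longlonglongrightarrow> (\<integral>x. ?i x \<partial>lborel)"
  proof (rule integral_dominated_convergence[where w = ?i])
    show "AE x in lborel. (\<lambda>k. ?i x * ?i (x - w k)) \<longlonglongrightarrow> ?i x"
    proof (rule AE_I2)
      fix x
      show "(\<lambda>k. ?i x * ?i (x - w k)) \<longlonglongrightarrow> ?i x"
      proof (cases "x \<in> U")
        case True
        have "(\<lambda>k. x - w k) \<longlonglongrightarrow> x" using tendsto_diff[OF tendsto_const w, of x] by simp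
        hence "\<forall>\<^sub>F k in sequentially. x - w k \<in> U" using topological_tendstoD U True by blast
        hence "\<forall>\<^sub>F k in sequentially. ?i x * ?i (x - w k) = ?i x"
          by eventually_elim (use True in auto)
        thus ?thesis by (rule tendsto_eventually)
      qed auto
    qed
  qed (use int in \<open>auto split: split_indicator\<close>)
  hence "(\<lambda>k. 2 * norm c * ((\<integral>x. ?i x \<partial>lborel) - (\<integral>x. ?i x * ?i (x - w k) \<partial>lborel))) \<longlonglongrightarrow>
      2 * norm c * ((\<integral>x. ?i x \<partial>lborel) - (\<integral>x. ?i x \<partial>lborel))" by (intro tendsto_intros)
  moreover have "(\<integral>x. norm (?i x *\<^sub>R c - ?i (x - w k) *\<^sub>R c) \<partial>lborel)
     = 2 * norm c * ((\<integral>x. ?i x \<partial>lborel) - (\<integral>x. ?i x * ?i (x - w k) \<partial>lborel))" for k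
  proof -
    have p: "integrable lborel (\<lambda>x. ?i x * ?i (x - w k))"
      by (rule Bochner_Integration.integrable_bound[OF int]) (auto split: split_indicator)
    have "(\<integral>x. norm (?i x *\<^sub>R c - ?i (x - w k) *\<^sub>R c) \<partial>lborel)
      = (\<integral>x. norm c * (?i x + ?i (x - w k) - 2 * (?i x * ?i (x - w k))) \<partial>lborel)"
      by (intro Bochner_Integration.integral_cong) (auto split: split_indicator)
    also have "\<dots> = norm c * ((\<integral>x. ?i x \<partial>lborel) + (\<integral>x. ?i (x - w k) \<partial>lborel) - 2 * (\<integral>x. ?i x * ?i (x - w k) \<partial>lborel))"
      using int intw p by simp
    also have "(\<integral>x. ?i (x - w k) \<partial>lborel) = (\<integral>x. ?i x \<partial>lborel)" by (rule integral_lborel_translate[OF int])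
    finally show ?thesis by (simp add: algebra_simps)
  qed
  ultimately show ?thesis by simp
qed

text \<open>
  Outer regularity reduces the indicator of a set of finite measure to that of an open set; simple
  functions and limits follow by approximation in \<open>L\<^sup>1\<close>.
\<close>

lemma translation_continuous_L1:
  fixes f :: "'a::euclidean_space \<Rightarrow> 'b::{banach, second_countable_topology}"
  assumes f: "integrable lborel f" and w: "w \<longlonglongrightarrow> 0"
  shows "(\<lambda>k. \<integral>x. norm (f x - f (x - w k)) \<partial>lborel) \<longlonglongrightarrow> 0"
  using f
proof (induct rule: integrable_induct)
  case (base A c)
  show ?case
  proof (rule translation_L1_approx)
    have "integrable lborel (indicator A :: 'a \<Rightarrow> real)"
      using base by (intro integrable_real_indicator) auto
    thus intA: "integrable lborel (\<lambda>x. indicator A x *\<^sub>R c)" by (intro integrable_scaleR_left)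
    fix e :: real assume e: "e > 0"
    \<comment> \<open>the summand 1 covers \<open>c = 0\<close>\<close>
    define d where "d = e / (norm c + 1)"
    have c0: "norm c + 1 > 0" by (simp add: add_nonneg_pos)
    hence d: "d > 0" using e by (simp add: d_def add_nonneg_pos)
    have A: "A \<in> sets lebesgue" using base by auto
    obtain U where U: "open U" "A \<subseteq> U" "(U - A) \<in> lmeasurable" "emeasure lebesgue (U - A) < ennreal d"
      using sets_lebesgue_outer_open[OF A d] by blast
    have [measurable]: "U \<in> sets borel" "A \<in> sets borel" using U base by auto
    have m: "emeasure lborel (U - A) < ennreal d" using U(4) by simp
    have "emeasure lborel U = emeasure lborel A + emeasure lborel (U - A)"
      using U(2) by (subst plus_emeasure) (auto simp: Un_absorb1)
    also have "\<dots> < \<infinity>" using base m by (auto simp: less_top[symmetric] dest: order.strict_trans)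
    finally have fin: "emeasure lborel U < \<infinity>" .
    have iU: "integrable lborel (indicator U :: 'a \<Rightarrow> real)"
      using fin by (intro integrable_real_indicator) auto
    have "(\<integral>x. norm (indicator A x *\<^sub>R c - indicator U x *\<^sub>R c) \<partial>lborel)
      = (\<integral>x. norm c * indicator (U - A) x \<partial>lborel)"
      using U(2) by (intro Bochner_Integration.integral_cong) (auto split: split_indicator)
    also have "\<dots> = norm c * measure lborel (U - A)" by simp
    also have "measure lborel (U - A) \<le> d"
      using m d by (simp add: measure_def enn2real_leI)
    hence "norm c * measure lborel (U - A) \<le> norm c * d" by (intro mult_left_mono) auto
    also have "norm c * d \<le> e"
      using e c0 by (simp add: d_def pos_divide_le_eq algebra_simps)
    finally have "(\<integral>x. norm (indicator A x *\<^sub>R c - indicator U x *\<^sub>R c) \<partial>lborel) \<le> e" .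
    with translation_L1_open[OF U(1) fin w, of c] iU
    show "\<exists>g. integrable lborel g \<and> (\<integral>x. norm (indicator A x *\<^sub>R c - g x) \<partial>lborel) \<le> e
        \<and> (\<lambda>k. \<integral>x. norm (g x - g (x - w k)) \<partial>lborel) \<longlonglongrightarrow> 0"
      by (intro exI[of _ "\<lambda>x. indicator U x *\<^sub>R c"] conjI integrable_scaleR_left)
  qed
next
  case (add f g)
  note tr = integrable_lborel_translate
  show ?case
  proof (rule tendsto_sandwich[OF always_eventually always_eventually tendsto_const])
    show "\<forall>k. 0 \<le> (\<integral>x. norm (f x + g x - (f (x - w k) + g (x - w k))) \<partial>lborel)" by simp
    show "\<forall>k. (\<integral>x. norm (f x + g x - (f (x - w k) + g (x - w k))) \<partial>lborel)
      \<le> (\<integral>x. norm (f x - f (x - w k)) \<partial>lborel) + (\<integral>x. norm (g x - g (x - w k)) \<partial>lborel)"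
    proof
      fix k
      have i: "integrable lborel (\<lambda>x. norm (f x - f (x - w k)))" "integrable lborel (\<lambda>x. norm (g x - g (x - w k)))"
        using add(1,3) tr[OF add(1)] tr[OF add(3)]
        by (auto intro!: integrable_norm Bochner_Integration.integrable_diff)
      have "(\<integral>x. norm (f x + g x - (f (x - w k) + g (x - w k))) \<partial>lborel)
        \<le> (\<integral>x. norm (f x - f (x - w k)) + norm (g x - g (x - w k)) \<partial>lborel)"
      proof (rule integral_mono)
        show "integrable lborel (\<lambda>x. norm (f x + g x - (f (x - w k) + g (x - w k))))"
          using add(1,3) tr[OF add(1)] tr[OF add(3)] by auto
        show "norm (f x + g x - (f (x - w k) + g (x - w k))) \<le> norm (f x - f (x - w k)) + norm (g x - g (x - w k))" for x
          using norm_triangle_ineq[of "f x - f (x - w k)" "g x - g (x - w k)"] by (simp add: algebra_simps)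
      qed (use i in auto)
      also have "\<dots> = (\<integral>x. norm (f x - f (x - w k)) \<partial>lborel) + (\<integral>x. norm (g x - g (x - w k)) \<partial>lborel)"
        by (rule Bochner_Integration.integral_add[OF i])
      finally show "(\<integral>x. norm (f x + g x - (f (x - w k) + g (x - w k))) \<partial>lborel) \<le> \<dots>" .
    qed
    show "(\<lambda>k. (\<integral>x. norm (f x - f (x - w k)) \<partial>lborel) + (\<integral>x. norm (g x - g (x - w k)) \<partial>lborel)) \<longlonglongrightarrow> 0"
      using tendsto_add[OF add(2,4)] by simp
  qed
next
  case (lim f s)
  show ?case
  proof (rule translation_L1_approx[OF lim(5)])
    fix e :: real assume e: "e > 0"
    have "(\<lambda>i. \<integral>x. norm (f x - s i x) \<partial>lborel) \<longlonglongrightarrow> (\<integral>x. 0 \<partial>(lborel :: 'a measure))"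
    proof (rule integral_dominated_convergence[where w = "\<lambda>x. 3 * norm (f x)"])
      show "AE x in lborel. (\<lambda>i. norm (f x - s i x)) \<longlonglongrightarrow> 0"
      proof (rule AE_I2)
        fix x :: 'a assume "x \<in> space lborel"
        from tendsto_diff[OF tendsto_const lim(3)[OF this], of "f x"]
        show "(\<lambda>i. norm (f x - s i x)) \<longlonglongrightarrow> 0" by (simp add: tendsto_norm_zero)
      qed
      show "AE x in lborel. norm (norm (f x - s i x)) \<le> 3 * norm (f x)" for i
      proof (rule AE_I2)
        fix x :: 'a assume "x \<in> space lborel"
        from lim(4)[OF this, of i] norm_triangle_ineq4[of "f x" "s i x"]
        show "norm (norm (f x - s i x)) \<le> 3 * norm (f x)" by simp
      qed
    qed (use lim(1,5) in auto)
    from LIMSEQ_D[OF this e] obtain i where "norm ((\<integral>x. norm (f x - s i x) \<partial>lborel) - (\<integral>x. 0 \<partial>(lborel :: 'a measure))) < e"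
      by auto
    thus "\<exists>g. integrable lborel g \<and> (\<integral>x. norm (f x - g x) \<partial>lborel) \<le> e
        \<and> (\<lambda>k. \<integral>x. norm (g x - g (x - w k)) \<partial>lborel) \<longlonglongrightarrow> 0"
      using lim(1,2) by (intro exI[of _ "s i"]) auto
  qed
qed

section \<open>Plancherel's theorem\<close>

lemma mult_le_sum_squares: "a * b \<le> a\<^sup>2 + b\<^sup>2" for a b :: real
proof -
  have "0 \<le> (a - b)\<^sup>2 + a\<^sup>2 + b\<^sup>2" by simp
  thus ?thesis by (simp add: power2_eq_square algebra_simps)
qed

lemma cnj_measurable [measurable]: "cnj \<in> borel_measurable borel"
  by (intro borel_measurable_continuous_onI continuous_intros)

lemma integrable_mult_L2:
  fixes f g :: "'a \<Rightarrow> complex"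
  assumes [measurable]: "f \<in> borel_measurable M" "g \<in> borel_measurable M"
    and f: "integrable M (\<lambda>x. (norm (f x))\<^sup>2)" and g: "integrable M (\<lambda>x. (norm (g x))\<^sup>2)"
  shows "integrable M (\<lambda>x. f x * g x)"
proof (rule Bochner_Integration.integrable_bound)
  show "integrable M (\<lambda>x. (norm (f x))\<^sup>2 + (norm (g x))\<^sup>2)" using f g by auto
  show "AE x in M. norm (f x * g x) \<le> norm ((norm (f x))\<^sup>2 + (norm (g x))\<^sup>2)"
    by (intro AE_I2) (simp add: norm_mult mult_le_sum_squares)
qed simp

lemma truncation_L2_tendsto_0:
  fixes f :: "'a \<Rightarrow> complex"
  assumes [measurable]: "f \<in> borel_measurable M" and f: "integrable M (\<lambda>x. (norm (f x))\<^sup>2)"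
  shows "(\<lambda>N::nat. \<integral>x. (if norm (f x) \<le> N then 0 else (norm (f x))\<^sup>2) \<partial>M) \<longlonglongrightarrow> 0"
proof -
  have "(\<lambda>N::nat. \<integral>x. (if norm (f x) \<le> N then 0 else (norm (f x))\<^sup>2) \<partial>M) \<longlonglongrightarrow> (\<integral>x. 0 \<partial>M)"
  proof (rule integral_dominated_convergence[where w = "\<lambda>x. (norm (f x))\<^sup>2"])
    show "AE x in M. (\<lambda>N::nat. (if norm (f x) \<le> N then 0 else (norm (f x))\<^sup>2)) \<longlonglongrightarrow> 0"
    proof (rule AE_I2)
      fix x
      obtain K :: nat where "norm (f x) \<le> K" using real_arch_simple by blast
      hence "\<forall>\<^sub>F N in sequentially. (if norm (f x) \<le> real N then 0 else (norm (f x))\<^sup>2) = 0"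
        by (intro eventually_sequentiallyI[of K]) auto
      thus "(\<lambda>N::nat. (if norm (f x) \<le> N then 0 else (norm (f x))\<^sup>2)) \<longlonglongrightarrow> 0"
        by (rule tendsto_eventually)
    qed
  qed (use f in auto)
  thus ?thesis by simp
qed

lemma autocorrelation_bound:
  fixes f :: "'a::euclidean_space \<Rightarrow> complex"
  assumes f2: "integrable lborel (\<lambda>x. (norm (f x))\<^sup>2)" and [measurable]: "f \<in> borel_measurable borel"
  shows "(\<integral>x. norm (f x * cnj (f (x - w))) \<partial>lborel) \<le> 2 * (\<integral>x. (norm (f x))\<^sup>2 \<partial>lborel)"
proof -
  note f2w = integrable_lborel_translate[OF f2, of w]
  have "(\<integral>x. norm (f x * cnj (f (x - w))) \<partial>lborel) \<le> (\<integral>x. (norm (f x))\<^sup>2 + (norm (f (x - w)))\<^sup>2 \<partial>lborel)"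
  proof (rule integral_mono)
    show "integrable lborel (\<lambda>x. norm (f x * cnj (f (x - w))))"
      using f2 f2w by (intro integrable_norm integrable_mult_L2) auto
  qed (use f2 f2w in \<open>auto simp: norm_mult mult_le_sum_squares\<close>)
  also have "\<dots> = (\<integral>x. (norm (f x))\<^sup>2 \<partial>lborel) + (\<integral>x. (norm (f (x - w)))\<^sup>2 \<partial>lborel)"
    using f2 f2w by (intro Bochner_Integration.integral_add)
  also have "(\<integral>x. (norm (f (x - w)))\<^sup>2 \<partial>lborel) = (\<integral>x. (norm (f x))\<^sup>2 \<partial>lborel)"
    by (rule integral_lborel_translate[OF f2])
  finally show ?thesis by simp
qed

text \<open>
  Where \<open>|f| \<le> N\<close> the integrand changes by at most \<open>N|f(x) - f(x - w k)|\<close>, and translations are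
  continuous in \<open>L\<^sup>1\<close>. The part where \<open>|f| > N\<close> has small \<open>L\<^sup>2\<close> norm, and the weighted inequality
  \<open>pq \<le> A p\<^sup>2 + q\<^sup>2/A\<close> makes its contribution small uniformly in \<open>k\<close>.
\<close>

lemma autocorrelation_continuous_0:
  fixes f :: "'a::euclidean_space \<Rightarrow> complex"
  assumes f: "integrable lborel f" and f2: "integrable lborel (\<lambda>x. (norm (f x))\<^sup>2)" and w: "w \<longlonglongrightarrow> 0"
  shows "(\<lambda>k. \<integral>x. f x * cnj (f (x - w k)) \<partial>lborel) \<longlonglongrightarrow> (\<integral>x. f x * cnj (f x) \<partial>lborel)"
proof -
  have [measurable]: "f \<in> borel_measurable borel" using f by auto
  define Q where "Q = (\<integral>x. (norm (f x))\<^sup>2 \<partial>lborel)"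
  define s where "s N x = (if norm (f x) \<le> real N then 0 else (norm (f x))\<^sup>2)" for N x
  define S where "S N = (\<integral>x. s N x \<partial>lborel)" for N
  define D where "D k = (\<integral>x. norm (f x - f (x - w k)) \<partial>lborel)" for k
  note tr = integrable_lborel_translate
  have Q: "Q \<ge> 0" by (simp add: Q_def)
  have S: "S \<longlonglongrightarrow> 0" unfolding S_def s_def by (rule truncation_L2_tendsto_0[OF _ f2]) simp
  have D: "D \<longlonglongrightarrow> 0" unfolding D_def by (rule translation_continuous_L1[OF f w])
  have s_meas [measurable]: "s N \<in> borel_measurable borel" for N unfolding s_def by measurable
  have s_int: "integrable lborel (s N)" for N
    by (rule Bochner_Integration.integrable_bound[OF f2]) (auto simp: s_def)
  have i: "integrable lborel (\<lambda>x. f x * cnj (f (x - w k)))" for k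
    using f2 tr[OF f2, of "w k"] by (intro integrable_mult_L2) auto
  have i0: "integrable lborel (\<lambda>x. f x * cnj (f x))" using f2 by (intro integrable_mult_L2) auto
  have key: "norm ((\<integral>x. f x * cnj (f (x - w k)) \<partial>lborel) - (\<integral>x. f x * cnj (f x) \<partial>lborel))
     \<le> real N * D k + (1 + A) * S N + Q / A" if A: "A > 0" for k N A
  proof -
    have "norm ((\<integral>x. f x * cnj (f (x - w k)) \<partial>lborel) - (\<integral>x. f x * cnj (f x) \<partial>lborel))
      = norm (\<integral>x. f x * cnj (f (x - w k)) - f x * cnj (f x) \<partial>lborel)"
      using i i0 by simp
    also have "\<dots> \<le> (\<integral>x. norm (f x * cnj (f (x - w k)) - f x * cnj (f x)) \<partial>lborel)"
      by (rule integral_norm_bound)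
    also have "\<dots> \<le> (\<integral>x. real N * norm (f x - f (x - w k)) + (1 + A) * s N x + (norm (f (x - w k)))\<^sup>2 / A \<partial>lborel)"
    proof (rule integral_mono)
      fix x
      let ?a = "norm (f x)" and ?b = "norm (f (x - w k))" and ?d = "norm (f x - f (x - w k))"
      have "f x * cnj (f (x - w k)) - f x * cnj (f x) = f x * cnj (f (x - w k) - f x)"
        by (simp add: algebra_simps)
      hence eq: "norm (f x * cnj (f (x - w k)) - f x * cnj (f x)) = ?a * ?d"
        by (simp only: norm_mult complex_mod_cnj norm_minus_commute)
      show "norm (f x * cnj (f (x - w k)) - f x * cnj (f x)) \<le> real N * ?d + (1 + A) * s N x + ?b\<^sup>2 / A"
      proof (cases "?a \<le> real N")
        case True
        hence "?a * ?d \<le> real N * ?d" by (intro mult_right_mono) auto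
        moreover have "0 \<le> ?b\<^sup>2 / A" using A by simp
        ultimately show ?thesis using True unfolding eq s_def by simp
      next
        case False
        have "0 \<le> (A * ?a - ?b)\<^sup>2 + (A * ?a)\<^sup>2 + ?b\<^sup>2" by simp
        hence "(A * ?a) * ?b \<le> (A * ?a)\<^sup>2 + ?b\<^sup>2" by (simp add: power2_eq_square algebra_simps)
        hence "A * (?a * ?b) \<le> A * (A * ?a\<^sup>2 + ?b\<^sup>2 / A)"
          using A by (simp add: power2_eq_square algebra_simps)
        hence ab: "?a * ?b \<le> A * ?a\<^sup>2 + ?b\<^sup>2 / A" using A by (rule mult_left_le_imp_le)
        have "?a * ?d \<le> ?a * (?a + ?b)" by (intro mult_left_mono norm_triangle_ineq4) auto
        also have "\<dots> = ?a\<^sup>2 + ?a * ?b" by (simp add: power2_eq_square algebra_simps)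
        also have "\<dots> \<le> (1 + A) * s N x + ?b\<^sup>2 / A" using ab False by (simp add: s_def algebra_simps)
        also have "\<dots> \<le> real N * ?d + (1 + A) * s N x + ?b\<^sup>2 / A" by simp
        finally show ?thesis unfolding eq .
      qed
    qed (use i i0 f tr[OF f] tr[OF f2] s_int in
        \<open>auto intro!: integrable_norm Bochner_Integration.integrable_add Bochner_Integration.integrable_diff
           integrable_mult_right integrable_divide\<close>)
    also have "\<dots> = real N * D k + (1 + A) * S N + (\<integral>x. (norm (f (x - w k)))\<^sup>2 \<partial>lborel) / A"
    proof -
      have "integrable lborel (\<lambda>x. norm (f x - f (x - w k)))"
        using f tr[OF f] by (intro integrable_norm Bochner_Integration.integrable_diff) auto
      thus ?thesis unfolding D_def S_def
        using tr[OF f2, of "w k"] s_int[of N]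
        by (simp add: Bochner_Integration.integral_add)
    qed
    also have "(\<integral>x. (norm (f (x - w k)))\<^sup>2 \<partial>lborel) = Q" unfolding Q_def by (rule integral_lborel_translate[OF f2])
    finally show ?thesis .
  qed
  show ?thesis
  proof (rule LIMSEQ_I)
    fix e :: real assume e: "e > 0"
    \<comment> \<open>first fix the weight, then the truncation level, then the translation\<close>
    define A where "A = 4 * (Q + 1) / e"
    have A: "A > 0" using Q e by (simp add: A_def)
    have QA: "Q / A \<le> e / 4" using Q e by (simp add: A_def field_simps)
    have "e / (4 * (1 + A)) > 0" using A e by simp
    from LIMSEQ_D[OF S this] obtain N where "norm (S N - 0) < e / (4 * (1 + A))" by auto
    hence SN: "(1 + A) * S N < e / 4" using A by (simp add: pos_less_divide_eq abs_less_iff algebra_simps)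
    have "e / (4 * (real N + 1)) > 0" using e by (intro divide_pos_pos mult_pos_pos) auto
    from LIMSEQ_D[OF D this] obtain K where K: "\<And>k. k \<ge> K \<Longrightarrow> norm (D k - 0) < e / (4 * (real N + 1))" by auto
    have "norm ((\<integral>x. f x * cnj (f (x - w k)) \<partial>lborel) - (\<integral>x. f x * cnj (f x) \<partial>lborel)) < e" if k: "k \<ge> K" for k
    proof -
      have D0: "D k \<ge> 0" by (simp add: D_def)
      have "D k < e / (4 * (real N + 1))" using K[OF k] by simp
      hence "(real N + 1) * D k < e / 4" by (simp add: pos_less_divide_eq mult_ac)
      moreover have "real N * D k \<le> (real N + 1) * D k" using D0 by (intro mult_right_mono) auto
      ultimately show ?thesis using key[OF A, of k N] SN QA e by argo
    qed
    thus "\<exists>K. \<forall>k\<ge>K. norm ((\<integral>x. f x * cnj (f (x - w k)) \<partial>lborel) - (\<integral>x. f x * cnj (f x) \<partial>lborel)) < e" by blast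
  qed
qed

definition character :: "'a::euclidean_space \<Rightarrow> 'a \<Rightarrow> complex" where
  "character x \<xi> = exp (- (\<i> * of_real (x \<bullet> \<xi>)))"

lemma character_measurable [measurable]: "case_prod character \<in> borel_measurable (borel \<Otimes>\<^sub>M borel)"
  unfolding character_def by measurable

lemma norm_character [simp]: "norm (character x \<xi>) = 1"
  by (simp add: character_def norm_exp_eq_Re)

lemma cnj_character: "cnj (character x \<xi>) = character (- x) \<xi>"
  by (simp add: character_def exp_cnj)

lemma character_mult: "character x \<xi> * character y \<xi> = character (x + y) \<xi>"
  by (simp add: character_def exp_add[symmetric] inner_add_left algebra_simps)

lemma fourier_bounded: "norm (fourier f \<xi>) \<le> L1_norm f"
proof -
  have "norm (fourier f \<xi>) \<le> (\<integral>x. norm (exp (- (\<i> * complex_of_real (x \<bullet> \<xi>))) * f x) \<partial>lebesgue)"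
    unfolding fourier_def by (rule integral_norm_bound)
  also have "\<dots> = L1_norm f" by (simp add: L1_norm_def norm_mult norm_exp_eq_Re)
  finally show ?thesis .
qed

lemma fourier_lborel:
  assumes "f \<in> borel_measurable borel"
  shows "fourier f \<xi> = (\<integral>x. character x \<xi> * f x \<partial>lborel)"
  unfolding fourier_def character_def using assms by (intro integral_completion) measurable

lemma fourier_continuous:
  assumes f: "in_L1 f"
  shows "continuous_on UNIV (fourier f)"
proof -
  have "(\<lambda>n. fourier f (X n)) \<longlonglongrightarrow> fourier f \<xi>" if X: "X \<longlonglongrightarrow> \<xi>" for X \<xi>
    unfolding fourier_def
  proof (rule integral_dominated_convergence[where w = "\<lambda>x. norm (f x)"])
    have [measurable]: "f \<in> borel_measurable lebesgue" using f by (auto simp: in_L1_def)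
    have m: "(\<lambda>x. exp (- (\<i> * complex_of_real (x \<bullet> \<eta>)))) \<in> borel_measurable lebesgue" for \<eta> :: 'a
      by (intro measurable_completion) measurable
    show "(\<lambda>x. exp (- (\<i> * complex_of_real (x \<bullet> \<xi>))) * f x) \<in> borel_measurable lebesgue"
      "(\<lambda>x. exp (- (\<i> * complex_of_real (x \<bullet> X n))) * f x) \<in> borel_measurable lebesgue" for n
      by (intro borel_measurable_times m; measurable)+
    show "AE x in lebesgue. (\<lambda>n. exp (- (\<i> * complex_of_real (x \<bullet> X n))) * f x)
        \<longlonglongrightarrow> exp (- (\<i> * complex_of_real (x \<bullet> \<xi>))) * f x"
      by (intro AE_I2 tendsto_intros X)
  qed (use f in \<open>auto simp: in_L1_def norm_mult norm_exp_eq_Re\<close>)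
  thus ?thesis by (auto simp: continuous_on_sequentially o_def)
qed

lemma fourier_dilated_gaussian:
  fixes v :: "'a::euclidean_space"
  assumes e: "\<epsilon> > 0"
  shows "integrable lborel (\<lambda>\<xi>::'a. gaussian (\<epsilon> *\<^sub>R \<xi>))"
    and "(\<integral>\<xi>. character v \<xi> * of_real (gaussian (\<epsilon> *\<^sub>R \<xi>)) \<partial>lborel)
      = of_real (sqrt (2 * pi) ^ DIM('a) / \<epsilon> ^ DIM('a) * gaussian (v /\<^sub>R \<epsilon>))"
proof -
  have "(\<integral>\<^sup>+\<xi>. ennreal (gaussian (\<xi>::'a)) \<partial>lborel) = ennreal (\<bar>\<epsilon>\<bar> ^ DIM('a)) * (\<integral>\<^sup>+\<xi>. ennreal (gaussian (\<epsilon> *\<^sub>R (\<xi>::'a))) \<partial>lborel)"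
    using nn_integral_lborel_affine[of \<epsilon> "\<lambda>\<xi>::'a. ennreal (gaussian \<xi>)" 0] e by simp
  moreover have "(\<integral>\<^sup>+\<xi>. ennreal (gaussian (\<xi>::'a)) \<partial>lborel) < \<infinity>"
    using integrable_gaussian[where 'a = 'a] by (simp add: integrable_iff_bounded)
  ultimately show "integrable lborel (\<lambda>\<xi>::'a. gaussian (\<epsilon> *\<^sub>R \<xi>))"
    using e by (auto simp: integrable_iff_bounded ennreal_mult_less_top)
  have "(\<integral>\<xi>. character v \<xi> * of_real (gaussian (\<epsilon> *\<^sub>R \<xi>)) \<partial>lborel)
     = \<bar>inverse \<epsilon>\<bar> ^ DIM('a) *\<^sub>R (\<integral>\<xi>. character v (0 + inverse \<epsilon> *\<^sub>R \<xi>) * of_real (gaussian (\<epsilon> *\<^sub>R (0 + inverse \<epsilon> *\<^sub>R \<xi>))) \<partial>lborel)"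
    using e by (intro integral_lborel_affine) (auto simp: character_def)
  also have "(\<lambda>\<xi>. character v (0 + inverse \<epsilon> *\<^sub>R \<xi>) * of_real (gaussian (\<epsilon> *\<^sub>R (0 + inverse \<epsilon> *\<^sub>R \<xi>))))
     = (\<lambda>\<xi>. exp (- (\<i> * of_real ((v /\<^sub>R \<epsilon>) \<bullet> \<xi>))) * of_real (gaussian \<xi>))"
    using e by (auto simp: character_def fun_eq_iff)
  also have "(\<integral>\<xi>. exp (- (\<i> * of_real ((v /\<^sub>R \<epsilon>) \<bullet> \<xi>))) * of_real (gaussian \<xi>) \<partial>lborel)
     = of_real (sqrt (2 * pi) ^ DIM('a) * gaussian (v /\<^sub>R \<epsilon>))" by (rule fourier_gaussian)
  finally show "(\<integral>\<xi>. character v \<xi> * of_real (gaussian (\<epsilon> *\<^sub>R \<xi>)) \<partial>lborel)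
      = of_real (sqrt (2 * pi) ^ DIM('a) / \<epsilon> ^ DIM('a) * gaussian (v /\<^sub>R \<epsilon>))"
    using e by (simp add: scaleR_conv_of_real field_simps)
qed

text \<open>
  The Gaussian factor makes the left integral converge absolutely, so that \<open>bounded_kernel_swap\<close> can
  be applied twice. This moves both transforms to the Gaussian, whose transform is an approximate
  identity; the right side is therefore a Gaussian mean of the autocorrelation of \<open>f\<close> near the origin.
\<close>

lemma gaussian_regularised_plancherel:
  fixes f :: "'a::euclidean_space \<Rightarrow> complex"
  assumes f: "integrable lborel f" and f2: "integrable lborel (\<lambda>x. (norm (f x))\<^sup>2)" and e: "\<epsilon> > 0"
  defines "F \<equiv> \<lambda>\<xi>. \<integral>x. character x \<xi> * f x \<partial>lborel"
  shows "(\<integral>\<xi>. of_real ((norm (F \<xi>))\<^sup>2 * gaussian (\<epsilon> *\<^sub>R \<xi>)) \<partial>lborel)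
    = of_real (sqrt (2 * pi) ^ DIM('a)) *
      (\<integral>z. of_real (gaussian z) * (\<integral>x. f x * cnj (f (x - \<epsilon> *\<^sub>R z)) \<partial>lborel) \<partial>lborel)"
proof -
  define K :: real where "K = sqrt (2 * pi) ^ DIM('a)"
  have [measurable]: "f \<in> borel_measurable borel" using f by auto
  have cf: "integrable lborel (\<lambda>x. cnj (f x))" using f by simp
  have F_meas [measurable]: "F \<in> borel_measurable borel" unfolding F_def by measurable
  have Fb: "norm (F \<xi>) \<le> (\<integral>x. norm (f x) \<partial>lborel)" for \<xi>
    unfolding F_def using integral_norm_bound[of lborel "\<lambda>x. character x \<xi> * f x"] by (simp add: norm_mult)
  note g_int = fourier_dilated_gaussian(1)[OF e, where 'a = 'a]
  have gc_int: "integrable lborel (\<lambda>\<xi>::'a. complex_of_real (gaussian (\<epsilon> *\<^sub>R \<xi>)))" using g_int by simp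
  have k_int: "integrable lborel (\<lambda>\<xi>. cnj (F \<xi>) * of_real (gaussian (\<epsilon> *\<^sub>R \<xi>)))"
  proof (rule Bochner_Integration.integrable_bound)
    show "integrable lborel (\<lambda>\<xi>::'a. (\<integral>x. norm (f x) \<partial>lborel) * gaussian (\<epsilon> *\<^sub>R \<xi>))"
      by (intro integrable_mult_right g_int)
    show "AE \<xi> in lborel. norm (cnj (F \<xi>) * of_real (gaussian (\<epsilon> *\<^sub>R \<xi>)))
        \<le> norm ((\<integral>x. norm (f x) \<partial>lborel) * gaussian (\<epsilon> *\<^sub>R \<xi>))"
      using Fb by (intro AE_I2) (auto simp: norm_mult intro!: mult_right_mono)
  qed measurable
  have inner: "(\<integral>\<xi>. character x \<xi> * (cnj (F \<xi>) * of_real (gaussian (\<epsilon> *\<^sub>R \<xi>))) \<partial>lborel)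
     = of_real K * (\<integral>z. cnj (f (x - \<epsilon> *\<^sub>R z)) * of_real (gaussian z) \<partial>lborel)" for x
  proof -
    have cF: "cnj (F \<xi>) = (\<integral>y. cnj (character y \<xi>) * cnj (f y) \<partial>lborel)" for \<xi>
      unfolding F_def complex_cnj_mult[symmetric] by (rule Bochner_Integration.integral_cnj[symmetric])
    have gx: "integrable lborel (\<lambda>\<xi>. character x \<xi> * of_real (gaussian (\<epsilon> *\<^sub>R \<xi>)))"
      by (rule Bochner_Integration.integrable_bound[OF g_int]) (auto simp: norm_mult character_def norm_exp_eq_Re)
    have "(\<integral>\<xi>. character x \<xi> * (cnj (F \<xi>) * of_real (gaussian (\<epsilon> *\<^sub>R \<xi>))) \<partial>lborel)
      = (\<integral>\<xi>. (\<integral>y. cnj (character y \<xi>) * cnj (f y) \<partial>lborel) * (character x \<xi> * of_real (gaussian (\<epsilon> *\<^sub>R \<xi>))) \<partial>lborel)"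
      unfolding cF by (simp add: mult_ac)
    also have "\<dots> = (\<integral>y. cnj (f y) * (\<integral>\<xi>. cnj (character y \<xi>) * (character x \<xi> * of_real (gaussian (\<epsilon> *\<^sub>R \<xi>))) \<partial>lborel) \<partial>lborel)"
      by (rule bounded_kernel_swap[OF cf gx]) auto
    also have "\<dots> = (\<integral>y. cnj (f y) * (\<integral>\<xi>. character (x - y) \<xi> * of_real (gaussian (\<epsilon> *\<^sub>R \<xi>)) \<partial>lborel) \<partial>lborel)"
      by (simp add: cnj_character character_mult mult.assoc[symmetric])
    also have "\<dots> = (\<integral>y. cnj (f y) * of_real (K / \<epsilon> ^ DIM('a) * gaussian ((x - y) /\<^sub>R \<epsilon>)) \<partial>lborel)"
      by (simp only: fourier_dilated_gaussian(2)[OF e] K_def)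
    also have "\<dots> = \<bar>- \<epsilon>\<bar> ^ DIM('a) *\<^sub>R (\<integral>z. cnj (f (x + (- \<epsilon>) *\<^sub>R z)) * of_real (K / \<epsilon> ^ DIM('a) * gaussian ((x - (x + (- \<epsilon>) *\<^sub>R z)) /\<^sub>R \<epsilon>)) \<partial>lborel)"
      using e by (intro integral_lborel_affine) auto
    also have "\<dots> = \<bar>- \<epsilon>\<bar> ^ DIM('a) *\<^sub>R (\<integral>z. of_real (K / \<epsilon> ^ DIM('a)) * (cnj (f (x - \<epsilon> *\<^sub>R z)) * of_real (gaussian z)) \<partial>lborel)"
      using e by (simp add: mult_ac)
    also have "\<dots> = of_real K * (\<integral>z. cnj (f (x - \<epsilon> *\<^sub>R z)) * of_real (gaussian z) \<partial>lborel)"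
      using e by (subst integral_mult_right_zero) (simp add: scaleR_conv_of_real)
    finally show ?thesis .
  qed
  have "(\<integral>\<xi>. of_real ((norm (F \<xi>))\<^sup>2 * gaussian (\<epsilon> *\<^sub>R \<xi>)) \<partial>lborel)
    = (\<integral>\<xi>. (\<integral>x. character x \<xi> * f x \<partial>lborel) * (cnj (F \<xi>) * of_real (gaussian (\<epsilon> *\<^sub>R \<xi>))) \<partial>lborel)"
  proof -
    have "(\<integral>x. character x \<xi> * f x \<partial>lborel) = F \<xi>" for \<xi> by (simp add: F_def)
    thus ?thesis by (simp add: complex_norm_square mult.assoc flip: of_real_power)
  qed
  also have "\<dots> = (\<integral>x. f x * (\<integral>\<xi>. character x \<xi> * (cnj (F \<xi>) * of_real (gaussian (\<epsilon> *\<^sub>R \<xi>))) \<partial>lborel) \<partial>lborel)"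
    by (rule bounded_kernel_swap[OF f k_int]) auto
  also have "\<dots> = of_real K * (\<integral>x. (\<integral>z. of_real (gaussian z) * (f x * cnj (f (x - \<epsilon> *\<^sub>R z))) \<partial>lborel) \<partial>lborel)"
  proof -
    have "f x * (of_real K * (\<integral>z. cnj (f (x - \<epsilon> *\<^sub>R z)) * of_real (gaussian z) \<partial>lborel))
       = of_real K * (\<integral>z. of_real (gaussian z) * (f x * cnj (f (x - \<epsilon> *\<^sub>R z))) \<partial>lborel)" for x
      by (simp add: mult_ac flip: integral_mult_right_zero)
    thus ?thesis unfolding inner by (simp only: integral_mult_right_zero)
  qed
  also have "(\<integral>x. (\<integral>z. of_real (gaussian z) * (f x * cnj (f (x - \<epsilon> *\<^sub>R z))) \<partial>lborel) \<partial>lborel)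
     = (\<integral>z. (\<integral>x. of_real (gaussian z) * (f x * cnj (f (x - \<epsilon> *\<^sub>R z))) \<partial>lborel) \<partial>lborel)"
  proof (rule lborel_pair.Fubini_integral, rule lborel_pair.Fubini_integrable)
    define Q where "Q = (\<integral>x. (norm (f x))\<^sup>2 \<partial>lborel)"
    show "case_prod (\<lambda>z x. of_real (gaussian z) * (f x * cnj (f (x - \<epsilon> *\<^sub>R z)))) \<in> borel_measurable (lborel \<Otimes>\<^sub>M lborel)"
      by measurable
    have int: "integrable lborel (\<lambda>x. f x * cnj (f (x - \<epsilon> *\<^sub>R z)))" for z
      using f2 integrable_lborel_translate[OF f2, of "\<epsilon> *\<^sub>R z"] by (intro integrable_mult_L2) auto
    show "AE z in lborel. integrable lborel (\<lambda>x. case (z, x) of (z, x) \<Rightarrow> of_real (gaussian z) * (f x * cnj (f (x - \<epsilon> *\<^sub>R z))))"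
      using int by (intro AE_I2) simp
    have le: "(\<integral>x. norm (f x * cnj (f (x - \<epsilon> *\<^sub>R z))) \<partial>lborel) \<le> 2 * Q" for z
      unfolding Q_def using f2 by (intro autocorrelation_bound) auto
    show "integrable lborel (\<lambda>z. \<integral>x. norm (case (z, x) of (z, x) \<Rightarrow> of_real (gaussian z) * (f x * cnj (f (x - \<epsilon> *\<^sub>R z)))) \<partial>lborel)"
    proof (rule Bochner_Integration.integrable_bound)
      show "integrable lborel (\<lambda>z::'a. gaussian z * (2 * Q))" by (intro integrable_mult_left integrable_gaussian)
      show "AE z in lborel. norm (\<integral>x. norm (case (z, x) of (z, x) \<Rightarrow> of_real (gaussian z) * (f x * cnj (f (x - \<epsilon> *\<^sub>R z)))) \<partial>lborel)
         \<le> norm (gaussian z * (2 * Q))"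
      proof (rule AE_I2)
        fix z :: 'a
        have "(\<integral>x. norm (case (z, x) of (z, x) \<Rightarrow> of_real (gaussian z) * (f x * cnj (f (x - \<epsilon> *\<^sub>R z)))) \<partial>lborel)
          = gaussian z * (\<integral>x. norm (f x * cnj (f (x - \<epsilon> *\<^sub>R z))) \<partial>lborel)"
          by (simp add: norm_mult)
        also have "\<dots> \<le> gaussian z * (2 * Q)" by (intro mult_left_mono le) simp
        finally show "norm (\<integral>x. norm (case (z, x) of (z, x) \<Rightarrow> of_real (gaussian z) * (f x * cnj (f (x - \<epsilon> *\<^sub>R z)))) \<partial>lborel)
         \<le> norm (gaussian z * (2 * Q))" by simp
      qed
    qed measurable
  qed
  also have "\<dots> = (\<integral>z. of_real (gaussian z) * (\<integral>x. f x * cnj (f (x - \<epsilon> *\<^sub>R z)) \<partial>lborel) \<partial>lborel)"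
    by simp
  finally show ?thesis by (simp add: K_def)
qed

text \<open>
  Let \<open>\<epsilon> \<rightarrow> 0\<close> in the regularised identity. The left side converges monotonically, which also gives the
  integrability of \<open>|F|\<^sup>2\<close>. On the right side the autocorrelation tends to its value at the origin, the
  integral of \<open>|f|\<^sup>2\<close>, and the factor \<open>(2\<pi>)\<^bsup>n/2\<^esup>\<close> and the integral of the
  Gaussian, which has the same value, multiply to \<open>(2\<pi>)\<^sup>n\<close>.
\<close>

lemma plancherel_lborel:
  fixes f :: "'a::euclidean_space \<Rightarrow> complex"
  assumes f: "integrable lborel f" and f2: "integrable lborel (\<lambda>x. (norm (f x))\<^sup>2)"
  defines "F \<equiv> \<lambda>\<xi>. \<integral>x. character x \<xi> * f x \<partial>lborel"
  shows "integrable lborel (\<lambda>\<xi>. (norm (F \<xi>))\<^sup>2)"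
    and "(\<integral>\<xi>. (norm (F \<xi>))\<^sup>2 \<partial>lborel) = (2 * pi) ^ DIM('a) * (\<integral>x. (norm (f x))\<^sup>2 \<partial>lborel)"
proof -
  define K :: real where "K = sqrt (2 * pi) ^ DIM('a)"
  define Q where "Q = (\<integral>x. (norm (f x))\<^sup>2 \<partial>lborel)"
  define \<epsilon> where "\<epsilon> n = inverse (real (Suc n))" for n
  define h where "h w = (\<integral>x. f x * cnj (f (x - w)) \<partial>lborel)" for w
  have \<epsilon>: "\<epsilon> n > 0" for n by (simp add: \<epsilon>_def)
  have \<epsilon>0: "\<epsilon> \<longlonglongrightarrow> 0" unfolding \<epsilon>_def by (rule LIMSEQ_inverse_real_of_nat)
  have \<epsilon>mono: "\<epsilon> n \<le> \<epsilon> m" if "m \<le> n" for m n using that by (simp add: \<epsilon>_def)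
  have [measurable]: "f \<in> borel_measurable borel" using f by auto
  have F_meas [measurable]: "F \<in> borel_measurable borel" unfolding F_def by measurable
  have h_meas [measurable]: "h \<in> borel_measurable borel" unfolding h_def by measurable
  have Fb: "norm (F \<xi>) \<le> (\<integral>x. norm (f x) \<partial>lborel)" for \<xi>
    unfolding F_def using integral_norm_bound[of lborel "\<lambda>x. character x \<xi> * f x"] by (simp add: norm_mult)
  have hb: "norm (h w) \<le> 2 * Q" for w
    unfolding h_def Q_def
    by (rule order_trans[OF integral_norm_bound autocorrelation_bound[OF f2]]) simp
  have h0: "h 0 = of_real Q"
    unfolding h_def Q_def by (simp add: complex_norm_square[symmetric] flip: of_real_power)
  have int: "integrable lborel (\<lambda>\<xi>. (norm (F \<xi>))\<^sup>2 * gaussian (\<epsilon> n *\<^sub>R \<xi>))" for n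
  proof (rule Bochner_Integration.integrable_bound)
    show "integrable lborel (\<lambda>\<xi>::'a. (\<integral>x. norm (f x) \<partial>lborel)\<^sup>2 * gaussian (\<epsilon> n *\<^sub>R \<xi>))"
      by (intro integrable_mult_right fourier_dilated_gaussian(1) \<epsilon>)
    show "AE \<xi> in lborel. norm ((norm (F \<xi>))\<^sup>2 * gaussian (\<epsilon> n *\<^sub>R \<xi>))
        \<le> norm ((\<integral>x. norm (f x) \<partial>lborel)\<^sup>2 * gaussian (\<epsilon> n *\<^sub>R \<xi>))"
      using Fb by (intro AE_I2) (auto simp: abs_mult intro!: mult_right_mono power_mono)
  qed measurable
  have "(\<lambda>n. of_real K * (\<integral>z. of_real (gaussian z) * h (\<epsilon> n *\<^sub>R z) \<partial>lborel))
     \<longlonglongrightarrow> of_real K * (\<integral>z. of_real (gaussian (z::'a)) * h 0 \<partial>lborel)"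
  proof (intro tendsto_intros integral_dominated_convergence[where w = "\<lambda>z. gaussian z * (2 * Q)"])
    show "AE z in lborel. (\<lambda>n. of_real (gaussian z) * h (\<epsilon> n *\<^sub>R z)) \<longlonglongrightarrow> of_real (gaussian z) * h 0"
    proof (intro AE_I2 tendsto_intros)
      fix z :: 'a
      have "(\<lambda>n. \<epsilon> n *\<^sub>R z) \<longlonglongrightarrow> 0" using tendsto_scaleR[OF \<epsilon>0 tendsto_const, of z] by simp
      from autocorrelation_continuous_0[OF f f2 this]
      show "(\<lambda>n. h (\<epsilon> n *\<^sub>R z)) \<longlonglongrightarrow> h 0" by (simp add: h_def)
    qed
    show "integrable lborel (\<lambda>z::'a. gaussian z * (2 * Q))" by (intro integrable_mult_left integrable_gaussian)
    show "AE z in lborel. norm (of_real (gaussian z) * h (\<epsilon> n *\<^sub>R z)) \<le> gaussian z * (2 * Q)" for n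
      using hb by (intro AE_I2) (auto simp: norm_mult intro!: mult_left_mono)
  qed measurable
  moreover have "of_real K * (\<integral>z. of_real (gaussian z) * h (\<epsilon> n *\<^sub>R z) \<partial>lborel)
     = of_real (\<integral>\<xi>. (norm (F \<xi>))\<^sup>2 * gaussian (\<epsilon> n *\<^sub>R \<xi>) \<partial>lborel)" for n
    using gaussian_regularised_plancherel[OF f f2 \<epsilon>, of n]
    unfolding h_def K_def F_def integral_complex_of_real by simp
  moreover have "of_real K * (\<integral>z. of_real (gaussian (z::'a)) * h 0 \<partial>lborel) = of_real (K * K * Q)"
    using integral_gaussian[where 'a = 'a] by (simp add: h0 K_def)
  ultimately have "(\<lambda>n. complex_of_real (\<integral>\<xi>. (norm (F \<xi>))\<^sup>2 * gaussian (\<epsilon> n *\<^sub>R \<xi>) \<partial>lborel)) \<longlonglongrightarrow> of_real (K * K * Q)"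
    by (simp only:)
  hence lim: "(\<lambda>n. \<integral>\<xi>. (norm (F \<xi>))\<^sup>2 * gaussian (\<epsilon> n *\<^sub>R \<xi>) \<partial>lborel) \<longlonglongrightarrow> K * K * Q"
    unfolding tendsto_of_real_iff .
  have mono: "AE \<xi> in lborel. mono (\<lambda>n. (norm (F \<xi>))\<^sup>2 * gaussian (\<epsilon> n *\<^sub>R \<xi>))"
  proof (intro AE_I2 monoI mult_left_mono)
    fix m n :: nat and \<xi> :: 'a assume "m \<le> n"
    hence "(\<epsilon> n * norm \<xi>)\<^sup>2 \<le> (\<epsilon> m * norm \<xi>)\<^sup>2"
      using \<epsilon>mono \<epsilon>[of n] by (intro power_mono mult_right_mono) auto
    thus "gaussian (\<epsilon> m *\<^sub>R \<xi>) \<le> gaussian (\<epsilon> n *\<^sub>R \<xi>)"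
      using \<epsilon>[of m] \<epsilon>[of n] by (simp add: gaussian_def abs_of_pos)
  qed simp
  have plim: "AE \<xi> in lborel. (\<lambda>n. (norm (F \<xi>))\<^sup>2 * gaussian (\<epsilon> n *\<^sub>R \<xi>)) \<longlonglongrightarrow> (norm (F \<xi>))\<^sup>2"
  proof (rule AE_I2)
    fix \<xi> :: 'a
    have "(\<lambda>n. (norm (F \<xi>))\<^sup>2 * exp (- (norm (\<epsilon> n *\<^sub>R \<xi>))\<^sup>2 / 2)) \<longlonglongrightarrow> (norm (F \<xi>))\<^sup>2 * exp (- (norm (0 *\<^sub>R \<xi>))\<^sup>2 / 2)"
      by (intro tendsto_intros \<epsilon>0) simp
    thus "(\<lambda>n. (norm (F \<xi>))\<^sup>2 * gaussian (\<epsilon> n *\<^sub>R \<xi>)) \<longlonglongrightarrow> (norm (F \<xi>))\<^sup>2" by (simp add: gaussian_def)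
  qed
  note res = integral_monotone_convergence_nonneg[OF int mono _ plim lim]
  show "integrable lborel (\<lambda>\<xi>. (norm (F \<xi>))\<^sup>2)" by (rule res(1)) auto
  have "(\<integral>\<xi>. (norm (F \<xi>))\<^sup>2 \<partial>lborel) = K * K * Q" by (rule res(2)) auto
  also have "K * K = (2 * pi) ^ DIM('a)" unfolding K_def power_mult_distrib[symmetric] by simp
  finally show "(\<integral>\<xi>. (norm (F \<xi>))\<^sup>2 \<partial>lborel) = (2 * pi) ^ DIM('a) * (\<integral>x. (norm (f x))\<^sup>2 \<partial>lborel)"
    by (simp add: Q_def)
qed

text \<open>
  Fubini's theorem on the product space applies to Borel functions, whereas the elements of \<open>L\<^sup>1\<close> and
  \<open>L\<^sup>2\<close> are Lebesgue measurable.
\<close>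

lemma borel_representative:
  fixes f :: "'a::euclidean_space \<Rightarrow> complex"
  assumes f: "f \<in> borel_measurable lebesgue"
  obtains g where "g \<in> borel_measurable borel" "AE x in lebesgue. f x = g x"
proof -
  have "(\<lambda>x. Re (f x)) \<in> borel_measurable lebesgue" "(\<lambda>x. Im (f x)) \<in> borel_measurable lebesgue"
    using f by simp_all
  from this[THEN completion_ex_borel_measurable_real]
  obtain p q where pq [measurable]: "p \<in> borel_measurable lborel" "q \<in> borel_measurable lborel"
    and ae: "AE x in lborel. Re (f x) = p x" "AE x in lborel. Im (f x) = q x" by blast
  show ?thesis
  proof (rule that[of "\<lambda>x. Complex (p x) (q x)"])
    have [measurable]: "p \<in> borel_measurable borel" "q \<in> borel_measurable borel" using pq by simp_all
    have "(\<lambda>x. complex_of_real (p x) + \<i> * complex_of_real (q x)) \<in> borel_measurable borel" by measurable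
    thus "(\<lambda>x. Complex (p x) (q x)) \<in> borel_measurable borel" by (simp add: Complex_eq)
    show "AE x in lebesgue. f x = Complex (p x) (q x)"
      using AE_completion[OF ae(1)] AE_completion[OF ae(2)] by eventually_elim (simp add: complex_eq_iff)
  qed
qed

theorem plancherel:
  fixes f :: "'a::euclidean_space \<Rightarrow> complex"
  assumes f1: "in_L1 f" and f2: "in_L2 f"
  shows "in_L2 (fourier f)"
    and "(\<integral>\<xi>. (norm (fourier f \<xi>))\<^sup>2 \<partial>lebesgue) = (2 * pi) ^ DIM('a) * (\<integral>x. (norm (f x))\<^sup>2 \<partial>lebesgue)"
proof -
  have fm [measurable]: "f \<in> borel_measurable lebesgue" using f2 by (simp add: in_L2_def)
  obtain g where g [measurable]: "g \<in> borel_measurable borel" and ae: "AE x in lebesgue. f x = g x"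
    using borel_representative[OF fm] .
  have gl [measurable]: "g \<in> borel_measurable lebesgue" by (intro measurable_completion) simp
  have "integrable lebesgue g" using f1 integrable_cong_AE[OF fm gl ae] by (simp add: in_L1_def)
  hence g1: "integrable lborel g" by (simp add: integrable_completion)
  have sq: "(\<lambda>x. (norm (g x))\<^sup>2) \<in> borel_measurable lebesgue" "(\<lambda>x. (norm (f x))\<^sup>2) \<in> borel_measurable lebesgue"
    by measurable
  have ae2: "AE x in lebesgue. (norm (f x))\<^sup>2 = (norm (g x))\<^sup>2" using ae by eventually_elim simp
  have "integrable lebesgue (\<lambda>x. (norm (g x))\<^sup>2)"
    using f2 integrable_cong_AE[OF sq(2,1) ae2] by (simp add: in_L2_def)
  hence g2: "integrable lborel (\<lambda>x. (norm (g x))\<^sup>2)" by (simp add: integrable_completion)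
  define F where "F \<xi> = (\<integral>x. character x \<xi> * g x \<partial>lborel)" for \<xi>
  have eq: "fourier f = F"
  proof
    fix \<xi> :: 'a
    have c: "(\<lambda>x. exp (- (\<i> * complex_of_real (x \<bullet> \<xi>)))) \<in> borel_measurable lebesgue"
      by (intro measurable_completion) measurable
    have "fourier f \<xi> = fourier g \<xi>"
      unfolding fourier_def using ae
      by (intro integral_cong_AE borel_measurable_times c fm gl) (auto elim: eventually_mono)
    thus "fourier f \<xi> = F \<xi>" unfolding F_def by (simp add: fourier_lborel)
  qed
  have Fm [measurable]: "F \<in> borel_measurable borel" unfolding F_def by measurable
  have Fsq: "(\<lambda>\<xi>. (norm (F \<xi>))\<^sup>2) \<in> borel_measurable lborel" by simp
  note P = plancherel_lborel[OF g1 g2, folded F_def]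
  have "F \<in> borel_measurable lebesgue" by (intro measurable_completion) simp
  with P(1) show "in_L2 (fourier f)"
    unfolding in_L2_def eq using Fsq by (simp add: integrable_completion)
  have "(\<integral>\<xi>. (norm (fourier f \<xi>))\<^sup>2 \<partial>lebesgue) = (\<integral>\<xi>. (norm (F \<xi>))\<^sup>2 \<partial>lborel)"
    unfolding eq by (rule integral_completion[OF Fsq])
  also note P(2)
  also have "(\<integral>x. (norm (g x))\<^sup>2 \<partial>lborel) = (\<integral>x. (norm (g x))\<^sup>2 \<partial>lebesgue)"
    by (rule integral_completion[symmetric]) simp
  also have "\<dots> = (\<integral>x. (norm (f x))\<^sup>2 \<partial>lebesgue)"
    using ae2 by (intro integral_cong_AE sq) (auto elim: eventually_mono)
  finally show "(\<integral>\<xi>. (norm (fourier f \<xi>))\<^sup>2 \<partial>lebesgue) = (2 * pi) ^ DIM('a) * (\<integral>x. (norm (f x))\<^sup>2 \<partial>lebesgue)" .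
qed

lemma L2_norm_squared: "(L2_norm f)\<^sup>2 = (\<integral>x. (norm (f x))\<^sup>2 \<partial>lebesgue)"
  by (simp add: L2_norm_def)

lemma nn_integral_L2:
  assumes "in_L2 f"
  shows "(\<integral>\<^sup>+x. ennreal ((norm (f x))\<^sup>2) \<partial>lebesgue) = ennreal ((L2_norm f)\<^sup>2)"
  unfolding L2_norm_squared using assms by (intro nn_integral_eq_integral) (auto simp: in_L2_def)

lemma ball_truncation:
  fixes f :: "'a::euclidean_space \<Rightarrow> complex"
  assumes f2: "in_L2 f"
  shows "in_L1 (\<lambda>x. indicator (cball 0 R) x * f x)" and "in_L2 (\<lambda>x. indicator (cball 0 R) x * f x)"
proof -
  have [measurable]: "f \<in> borel_measurable lebesgue" and int: "integrable lebesgue (\<lambda>x. (norm (f x))\<^sup>2)"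
    using f2 by (auto simp: in_L2_def)
  have i: "indicator (cball 0 R) \<in> borel_measurable (lebesgue :: 'a measure)"
    by (intro borel_measurable_indicator sets_completionI_sets) simp
  have ic: "(\<lambda>x. indicator (cball 0 R) x :: complex) \<in> borel_measurable (lebesgue :: 'a measure)"
    by (intro borel_measurable_indicator sets_completionI_sets) simp
  have m: "(\<lambda>x. indicator (cball 0 R) x * f x) \<in> borel_measurable lebesgue"
    by (intro borel_measurable_times ic) simp
  have "emeasure lborel (cball (0::'a) R) < \<infinity>" by (rule emeasure_bounded_finite) simp
  hence ind: "integrable lebesgue (indicator (cball (0::'a) R) :: 'a \<Rightarrow> real)"
    by (intro integrable_real_indicator) (auto intro: sets_completionI_sets)
  have "a \<le> 1 + a\<^sup>2" for a :: real using mult_le_sum_squares[of a 1] by simp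
  hence bd: "norm (indicator (cball 0 R) x * f x) \<le> norm (indicator (cball 0 R) x + (norm (f x))\<^sup>2)" for x
    by (auto split: split_indicator)
  show "in_L1 (\<lambda>x. indicator (cball 0 R) x * f x)"
    unfolding in_L1_def
    by (rule Bochner_Integration.integrable_bound[OF Bochner_Integration.integrable_add[OF ind int] m])
      (use bd in \<open>intro AE_I2\<close>)
  show "in_L2 (\<lambda>x. indicator (cball 0 R) x * f x)"
    unfolding in_L2_def
  proof (intro conjI m Bochner_Integration.integrable_bound[OF int])
    show "(\<lambda>x. (norm (indicator (cball 0 R) x * f x))\<^sup>2) \<in> borel_measurable lebesgue" using m by measurable
  qed (auto intro!: AE_I2 split: split_indicator)
qed

text \<open>
  With \<open>\<eta> \<rightarrow> 0\<close> this replaces the triangle inequality of the \<open>L\<^sup>2\<close> norm. It can be integrated directly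
  as an inequality between nonnegative, possibly infinite integrals.
\<close>

lemma norm_square_young:
  fixes a b :: "'b::real_normed_vector"
  assumes "\<eta> > 0"
  shows "(norm a)\<^sup>2 \<le> (1 + \<eta>) * (norm b)\<^sup>2 + (1 + 1 / \<eta>) * (norm (b - a))\<^sup>2"
proof -
  define s where "s = sqrt \<eta>"
  have s: "s > 0" "s\<^sup>2 = \<eta>" using assms by (auto simp: s_def)
  have "norm a \<le> norm b + norm (b - a)" using norm_triangle_sub[of a b] by (simp add: norm_minus_commute)
  hence "(norm a)\<^sup>2 \<le> (norm b + norm (b - a))\<^sup>2" by (intro power_mono) auto
  also have "\<dots> = (norm b)\<^sup>2 + (norm (b - a))\<^sup>2 + 2 * ((s * norm b) * (norm (b - a) / s))"
    using s by (simp add: power2_eq_square algebra_simps)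
  also have "2 * ((s * norm b) * (norm (b - a) / s)) \<le> (s * norm b)\<^sup>2 + (norm (b - a) / s)\<^sup>2"
    using sum_squares_bound[of "s * norm b" "norm (b - a) / s"] by (simp only: mult.assoc)
  finally show ?thesis using s by (simp add: power_mult_distrib power_divide algebra_simps)
qed

lemma le_by_relaxation:
  fixes x y :: real
  assumes "\<And>\<eta>. \<eta> > 0 \<Longrightarrow> x \<le> (1 + \<eta>) * y"
  shows "x \<le> y"
proof (rule tendsto_lowerbound[where F = "at_right (0::real)" and f = "\<lambda>\<eta>. (1 + \<eta>) * y"])
  have "((\<lambda>\<eta>. (1 + \<eta>) * y) \<longlongrightarrow> (1 + 0) * y) (at_right 0)" by (intro tendsto_intros)
  thus "((\<lambda>\<eta>. (1 + \<eta>) * y) \<longlongrightarrow> y) (at_right 0)" by simp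
  show "\<forall>\<^sub>F \<eta> in at_right 0. x \<le> (1 + \<eta>) * y"
    using assms by (auto simp: eventually_at_right_field intro!: exI[of _ 1])
qed simp

text \<open>
  The identity holds for the truncations of \<open>f\<close>. Their norms converge to that of \<open>f\<close>, and the norms of
  their transforms converge to that of \<open>g\<close> by the definition of the \<open>L\<^sup>2\<close> transform.
\<close>

theorem plancherel_L2:
  fixes f g :: "'a::euclidean_space \<Rightarrow> complex"
  assumes fg: "L2_fourier f g"
  shows "(L2_norm g)\<^sup>2 = (2 * pi) ^ DIM('a) * (L2_norm f)\<^sup>2"
proof -
  define T where "T R x = indicator (cball 0 R) x * f x" for R :: real and x
  define D where "D n = (\<integral>\<^sup>+\<xi>. ennreal ((norm (fourier (T (real n)) \<xi> - g \<xi>))\<^sup>2) \<partial>lebesgue)" for n :: nat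
  define X where "X n = (\<integral>x. (norm (T (real n) x))\<^sup>2 \<partial>lebesgue)" for n :: nat
  define P :: real where "P = (2 * pi) ^ DIM('a)"
  have P: "P \<ge> 0" by (simp add: P_def)
  have f2: "in_L2 f" and g2: "in_L2 g"
    and lim: "((\<lambda>R. \<integral>\<^sup>+\<xi>. ennreal ((norm (fourier (T R) \<xi> - g \<xi>))\<^sup>2) \<partial>lebesgue) \<longlongrightarrow> 0) at_top"
    using fg by (auto simp: L2_fourier_def T_def[abs_def])
  have [measurable]: "f \<in> borel_measurable lebesgue" "g \<in> borel_measurable lebesgue"
    using f2 g2 by (auto simp: in_L2_def)
  have D: "D \<longlonglongrightarrow> 0" unfolding D_def by (rule filterlim_compose[OF lim filterlim_real_sequentially])
  have T1: "in_L1 (T R)" and T2: "in_L2 (T R)" for R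
    using ball_truncation[OF f2] by (simp_all add: T_def[abs_def])
  have [measurable]: "fourier (T R) \<in> borel_measurable lebesgue" for R
    using plancherel(1)[OF T1 T2] by (simp add: in_L2_def)
  have FT: "(\<integral>\<^sup>+\<xi>. ennreal ((norm (fourier (T (real n)) \<xi>))\<^sup>2) \<partial>lebesgue) = ennreal (P * X n)" for n
    unfolding nn_integral_L2[OF plancherel(1)[OF T1 T2]] L2_norm_squared plancherel(2)[OF T1 T2] X_def P_def ..
  have X: "X \<longlonglongrightarrow> (L2_norm f)\<^sup>2"
    unfolding X_def L2_norm_squared
  proof (rule integral_dominated_convergence[where w = "\<lambda>x. (norm (f x))\<^sup>2"])
    show "(\<lambda>x. (norm (T (real n) x))\<^sup>2) \<in> borel_measurable lebesgue" for n
      using T2[of "real n"] by (auto simp: in_L2_def)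
    show "AE x in lebesgue. (\<lambda>n. (norm (T (real n) x))\<^sup>2) \<longlonglongrightarrow> (norm (f x))\<^sup>2"
    proof (rule AE_I2)
      fix x :: 'a
      obtain K :: nat where K: "norm x \<le> K" using real_arch_simple by blast
      have "\<forall>\<^sub>F n in sequentially. (norm (T (real n) x))\<^sup>2 = (norm (f x))\<^sup>2"
        using K by (intro eventually_sequentiallyI[of K]) (auto simp: T_def indicator_def)
      thus "(\<lambda>n. (norm (T (real n) x))\<^sup>2) \<longlonglongrightarrow> (norm (f x))\<^sup>2" by (rule tendsto_eventually)
    qed
  qed (use f2 in \<open>auto simp: in_L2_def T_def split: split_indicator\<close>)
  have PX: "(\<lambda>n. ennreal (P * X n)) \<longlonglongrightarrow> ennreal (P * (L2_norm f)\<^sup>2)"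
    by (intro tendsto_ennrealI tendsto_intros X)
  have young: "(\<integral>\<^sup>+\<xi>. ennreal ((norm (a \<xi>))\<^sup>2) \<partial>lebesgue)
      \<le> ennreal (1 + \<eta>) * (\<integral>\<^sup>+\<xi>. ennreal ((norm (b \<xi>))\<^sup>2) \<partial>lebesgue)
        + ennreal (1 + 1 / \<eta>) * (\<integral>\<^sup>+\<xi>. ennreal ((norm (b \<xi> - a \<xi>))\<^sup>2) \<partial>lebesgue)"
    if \<eta>: "\<eta> > 0" and [measurable]: "a \<in> borel_measurable lebesgue" "b \<in> borel_measurable lebesgue"
    for \<eta> and a b :: "'a \<Rightarrow> complex"
  proof -
    have "(\<integral>\<^sup>+\<xi>. ennreal ((norm (a \<xi>))\<^sup>2) \<partial>lebesgue)
      \<le> (\<integral>\<^sup>+\<xi>. ennreal (1 + \<eta>) * ennreal ((norm (b \<xi>))\<^sup>2) + ennreal (1 + 1 / \<eta>) * ennreal ((norm (b \<xi> - a \<xi>))\<^sup>2) \<partial>lebesgue)"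
    proof (rule nn_integral_mono)
      fix \<xi>
      have "ennreal ((norm (a \<xi>))\<^sup>2) \<le> ennreal ((1 + \<eta>) * (norm (b \<xi>))\<^sup>2 + (1 + 1 / \<eta>) * (norm (b \<xi> - a \<xi>))\<^sup>2)"
        by (intro ennreal_leI norm_square_young \<eta>)
      thus "ennreal ((norm (a \<xi>))\<^sup>2) \<le> ennreal (1 + \<eta>) * ennreal ((norm (b \<xi>))\<^sup>2) + ennreal (1 + 1 / \<eta>) * ennreal ((norm (b \<xi> - a \<xi>))\<^sup>2)"
        using \<eta> by (simp add: ennreal_mult ennreal_plus)
    qed
    thus ?thesis by (simp add: nn_integral_add nn_integral_cmult)
  qed
  have Dlim: "(\<lambda>n. ennreal (1 + 1 / \<eta>) * D n) \<longlonglongrightarrow> 0" for \<eta>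
    using ennreal_tendsto_cmult[OF _ D, of "ennreal (1 + 1 / \<eta>)"] by simp
  have le1: "(L2_norm g)\<^sup>2 \<le> (1 + \<eta>) * (P * (L2_norm f)\<^sup>2)" if \<eta>: "\<eta> > 0" for \<eta>
  proof -
    have "ennreal ((L2_norm g)\<^sup>2) \<le> ennreal (1 + \<eta>) * ennreal (P * (L2_norm f)\<^sup>2) + 0"
    proof (rule tendsto_lowerbound)
      show "(\<lambda>n. ennreal (1 + \<eta>) * ennreal (P * X n) + ennreal (1 + 1 / \<eta>) * D n)
        \<longlonglongrightarrow> ennreal (1 + \<eta>) * ennreal (P * (L2_norm f)\<^sup>2) + 0"
        by (intro tendsto_add ennreal_tendsto_cmult PX Dlim) simp
      show "\<forall>\<^sub>F n in sequentially. ennreal ((L2_norm g)\<^sup>2) \<le> ennreal (1 + \<eta>) * ennreal (P * X n) + ennreal (1 + 1 / \<eta>) * D n"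
        unfolding nn_integral_L2[OF g2, symmetric] FT[symmetric] D_def
        by (intro always_eventually allI young \<eta>) simp_all
    qed simp
    also have "\<dots> = ennreal ((1 + \<eta>) * (P * (L2_norm f)\<^sup>2))"
      unfolding add_0_right using \<eta> P by (intro ennreal_mult[symmetric]) auto
    finally show ?thesis using \<eta> P by (subst (asm) ennreal_le_iff) auto
  qed
  have le2: "P * (L2_norm f)\<^sup>2 \<le> (1 + \<eta>) * (L2_norm g)\<^sup>2" if \<eta>: "\<eta> > 0" for \<eta>
  proof -
    have "ennreal (P * (L2_norm f)\<^sup>2) \<le> ennreal (1 + \<eta>) * ennreal ((L2_norm g)\<^sup>2) + 0"
    proof (rule tendsto_le[OF _ _ PX])
      show "(\<lambda>n. ennreal (1 + \<eta>) * ennreal ((L2_norm g)\<^sup>2) + ennreal (1 + 1 / \<eta>) * D n)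
        \<longlonglongrightarrow> ennreal (1 + \<eta>) * ennreal ((L2_norm g)\<^sup>2) + 0"
        by (intro tendsto_add tendsto_const Dlim)
      show "\<forall>\<^sub>F n in sequentially. ennreal (P * X n) \<le> ennreal (1 + \<eta>) * ennreal ((L2_norm g)\<^sup>2) + ennreal (1 + 1 / \<eta>) * D n"
        unfolding nn_integral_L2[OF g2, symmetric] FT[symmetric] D_def
        by (subst norm_minus_commute) (intro always_eventually allI young \<eta>; simp)
    qed simp
    also have "\<dots> = ennreal ((1 + \<eta>) * (L2_norm g)\<^sup>2)"
      unfolding add_0_right using \<eta> by (intro ennreal_mult[symmetric]) auto
    finally show ?thesis using \<eta> by (subst (asm) ennreal_le_iff) auto
  qed
  show ?thesis
    using le_by_relaxation[of "(L2_norm g)\<^sup>2" "P * (L2_norm f)\<^sup>2"] le_by_relaxation[of "P * (L2_norm f)\<^sup>2" "(L2_norm g)\<^sup>2"]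
      le1 le2 by (intro antisym) (auto simp: P_def)
qed

section \<open>Integrals of radial functions\<close>

text \<open>
  The area of the unit sphere in \<open>n\<close> dimensions.
\<close>

definition sphere_area :: "nat \<Rightarrow> real" where
  "sphere_area n = real n * unit_ball_vol (real n)"

lemma sphere_area_pos: "0 < n \<Longrightarrow> 0 < sphere_area n"
  by (simp add: sphere_area_def)

text \<open>
  Both measures give the half line \<open>{..b}\<close> the volume of the ball of radius \<open>b\<close>.
\<close>

lemma distr_norm_lborel:
  "distr (lborel :: 'a::euclidean_space measure) borel norm
    = density lborel (\<lambda>r. ennreal (indicator {0..} r * (sphere_area DIM('a) * r ^ (DIM('a) - 1))))"
proof (rule measure_eqI_generator_eq[where E = "range atMost" and \<Omega> = UNIV and A = "\<lambda>i. {..real i}"])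
  let ?n = "DIM('a)"
  have ind: "indicator {0..} r * (sphere_area ?n * r ^ (?n - 1)) \<ge> 0" for r :: real
    by (auto simp: sphere_area_def indicator_def)
  show "Int_stable (range atMost :: real set set)" by (auto simp: Int_stable_def)
  show "sets (distr (lborel :: 'a measure) borel norm) = sigma_sets UNIV (range atMost)"
    by (simp add: borel_eq_atMost)
  show "sets (density lborel (\<lambda>r. ennreal (indicator {0..} r * (sphere_area ?n * r ^ (?n - 1))))) = sigma_sets UNIV (range atMost)"
    by (simp add: borel_eq_atMost)
  show "(\<Union>i. {..real i}) = UNIV" by (auto simp: real_arch_simple)
  have ball: "emeasure (distr (lborel :: 'a measure) borel norm) {..b} = ennreal (unit_ball_vol ?n * (max 0 b) ^ ?n)" for b
  proof -
    have "emeasure (distr (lborel :: 'a measure) borel norm) {..b} = emeasure (lborel :: 'a measure) {x. norm x \<le> b}"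
      by (subst emeasure_distr) (auto intro!: arg_cong2[where f = emeasure])
    also have "{x :: 'a. norm x \<le> b} = cball 0 b" by (auto simp: dist_norm)
    also have "emeasure lborel (cball (0::'a) b) = ennreal (unit_ball_vol ?n * (max 0 b) ^ ?n)"
      by (cases "b \<ge> 0") (auto simp: emeasure_cball)
    finally show ?thesis .
  qed
  show "emeasure (distr (lborel :: 'a measure) borel norm) {..real i} \<noteq> \<infinity>" for i by (simp add: ball)
  fix X :: "real set" assume "X \<in> range atMost"
  then obtain b where X: "X = {..b}" by blast
  have "emeasure (density lborel (\<lambda>r. ennreal (indicator {0..} r * (sphere_area ?n * r ^ (?n - 1))))) {..b}
     = (\<integral>\<^sup>+r. ennreal (indicator {0..} r * (sphere_area ?n * r ^ (?n - 1))) * indicator {..b} r \<partial>lborel)"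
    by (subst emeasure_density) auto
  also have "\<dots> = ennreal (unit_ball_vol ?n * (max 0 b) ^ ?n)"
  proof (cases "b \<ge> 0")
    case True
    have "(\<integral>\<^sup>+r. ennreal (indicator {0..} r * (sphere_area ?n * r ^ (?n - 1))) * indicator {..b} r \<partial>lborel)
      = (\<integral>\<^sup>+r. ennreal (sphere_area ?n * r ^ (?n - 1)) * indicator {0..b} r \<partial>lborel)"
      by (intro nn_integral_cong) (auto split: split_indicator)
    also have "\<dots> = ennreal (unit_ball_vol ?n * b ^ ?n - unit_ball_vol ?n * 0 ^ ?n)"
    proof (rule nn_integral_FTC_Icc)
      fix r :: real assume "r \<in> {0..b}"
      hence "0 \<le> r" by simp
      show "((\<lambda>r. unit_ball_vol ?n * r ^ ?n) has_real_derivative sphere_area ?n * r ^ (?n - 1)) (at r)"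
        by (auto intro!: derivative_eq_intros simp: sphere_area_def)
      show "0 \<le> sphere_area ?n * r ^ (?n - 1)" using \<open>0 \<le> r\<close> by (simp add: sphere_area_def)
    qed (use True in auto)
    finally show ?thesis using True by simp
  next
    case False
    hence zero: "ennreal (indicator {0..} r * (sphere_area ?n * r ^ (?n - 1))) * indicator {..b} r = 0" for r
      by (auto split: split_indicator)
    show ?thesis unfolding zero using False by (simp add: power_0_left)
  qed
  finally show "emeasure (distr (lborel :: 'a measure) borel norm) X
    = emeasure (density lborel (\<lambda>r. ennreal (indicator {0..} r * (sphere_area ?n * r ^ (?n - 1))))) X"
    unfolding X ball by simp
qed auto

lemma nn_integral_radial:
  assumes [measurable]: "g \<in> borel_measurable borel"
  shows "(\<integral>\<^sup>+\<xi>. g (norm \<xi>) \<partial>(lborel :: 'a::euclidean_space measure))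
    = (\<integral>\<^sup>+r. ennreal (indicator {0..} r * (sphere_area DIM('a) * r ^ (DIM('a) - 1))) * g r \<partial>lborel)"
proof -
  have "(\<integral>\<^sup>+\<xi>. g (norm \<xi>) \<partial>(lborel :: 'a measure)) = (\<integral>\<^sup>+r. g r \<partial>distr (lborel :: 'a measure) borel norm)"
    by (subst nn_integral_distr) auto
  thus ?thesis unfolding distr_norm_lborel by (subst (asm) nn_integral_density) auto
qed

lemma nn_integral_shell:
  assumes [measurable]: "\<phi> \<in> borel_measurable borel" and ab: "0 \<le> a"
  shows "(\<integral>\<^sup>+\<xi>. ennreal (indicator {a..b} (norm \<xi>) * \<phi> (norm \<xi>)) \<partial>(lborel :: 'a::euclidean_space measure))
    = (\<integral>\<^sup>+r. ennreal (indicator {a..b} r * (sphere_area DIM('a) * (\<phi> r * r ^ (DIM('a) - 1)))) \<partial>lborel)"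
proof (subst nn_integral_radial[where g = "\<lambda>r. ennreal (indicator {a..b} r * \<phi> r)"])
  show "(\<integral>\<^sup>+r. ennreal (indicator {0..} r * (sphere_area DIM('a) * r ^ (DIM('a) - 1))) * ennreal (indicator {a..b} r * \<phi> r) \<partial>lborel)
    = (\<integral>\<^sup>+r. ennreal (indicator {a..b} r * (sphere_area DIM('a) * (\<phi> r * r ^ (DIM('a) - 1)))) \<partial>lborel)"
  proof (rule nn_integral_cong)
    fix r :: real
    show "ennreal (indicator {0..} r * (sphere_area DIM('a) * r ^ (DIM('a) - 1))) * ennreal (indicator {a..b} r * \<phi> r)
      = ennreal (indicator {a..b} r * (sphere_area DIM('a) * (\<phi> r * r ^ (DIM('a) - 1))))"
    proof (cases "r \<in> {a..b}")
      case True
      hence "0 \<le> sphere_area DIM('a) * r ^ (DIM('a) - 1)" using ab by (simp add: sphere_area_def)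
      from ennreal_mult'[OF this, of "\<phi> r"] True ab show ?thesis by (simp add: mult_ac)
    qed simp
  qed
qed measurable

text \<open>
  In practice \<open>\<psi>\<close> is a power of \<open>r\<close> with the explicit antiderivative \<open>F\<close>.
\<close>

lemma radial_shell_upper:
  fixes F \<phi> \<psi> :: "real \<Rightarrow> real"
  assumes ab: "0 \<le> a" "a \<le> b" and [measurable]: "\<phi> \<in> borel_measurable borel"
    and le: "\<And>r. a \<le> r \<Longrightarrow> r \<le> b \<Longrightarrow> \<phi> r * r ^ (DIM('a) - 1) \<le> \<psi> r"
    and pos: "\<And>r. a \<le> r \<Longrightarrow> r \<le> b \<Longrightarrow> 0 \<le> \<psi> r"
    and F: "\<And>r. a \<le> r \<Longrightarrow> r \<le> b \<Longrightarrow> (F has_real_derivative \<psi> r) (at r)"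
  shows "(\<integral>\<^sup>+\<xi>. ennreal (indicator {a..b} (norm \<xi>) * \<phi> (norm \<xi>)) \<partial>(lborel :: 'a::euclidean_space measure))
    \<le> ennreal (sphere_area DIM('a) * (F b - F a))"
proof -
  have S: "0 < sphere_area DIM('a)" by (rule sphere_area_pos) simp
  have "(\<psi> has_integral (F b - F a)) {a..b}"
    using ab F by (intro fundamental_theorem_of_calculus)
      (auto simp: has_real_derivative_iff_has_vector_derivative[symmetric] intro: DERIV_subset)
  hence I: "((\<lambda>r. sphere_area DIM('a) * \<psi> r) has_integral sphere_area DIM('a) * (F b - F a)) {a..b}"
    by (rule has_integral_mult_right)
  have "(\<integral>\<^sup>+r. ennreal (indicator {a..b} r * (sphere_area DIM('a) * (\<phi> r * r ^ (DIM('a) - 1)))) \<partial>lborel)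
     \<le> (\<integral>\<^sup>+r. ennreal (indicator {a..b} r * (sphere_area DIM('a) * \<psi> r)) \<partial>lborel)"
    using le S by (intro nn_integral_mono ennreal_leI) (auto split: split_indicator intro!: mult_left_mono)
  also have "\<dots> = ennreal (sphere_area DIM('a) * (F b - F a))"
    using S pos by (intro nn_integral_has_integral_lebesgue[OF _ I]) auto
  finally show ?thesis unfolding nn_integral_shell[OF assms(3) ab(1)] .
qed

text \<open>
  The minorant \<open>\<psi>\<close> may change sign, as in \<open>sine_square_shell\<close>; the continuity of \<open>\<phi>\<close> provides an integral
  to compare with.
\<close>

lemma radial_shell_lower:
  fixes F \<phi> \<psi> :: "real \<Rightarrow> real"
  assumes ab: "0 \<le> a" "a \<le> b" and [measurable]: "\<phi> \<in> borel_measurable borel"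
    and cont: "continuous_on {a..b} \<phi>"
    and pos: "\<And>r. a \<le> r \<Longrightarrow> r \<le> b \<Longrightarrow> 0 \<le> \<phi> r"
    and le: "\<And>r. a \<le> r \<Longrightarrow> r \<le> b \<Longrightarrow> \<psi> r \<le> \<phi> r * r ^ (DIM('a) - 1)"
    and F: "\<And>r. a \<le> r \<Longrightarrow> r \<le> b \<Longrightarrow> (F has_real_derivative \<psi> r) (at r)"
  shows "ennreal (sphere_area DIM('a) * (F b - F a))
    \<le> (\<integral>\<^sup>+\<xi>. ennreal (indicator {a..b} (norm \<xi>) * \<phi> (norm \<xi>)) \<partial>(lborel :: 'a::euclidean_space measure))"
proof -
  have S: "0 < sphere_area DIM('a)" by (rule sphere_area_pos) simp
  define J where "J = integral {a..b} (\<lambda>r. \<phi> r * r ^ (DIM('a) - 1))"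
  have J: "((\<lambda>r. \<phi> r * r ^ (DIM('a) - 1)) has_integral J) {a..b}"
    unfolding J_def by (intro integrable_integral integrable_continuous_interval continuous_intros cont)
  have "(\<psi> has_integral (F b - F a)) {a..b}"
    using ab F by (intro fundamental_theorem_of_calculus)
      (auto simp: has_real_derivative_iff_has_vector_derivative[symmetric] intro: DERIV_subset)
  from has_integral_le[OF this J] le have "F b - F a \<le> J" by auto
  hence "ennreal (sphere_area DIM('a) * (F b - F a)) \<le> ennreal (sphere_area DIM('a) * J)"
    using S by (intro ennreal_leI mult_left_mono) auto
  also have "ennreal (sphere_area DIM('a) * J)
    = (\<integral>\<^sup>+r. ennreal (indicator {a..b} r * (sphere_area DIM('a) * (\<phi> r * r ^ (DIM('a) - 1)))) \<partial>lborel)"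
    using S pos ab by (intro nn_integral_has_integral_lebesgue[OF _ has_integral_mult_right[OF J], symmetric]) auto
  finally show ?thesis unfolding nn_integral_shell[OF assms(3) ab(1)] .
qed

lemma inverse_fourth_power_weight:
  assumes "0 < (r::real)" "0 < n"
  shows "1 / r ^ 4 * r ^ (n - 1) = r powr (real n - 5)"
proof -
  have "r powr (real n - 5) = r powr real (n - 1) / r powr real 4"
    using assms by (subst powr_diff[symmetric]) (simp add: of_nat_diff)
  also have "\<dots> = r ^ (n - 1) / r ^ 4" using assms by (simp only: powr_realpow)
  finally show ?thesis by simp
qed

lemma decay_rate_squared:
  assumes "t > 1"
  shows "n \<le> 3 \<Longrightarrow> (decay_rate n t)\<^sup>2 = t powr (2 - real n / 2)"
    and "n = 4 \<Longrightarrow> (decay_rate n t)\<^sup>2 = ln t"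
    and "n \<ge> 5 \<Longrightarrow> (decay_rate n t)\<^sup>2 = t powr (1 - real n / 4)"
proof -
  have sq: "(t powr p)\<^sup>2 = t powr (2 * p)" for p
    using assms by (simp add: power2_eq_square powr_add[symmetric])
  show "n \<le> 3 \<Longrightarrow> (decay_rate n t)\<^sup>2 = t powr (2 - real n / 2)"
    by (simp add: decay_rate_def sq algebra_simps)
  show "n = 4 \<Longrightarrow> (decay_rate n t)\<^sup>2 = ln t" using assms by (simp add: decay_rate_def)
  show "n \<ge> 5 \<Longrightarrow> (decay_rate n t)\<^sup>2 = t powr (1 - real n / 4)"
    by (simp add: decay_rate_def sq algebra_simps)
qed

text \<open>
  The size of \<open>|U(t)|\<^sup>2\<close> relative to the data when damping is ignored: growth up to the scale
  \<open>r = t\<^bsup>-1/2\<^esup>\<close>, then the amplitude of the oscillation. Frequencies above 1 are left to the \<open>L\<^sup>2\<close> norm of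
  the data.
\<close>

definition low_kernel :: "real \<Rightarrow> real \<Rightarrow> real" where
  "low_kernel t r = (if r \<le> t powr (- 1 / 2) then t\<^sup>2 else if r \<le> 1 then 1 / r ^ 4 else 0)"

text \<open>
  The ball of radius \<open>t\<^bsup>-1/2\<^esup>\<close> contributes a multiple of \<open>t\<^bsup>2-n/2\<^esup>\<close>. The integral of \<open>r\<^bsup>n-5\<^esup>\<close> from
  \<open>t\<^bsup>-1/2\<^esup>\<close> to 1 is of the same order for \<open>n \<le> 3\<close> and equals \<open>ln t/2\<close> for \<open>n = 4\<close>. From \<open>t = e\<close> on the
  logarithm is at least 1 and so dominates the contribution of the ball.
\<close>

lemma low_kernel_integral:
  assumes n: "DIM('a::euclidean_space) \<le> 4"
  shows "\<exists>C>0. \<forall>t\<ge>exp 1. (\<integral>\<^sup>+\<xi>. ennreal (low_kernel t (norm \<xi>)) \<partial>(lborel :: 'a measure))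
     \<le> ennreal (C * (decay_rate DIM('a) t)\<^sup>2)"
proof -
  let ?n = "DIM('a)"
  let ?S = "sphere_area DIM('a)"
  have S: "?S > 0" by (rule sphere_area_pos) simp
  have "(\<integral>\<^sup>+\<xi>. ennreal (low_kernel t (norm \<xi>)) \<partial>(lborel :: 'a measure)) \<le> ennreal ((2 * ?S) * (decay_rate ?n t)\<^sup>2)"
    if t: "t \<ge> exp 1" for t
  proof -
    define R where "R = t powr (- 1 / 2)"
    have t1: "t > 1" using t exp_gt_one[of 1] by linarith
    have lnt: "ln t \<ge> 1" using t t1 by (simp add: ln_ge_iff)
    have R: "0 < R" "R \<le> 1"
    proof -
      show "0 < R" using t1 by (simp add: R_def)
      have "t powr (- 1 / 2) \<le> t powr 0" using t1 by (intro powr_mono) auto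
      thus "R \<le> 1" using t1 by (simp add: R_def)
    qed
    have Rn: "R powr p = t powr (- p / 2)" for p by (simp add: R_def powr_powr)
    have main_scale: "t powr (2 - real ?n / 2) \<le> (decay_rate ?n t)\<^sup>2"
    proof (cases "?n \<le> 3")
      case False
      hence "?n = 4" using n by simp
      thus ?thesis using decay_rate_squared(2)[OF t1, of ?n] lnt t1 by simp
    qed (simp add: decay_rate_squared(1)[OF t1])
    have I1: "(\<integral>\<^sup>+\<xi>. ennreal (indicator {0..R} (norm \<xi>) * t\<^sup>2) \<partial>(lborel :: 'a measure)) \<le> ennreal (?S * (decay_rate ?n t)\<^sup>2)"
    proof -
      have "(\<integral>\<^sup>+\<xi>. ennreal (indicator {0..R} (norm \<xi>) * t\<^sup>2) \<partial>(lborel :: 'a measure))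
          \<le> ennreal (?S * (t\<^sup>2 * R ^ ?n / ?n - t\<^sup>2 * 0 ^ ?n / ?n))"
        by (rule radial_shell_upper[where \<psi> = "\<lambda>r. t\<^sup>2 * r ^ (?n - 1)" and F = "\<lambda>r. t\<^sup>2 * r ^ ?n / ?n" and \<phi> = "\<lambda>_. t\<^sup>2"])
          (use R in \<open>auto intro!: derivative_eq_intros\<close>)
      also have "\<dots> \<le> ennreal (?S * (decay_rate ?n t)\<^sup>2)"
      proof (intro ennreal_leI mult_left_mono)
        have "R ^ ?n = t powr (- real ?n / 2)" using Rn[of "real ?n"] R by (simp add: powr_realpow)
        moreover have "t\<^sup>2 = t powr 2" using t1 by (simp add: powr_numeral)
        ultimately have "t\<^sup>2 * R ^ ?n = t powr (2 - real ?n / 2)" by (simp add: powr_add[symmetric])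
        moreover have "t\<^sup>2 * R ^ ?n / ?n \<le> t\<^sup>2 * R ^ ?n / 1"
          using R DIM_positive[where 'a='a] by (intro divide_left_mono) auto
        ultimately show "t\<^sup>2 * R ^ ?n / ?n - t\<^sup>2 * 0 ^ ?n / ?n \<le> (decay_rate ?n t)\<^sup>2"
          using main_scale by (simp add: power_0_left)
      qed (use S in simp)
      finally show ?thesis .
    qed
    have I2: "(\<integral>\<^sup>+\<xi>. ennreal (indicator {R..1} (norm \<xi>) * (1 / norm \<xi> ^ 4)) \<partial>(lborel :: 'a measure)) \<le> ennreal (?S * (decay_rate ?n t)\<^sup>2)"
    proof (cases "?n = 4")
      case True
      have "(\<integral>\<^sup>+\<xi>. ennreal (indicator {R..1} (norm \<xi>) * (1 / norm \<xi> ^ 4)) \<partial>(lborel :: 'a measure))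
          \<le> ennreal (?S * (ln 1 - ln R))"
      proof (rule radial_shell_upper[where \<psi> = "\<lambda>r. 1 / r" and F = ln and \<phi> = "\<lambda>r. 1 / r ^ 4"])
        fix r assume r: "R \<le> r" "r \<le> 1"
        have "r > 0" using r R by simp
        thus "1 / r ^ 4 * r ^ (?n - 1) \<le> 1 / r" by (simp add: True eval_nat_numeral)
        show "(ln has_real_derivative 1 / r) (at r)" using r R by (intro DERIV_ln_divide) auto
      qed (use R in auto)
      also have "\<dots> \<le> ennreal (?S * (decay_rate ?n t)\<^sup>2)"
        using S True t1 lnt by (intro ennreal_leI mult_left_mono) (auto simp: R_def ln_powr decay_rate_squared)
      finally show ?thesis .
    next
      case False
      hence n3: "?n \<le> 3" using n by simp
      let ?q = "4 - real ?n"
      have q: "?q \<ge> 1" using n3 by simp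
      have "(\<integral>\<^sup>+\<xi>. ennreal (indicator {R..1} (norm \<xi>) * (1 / norm \<xi> ^ 4)) \<partial>(lborel :: 'a measure))
          \<le> ennreal (?S * (- (1 powr - ?q) / ?q - - (R powr - ?q) / ?q))"
      proof (rule radial_shell_upper[where \<psi> = "\<lambda>r. r powr (real ?n - 5)" and F = "\<lambda>r. - (r powr - ?q) / ?q" and \<phi> = "\<lambda>r. 1 / r ^ 4"])
        fix r assume r: "R \<le> r" "r \<le> 1"
        show "1 / r ^ 4 * r ^ (?n - 1) \<le> r powr (real ?n - 5)"
          using r R by (subst inverse_fourth_power_weight) auto
        have "((\<lambda>r. - (r powr - ?q) / ?q) has_real_derivative - (- ?q * r powr (- ?q - 1)) / ?q) (at r)"
          using r R False by (auto intro!: derivative_eq_intros)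
        also have "- (- ?q * r powr (- ?q - 1)) / ?q = r powr (- ?q - 1)"
        proof -
          have "- (- x * y) / x = y" if "x \<ge> 1" for x y :: real using that by simp
          from this[OF q] show ?thesis .
        qed
        also have "- ?q - 1 = real ?n - 5" by simp
        finally show "((\<lambda>r. - (r powr - ?q) / ?q) has_real_derivative r powr (real ?n - 5)) (at r)" .
      qed (use R in auto)
      also have "\<dots> \<le> ennreal (?S * (decay_rate ?n t)\<^sup>2)"
      proof (intro ennreal_leI mult_left_mono)
        have "- (1 powr - ?q) / ?q - - (R powr - ?q) / ?q = (R powr - ?q - 1) / ?q"
          by (simp add: diff_divide_distrib)
        also have "\<dots> \<le> R powr - ?q / ?q" using q by (intro divide_right_mono) auto
        also have "\<dots> \<le> R powr - ?q / 1" using q by (intro divide_left_mono) auto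
        also have "\<dots> = t powr (2 - real ?n / 2)" unfolding Rn by (simp add: field_simps)
        finally show "- (1 powr - ?q) / ?q - - (R powr - ?q) / ?q \<le> (decay_rate ?n t)\<^sup>2" using main_scale by simp
      qed (use S in simp)
      finally show ?thesis .
    qed
    have "(\<integral>\<^sup>+\<xi>. ennreal (low_kernel t (norm \<xi>)) \<partial>(lborel :: 'a measure))
      \<le> (\<integral>\<^sup>+\<xi>. ennreal (indicator {0..R} (norm \<xi>) * t\<^sup>2) + ennreal (indicator {R..1} (norm \<xi>) * (1 / norm \<xi> ^ 4)) \<partial>(lborel :: 'a measure))"
      by (intro nn_integral_mono) (auto simp: low_kernel_def R_def split: split_indicator)
    also have "\<dots> = (\<integral>\<^sup>+\<xi>. ennreal (indicator {0..R} (norm \<xi>) * t\<^sup>2) \<partial>(lborel :: 'a measure))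
        + (\<integral>\<^sup>+\<xi>. ennreal (indicator {R..1} (norm \<xi>) * (1 / norm \<xi> ^ 4)) \<partial>(lborel :: 'a measure))"
      by (intro nn_integral_add) measurable
    also have "\<dots> \<le> ennreal (?S * (decay_rate ?n t)\<^sup>2) + ennreal (?S * (decay_rate ?n t)\<^sup>2)"
      by (intro add_mono I1 I2)
    also have "\<dots> = ennreal ((2 * ?S) * (decay_rate ?n t)\<^sup>2)"
      using S by (subst ennreal_plus[symmetric]) (auto simp: algebra_simps)
    finally show ?thesis .
  qed
  thus ?thesis using S by (intro exI[of _ "2 * ?S"]) auto
qed

lemma exp_neg_le_power:
  fixes x :: real
  assumes "x > 0"
  shows "exp (- x) \<le> fact m / x ^ m"
proof -
  have "x ^ m / fact m \<le> exp x"
  proof -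
    have s: "(\<lambda>k. x ^ k / fact k) sums exp x"
      using exp_converges[of x] by (simp only: scaleR_conv_of_real divide_inverse mult.commute of_real_eq_id id_apply)
    have "sum (\<lambda>k. x ^ k / fact k) {m} \<le> (\<Sum>k. x ^ k / fact k)"
      by (rule sum_le_suminf[OF sums_summable[OF s]]) (use assms in auto)
    also have "\<dots> = exp x" by (rule sums_unique[OF s, symmetric])
    finally show ?thesis by simp
  qed
  moreover have "0 < x ^ m" using assms by simp
  ultimately show ?thesis by (simp add: exp_minus field_simps)
qed

text \<open>
  The amplitude \<open>r\<^bsup>-4\<^esup>\<close> of the squared oscillation together with its damping; again only for \<open>r \<le> 1\<close>.
\<close>

definition high_kernel :: "real \<Rightarrow> real \<Rightarrow> real \<Rightarrow> real" where
  "high_kernel k t r = (if r \<le> 1 then exp (- (k * r ^ 4 * t)) / r ^ 4 else 0)"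

text \<open>
  Below the scale \<open>r = t\<^bsup>-1/4\<^esup>\<close> the exponential is bounded by 1, and \<open>r\<^bsup>n-5\<^esup>\<close> is integrable at the origin.
  Above it, the inequality \<open>exp(-x) \<le> n!/x\<^sup>n\<close> gives more than enough decay in \<open>r\<close>. Both parts scale like
  \<open>t\<^bsup>1-n/4\<^esup>\<close>.
\<close>

lemma high_kernel_integral:
  assumes n: "DIM('a::euclidean_space) \<ge> 5" and k: "k > 0"
  shows "\<exists>C>0. \<forall>t>1. (\<integral>\<^sup>+\<xi>. ennreal (high_kernel k t (norm \<xi>)) \<partial>(lborel :: 'a measure))
     \<le> ennreal (C * (decay_rate DIM('a) t)\<^sup>2)"
proof -
  let ?n = "DIM('a)"
  let ?S = "sphere_area DIM('a)"
  define K where "K = fact ?n / k ^ ?n"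
  have S: "?S > 0" by (rule sphere_area_pos) simp
  have K: "K > 0" using k by (simp add: K_def)
  have "(\<integral>\<^sup>+\<xi>. ennreal (high_kernel k t (norm \<xi>)) \<partial>(lborel :: 'a measure)) \<le> ennreal ((?S * (1 + K)) * (decay_rate ?n t)\<^sup>2)"
    if t1: "t > 1" for t
  proof -
    define R where "R = t powr (- 1 / 4)"
    have R: "0 < R" "R \<le> 1"
    proof -
      show "0 < R" using t1 by (simp add: R_def)
      have "t powr (- 1 / 4) \<le> t powr 0" using t1 by (intro powr_mono) auto
      thus "R \<le> 1" using t1 by (simp add: R_def)
    qed
    have Rn: "R powr p = t powr (- p / 4)" for p by (simp add: R_def powr_powr)
    have D: "(decay_rate ?n t)\<^sup>2 = t powr (1 - real ?n / 4)" using decay_rate_squared(3)[OF t1 n] .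
    have I1: "(\<integral>\<^sup>+\<xi>. ennreal (indicator {0..R} (norm \<xi>) * (1 / norm \<xi> ^ 4)) \<partial>(lborel :: 'a measure)) \<le> ennreal (?S * (decay_rate ?n t)\<^sup>2)"
    proof -
      have "(\<integral>\<^sup>+\<xi>. ennreal (indicator {0..R} (norm \<xi>) * (1 / norm \<xi> ^ 4)) \<partial>(lborel :: 'a measure))
          \<le> ennreal (?S * (R ^ (?n - 4) / (?n - 4) - 0 ^ (?n - 4) / (?n - 4)))"
      proof (rule radial_shell_upper[where \<psi> = "\<lambda>r. r ^ (?n - 5)" and F = "\<lambda>r. r ^ (?n - 4) / (?n - 4)" and \<phi> = "\<lambda>r. 1 / r ^ 4"])
        fix r :: real assume r: "0 \<le> r" "r \<le> R"
        have "r ^ (?n - 1) = r ^ (?n - 5) * r ^ 4" using n by (simp flip: power_add)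
        thus "1 / r ^ 4 * r ^ (?n - 1) \<le> r ^ (?n - 5)" using r by (cases "r = 0") auto
        have "((\<lambda>r. r ^ (?n - 4) / (?n - 4)) has_real_derivative ((?n - 4) * r ^ (?n - 4 - 1)) / (?n - 4)) (at r)"
          by (auto intro!: derivative_eq_intros)
        thus "((\<lambda>r. r ^ (?n - 4) / (?n - 4)) has_real_derivative r ^ (?n - 5)) (at r)"
          using n by simp
      qed (use R in auto)
      also have "\<dots> \<le> ennreal (?S * (decay_rate ?n t)\<^sup>2)"
      proof (intro ennreal_leI mult_left_mono)
        have "R ^ (?n - 4) = R powr (real ?n - 4)" using R n by (simp add: powr_realpow[symmetric] of_nat_diff)
        also have "\<dots> = t powr (1 - real ?n / 4)" unfolding Rn by (simp add: field_simps)
        finally have "R ^ (?n - 4) = (decay_rate ?n t)\<^sup>2" by (simp add: D)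
        moreover have "R ^ (?n - 4) / (?n - 4) \<le> R ^ (?n - 4) / 1" using R n by (intro divide_left_mono) auto
        ultimately show "R ^ (?n - 4) / (?n - 4) - 0 ^ (?n - 4) / (?n - 4) \<le> (decay_rate ?n t)\<^sup>2"
          using n by (simp add: power_0_left)
      qed (use S in simp)
      finally show ?thesis .
    qed
    let ?q = "3 * real ?n + 4"
    have I2: "(\<integral>\<^sup>+\<xi>. ennreal (indicator {R..1} (norm \<xi>) * (exp (- (k * norm \<xi> ^ 4 * t)) / norm \<xi> ^ 4)) \<partial>(lborel :: 'a measure))
        \<le> ennreal (?S * (K * (decay_rate ?n t)\<^sup>2))"
    proof -
      have "(\<integral>\<^sup>+\<xi>. ennreal (indicator {R..1} (norm \<xi>) * (exp (- (k * norm \<xi> ^ 4 * t)) / norm \<xi> ^ 4)) \<partial>(lborel :: 'a measure))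
          \<le> ennreal (?S * (- (K * t powr (- real ?n) * 1 powr (- ?q) / ?q) - - (K * t powr (- real ?n) * R powr (- ?q) / ?q)))"
      proof (rule radial_shell_upper[where \<psi> = "\<lambda>r. K * t powr (- real ?n) * r powr (- ?q - 1)"
            and F = "\<lambda>r. - (K * t powr (- real ?n) * r powr (- ?q) / ?q)" and \<phi> = "\<lambda>r. exp (- (k * r ^ 4 * t)) / r ^ 4"])
        fix r assume r: "R \<le> r" "r \<le> 1"
        hence r0: "r > 0" using R by simp
        have "exp (- (k * r ^ 4 * t)) \<le> fact ?n / (k * r ^ 4 * t) ^ ?n"
          using r0 k t1 by (intro exp_neg_le_power) auto
        also have "\<dots> = K * t powr (- real ?n) * r powr (- 4 * real ?n)"
        proof -
          have "t powr (- real ?n) = 1 / t ^ ?n"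
            using t1 by (simp add: powr_minus_divide powr_realpow)
          moreover have "r powr (- 4 * real ?n) = 1 / (r ^ 4) ^ ?n"
          proof -
            have "r powr (- 4 * real ?n) = 1 / r powr real (4 * ?n)"
              by (simp add: powr_minus_divide)
            also have "r powr real (4 * ?n) = (r ^ 4) ^ ?n"
              using r0 by (simp only: powr_realpow power_mult)
            finally show ?thesis .
          qed
          ultimately show ?thesis by (simp add: K_def power_mult_distrib)
        qed
        finally have "exp (- (k * r ^ 4 * t)) * (1 / r ^ 4 * r ^ (?n - 1))
           \<le> K * t powr (- real ?n) * r powr (- 4 * real ?n) * (1 / r ^ 4 * r ^ (?n - 1))"
          using r0 by (intro mult_right_mono) auto
        also have "\<dots> = K * t powr (- real ?n) * r powr (- ?q - 1)"
          using r0 by (subst inverse_fourth_power_weight) (auto simp: mult.assoc powr_add[symmetric] algebra_simps)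
        finally show "exp (- (k * r ^ 4 * t)) / r ^ 4 * r ^ (?n - 1) \<le> K * t powr (- real ?n) * r powr (- ?q - 1)" by simp
        have "((\<lambda>r. - (K * t powr (- real ?n) * r powr (- ?q) / ?q)) has_real_derivative
            - (K * t powr (- real ?n) * (- ?q * r powr (- ?q - 1)) / ?q)) (at r)"
          using r0 by (auto intro!: derivative_eq_intros)
        moreover have "- (A * (- q * p) / q) = A * p" if "q > 0" for A q p :: real
          using that by simp
        ultimately show "((\<lambda>r. - (K * t powr (- real ?n) * r powr (- ?q) / ?q)) has_real_derivative K * t powr (- real ?n) * r powr (- ?q - 1)) (at r)"
          by (metis add_nonneg_pos mult_nonneg_nonneg of_nat_0_le_iff zero_le_numeral zero_less_numeral)
      qed (use R K in auto)
      also have "\<dots> \<le> ennreal (?S * (K * (decay_rate ?n t)\<^sup>2))"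
      proof (intro ennreal_leI mult_left_mono)
        have eq: "t powr (- real ?n) * R powr (- ?q) = (decay_rate ?n t)\<^sup>2"
          unfolding Rn D by (simp add: powr_add[symmetric] field_simps)
        have "- (K * t powr (- real ?n) * 1 powr (- ?q) / ?q) - - (K * t powr (- real ?n) * R powr (- ?q) / ?q)
           \<le> K * (t powr (- real ?n) * R powr (- ?q)) / ?q"
        proof -
          have "- (u * 1 / p) - - (u * v / p) \<le> u * v / p" if "u \<ge> 0" "p > 0" for u v p :: real
            using that by simp
          from this[of "K * t powr (- real ?n)" ?q] show ?thesis
            using K by (simp add: mult.assoc)
        qed
        also have "\<dots> \<le> K * (t powr (- real ?n) * R powr (- ?q)) / 1" using K by (intro divide_left_mono) auto
        finally show "- (K * t powr (- real ?n) * 1 powr (- ?q) / ?q) - - (K * t powr (- real ?n) * R powr (- ?q) / ?q)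
           \<le> K * (decay_rate ?n t)\<^sup>2" unfolding eq by simp
      qed (use S in simp)
      finally show ?thesis .
    qed
    have "(\<integral>\<^sup>+\<xi>. ennreal (high_kernel k t (norm \<xi>)) \<partial>(lborel :: 'a measure))
      \<le> (\<integral>\<^sup>+\<xi>. ennreal (indicator {0..R} (norm \<xi>) * (1 / norm \<xi> ^ 4))
          + ennreal (indicator {R..1} (norm \<xi>) * (exp (- (k * norm \<xi> ^ 4 * t)) / norm \<xi> ^ 4)) \<partial>(lborel :: 'a measure))"
    proof (rule nn_integral_mono)
      fix \<xi> :: 'a
      have "exp (- (k * norm \<xi> ^ 4 * t)) / norm \<xi> ^ 4 \<le> 1 / norm \<xi> ^ 4"
        using k t1 by (intro divide_right_mono) auto
      thus "ennreal (high_kernel k t (norm \<xi>)) \<le> ennreal (indicator {0..R} (norm \<xi>) * (1 / norm \<xi> ^ 4))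
          + ennreal (indicator {R..1} (norm \<xi>) * (exp (- (k * norm \<xi> ^ 4 * t)) / norm \<xi> ^ 4))"
        by (auto simp: high_kernel_def split: split_indicator intro: ennreal_leI order_trans[OF ennreal_leI])
    qed
    also have "\<dots> = (\<integral>\<^sup>+\<xi>. ennreal (indicator {0..R} (norm \<xi>) * (1 / norm \<xi> ^ 4)) \<partial>(lborel :: 'a measure))
        + (\<integral>\<^sup>+\<xi>. ennreal (indicator {R..1} (norm \<xi>) * (exp (- (k * norm \<xi> ^ 4 * t)) / norm \<xi> ^ 4)) \<partial>(lborel :: 'a measure))"
      by (intro nn_integral_add) measurable
    also have "\<dots> \<le> ennreal (?S * (decay_rate ?n t)\<^sup>2) + ennreal (?S * (K * (decay_rate ?n t)\<^sup>2))"
      by (intro add_mono I1 I2)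
    also have "\<dots> = ennreal ((?S * (1 + K)) * (decay_rate ?n t)\<^sup>2)"
      using S K by (subst ennreal_plus[symmetric]) (auto simp: algebra_simps)
    finally show ?thesis .
  qed
  thus ?thesis using S K by (intro exI[of _ "?S * (1 + K)"]) auto
qed

section \<open>Frequency windows carrying the lower bound\<close>

lemma shell_weight:
  assumes "0 < (r::real)" "0 < n"
  shows "1 / r ^ 4 * r ^ (n - 1) = r powr (real n - 4) / r"
proof -
  have "r powr (real n - 5) = r powr (real n - 4) / r powr 1"
    by (subst powr_diff[symmetric]) simp
  thus ?thesis using assms by (simp only: inverse_fourth_power_weight) simp
qed

lemma inverse_fourth_shell:
  assumes ab: "0 < a" "a \<le> b"
    and M: "\<And>r. a \<le> r \<Longrightarrow> r \<le> b \<Longrightarrow> r powr (real DIM('a) - 4) \<le> M"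
  shows "(\<integral>\<^sup>+\<xi>. ennreal (indicator {a..b} (norm \<xi>) * (1 / norm \<xi> ^ 4)) \<partial>(lborel :: 'a::euclidean_space measure))
    \<le> ennreal (sphere_area DIM('a) * (M * ln (b / a)))"
proof -
  have M0: "M \<ge> 0" using M[of a] ab by (metis order_refl order_trans powr_ge_zero)
  have "(\<integral>\<^sup>+\<xi>. ennreal (indicator {a..b} (norm \<xi>) * (1 / norm \<xi> ^ 4)) \<partial>(lborel :: 'a measure))
    \<le> ennreal (sphere_area DIM('a) * (M * ln b - M * ln a))"
  proof (rule radial_shell_upper[where \<phi> = "\<lambda>r. 1 / r ^ 4" and \<psi> = "\<lambda>r. M * (1 / r)" and F = "\<lambda>r. M * ln r"])
    fix r assume r: "a \<le> r" "r \<le> b"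
    have r0: "r > 0" using r ab by simp
    show "1 / r ^ 4 * r ^ (DIM('a) - 1) \<le> M * (1 / r)"
      using M[OF r] r0 by (subst shell_weight) (auto intro: divide_right_mono)
    show "((\<lambda>r. M * ln r) has_real_derivative M * (1 / r)) (at r)"
      using r0 by (intro DERIV_cmult DERIV_ln_divide) auto
    show "0 \<le> M * (1 / r)" using M0 r0 by simp
  qed (use ab in auto)
  thus ?thesis using ab by (simp add: ln_div algebra_simps)
qed

text \<open>
  Since \<open>sin\<^sup>2 x = (1 - cos 2x)/2\<close>, the integral of \<open>sin\<^sup>2(r\<^sup>2t)/r\<close> is \<open>ln(b/a)/2\<close> up to an oscillating
  term, which one partial integration bounds by a multiple of \<open>1/(ta\<^sup>2)\<close>. The lower bound \<open>m\<close> for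
  \<open>r\<^bsup>n-4\<^esup>\<close> reduces every dimension to this logarithmic integral.
\<close>

lemma sine_square_shell:
  assumes ab: "0 < a" "a \<le> b" and t: "t > 0" and m0: "0 \<le> m"
    and m: "\<And>r. a \<le> r \<Longrightarrow> r \<le> b \<Longrightarrow> m \<le> r powr (real DIM('a) - 4)"
  shows "ennreal (sphere_area DIM('a) * (m * (ln (b / a) / 2 - 1 / (4 * (t * a\<^sup>2)))))
    \<le> (\<integral>\<^sup>+\<xi>. ennreal (indicator {a..b} (norm \<xi>) * ((sin ((norm \<xi>)\<^sup>2 * t))\<^sup>2 / norm \<xi> ^ 4)) \<partial>(lborel :: 'a::euclidean_space measure))"
proof -
  \<comment> \<open>the term \<open>1/(8tr\<^sup>2)\<close> gives the remainder of the partial integration a sign\<close>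
  define F where "F r = m * (ln r / 2 - sin (2 * (r\<^sup>2 * t)) / (8 * t * r\<^sup>2) + 1 / (8 * t * r\<^sup>2))" for r
  define \<psi> where "\<psi> r = m * ((sin (r\<^sup>2 * t))\<^sup>2 / r + (sin (2 * (r\<^sup>2 * t)) - 1) / (4 * t * r ^ 3))" for r
  have S: "0 < sphere_area DIM('a)" by (rule sphere_area_pos) simp
  have "ennreal (sphere_area DIM('a) * (F b - F a))
    \<le> (\<integral>\<^sup>+\<xi>. ennreal (indicator {a..b} (norm \<xi>) * ((sin ((norm \<xi>)\<^sup>2 * t))\<^sup>2 / norm \<xi> ^ 4)) \<partial>(lborel :: 'a measure))"
  proof (rule radial_shell_lower[where \<phi> = "\<lambda>r. (sin (r\<^sup>2 * t))\<^sup>2 / r ^ 4" and \<psi> = \<psi> and F = F])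
    show "continuous_on {a..b} (\<lambda>r. (sin (r\<^sup>2 * t))\<^sup>2 / r ^ 4)"
      using ab by (intro continuous_intros) auto
    fix r assume r: "a \<le> r" "r \<le> b"
    have r0: "r > 0" using r ab by simp
    have "(sin (2 * (r\<^sup>2 * t)) - 1) / (4 * t * r ^ 3) \<le> 0"
      using r0 t by (intro divide_nonpos_pos) auto
    hence "\<psi> r \<le> m * ((sin (r\<^sup>2 * t))\<^sup>2 / r)" unfolding \<psi>_def using m0 by (intro mult_left_mono) auto
    also have "\<dots> \<le> r powr (real DIM('a) - 4) * ((sin (r\<^sup>2 * t))\<^sup>2 / r)"
      using m[OF r] r0 by (intro mult_right_mono) auto
    also have "\<dots> = (sin (r\<^sup>2 * t))\<^sup>2 * (1 / r ^ 4 * r ^ (DIM('a) - 1))"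
      using r0 by (subst shell_weight) auto
    finally show "\<psi> r \<le> (sin (r\<^sup>2 * t))\<^sup>2 / r ^ 4 * r ^ (DIM('a) - 1)" by simp
    have "(F has_real_derivative m * (1 / r / 2
        - (cos (2 * (r\<^sup>2 * t)) * (4 * r * t) * (8 * t * r\<^sup>2) - sin (2 * (r\<^sup>2 * t)) * (16 * t * r)) / (8 * t * r\<^sup>2)\<^sup>2
        - 16 * t * r / (8 * t * r\<^sup>2)\<^sup>2)) (at r)"
      unfolding F_def using r0 t
      by (auto intro!: derivative_eq_intros simp: power2_eq_square mult_ac)
    also have "m * (1 / r / 2
        - (cos (2 * (r\<^sup>2 * t)) * (4 * r * t) * (8 * t * r\<^sup>2) - sin (2 * (r\<^sup>2 * t)) * (16 * t * r)) / (8 * t * r\<^sup>2)\<^sup>2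
        - 16 * t * r / (8 * t * r\<^sup>2)\<^sup>2) = \<psi> r"
    proof -
      have "cos (2 * (r\<^sup>2 * t)) = 1 - 2 * (sin (r\<^sup>2 * t))\<^sup>2" by (rule cos_double_sin)
      moreover have "m * (1 / r / 2 - ((1 - 2 * u) * (4 * r * t) * (8 * t * r\<^sup>2) - v * (16 * t * r)) / (8 * t * r\<^sup>2)\<^sup>2
          - 16 * t * r / (8 * t * r\<^sup>2)\<^sup>2) = m * (u / r + (v - 1) / (4 * t * r ^ 3))" for u v :: real
        using r0 t by (simp add: field_simps power2_eq_square power3_eq_cube)
      ultimately show ?thesis unfolding \<psi>_def by (simp only:)
    qed
    finally show "(F has_real_derivative \<psi> r) (at r)" .
  qed (use ab in auto)
  moreover have "m * (ln (b / a) / 2 - 1 / (4 * (t * a\<^sup>2))) \<le> F b - F a"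
  proof -
    have "0 \<le> (1 - sin (2 * (b\<^sup>2 * t))) / (8 * t * b\<^sup>2)" using t by (intro divide_nonneg_nonneg) auto
    hence B: "m * (ln b / 2) \<le> F b" unfolding F_def using m0 by (intro mult_left_mono) (auto simp: diff_divide_distrib)
    have "(1 - sin (2 * (a\<^sup>2 * t))) / (8 * t * a\<^sup>2) \<le> 2 / (8 * t * a\<^sup>2)"
      using t sin_ge_minus_one[of "2 * (a\<^sup>2 * t)"] by (intro divide_right_mono) auto
    hence "F a \<le> m * (ln a / 2 + 1 / (4 * (t * a\<^sup>2)))"
      unfolding F_def using m0 by (intro mult_left_mono) (auto simp: diff_divide_distrib)
    with B have "m * (ln b / 2) - m * (ln a / 2 + 1 / (4 * (t * a\<^sup>2))) \<le> F b - F a" by linarith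
    thus ?thesis using ab by (simp add: ln_div algebra_simps diff_divide_distrib)
  qed
  ultimately show ?thesis using S by (meson ennreal_leI less_imp_le mult_left_mono order_trans)
qed

lemma ln_4_ge_1: "1 \<le> ln (4::real)"
proof -
  have "exp 1 \<le> (4::real)" using exp_le by linarith
  thus ?thesis by (simp add: ln_ge_iff)
qed

text \<open>
  For \<open>n \<le> 3\<close> the window is the shell between \<open>t\<^bsup>-1/2\<^esup>\<close> and four times this radius.
\<close>

lemma frequency_window_low_dimension:
  assumes \<sigma>: "\<sigma> > 0" and n: "n \<le> 3"
  defines "R \<equiv> \<lambda>t::real. t powr (- 1 / 2)"
  shows "((\<lambda>t. 4 * R t) \<longlongrightarrow> 0) at_top"
    and "((\<lambda>t. (4 * R t) ^ n / (decay_rate n t)\<^sup>2) \<longlongrightarrow> 0) at_top"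
    and "\<forall>\<^sub>F t in at_top. 2048 * ((4 * R t) ^ 4 * t / \<sigma>)\<^sup>2 * R t powr (real n - 4) \<le> (4 * R t) powr (real n - 4)"
    and "t > 1 \<Longrightarrow> 4 powr (real n - 4) * (decay_rate n t)\<^sup>2 \<le> (4 * R t) powr (real n - 4) * ln (4 * R t / R t)"
    and "t > 1 \<Longrightarrow> t * (R t)\<^sup>2 = 1"
proof -
  have Rp: "R t powr p = t powr (- p / 2)" for t p by (simp add: R_def powr_powr)
  have R0: "R t > 0" if "t > 1" for t using that by (simp add: R_def)
  show "((\<lambda>t. 4 * R t) \<longlongrightarrow> 0) at_top" unfolding R_def by real_asymp
  have "(4 * R t) ^ n / (decay_rate n t)\<^sup>2 = 4 ^ n * t powr (-2)" if t: "t > 1" for t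
  proof -
    have "R t ^ n = t powr (- real n / 2)" using Rp[of t "real n"] R0[OF t] by (simp add: powr_realpow)
    moreover have "t powr (- real n / 2) / t powr (2 - real n / 2) = t powr (-2)"
      by (simp add: powr_diff[symmetric])
    ultimately show ?thesis unfolding decay_rate_squared(1)[OF t n]
      by (simp only: power_mult_distrib times_divide_eq_right[symmetric])
  qed
  hence "\<forall>\<^sub>F t in at_top. 4 ^ n * t powr (-2) = (4 * R t) ^ n / (decay_rate n t)\<^sup>2"
    by (intro eventually_mono[OF eventually_gt_at_top[of 1]]) auto
  moreover have "((\<lambda>t::real. 4 ^ n * t powr (-2)) \<longlongrightarrow> 4 ^ n * 0) at_top"
    by (intro tendsto_mult tendsto_const) real_asymp
  ultimately show "((\<lambda>t. (4 * R t) ^ n / (decay_rate n t)\<^sup>2) \<longlongrightarrow> 0) at_top"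
    by (simp add: tendsto_cong)
  show "4 powr (real n - 4) * (decay_rate n t)\<^sup>2 \<le> (4 * R t) powr (real n - 4) * ln (4 * R t / R t)" if t: "t > 1"
  proof -
    have "(4 * R t) powr (real n - 4) = 4 powr (real n - 4) * t powr (2 - real n / 2)"
      using R0[OF t] by (simp add: powr_mult Rp) (simp add: field_simps)
    hence "4 powr (real n - 4) * (decay_rate n t)\<^sup>2 * 1 \<le> (4 * R t) powr (real n - 4) * ln (4 * R t / R t)"
      using R0[OF t] ln_4_ge_1 unfolding decay_rate_squared(1)[OF t n] by (intro mult_mono) auto
    thus ?thesis by simp
  qed
  show tR: "t * (R t)\<^sup>2 = 1" if t: "t > 1" for t
  proof -
    have "(R t)\<^sup>2 = R t powr 2" using R0[OF t] by (simp add: powr_numeral)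
    also have "\<dots> = 1 / t" unfolding Rp using t by (simp add: powr_minus_divide)
    finally show ?thesis using t by simp
  qed
  have small: "2048 * ((4 * R t) ^ 4 * t / \<sigma>)\<^sup>2 * R t powr (real n - 4) \<le> (4 * R t) powr (real n - 4)"
    if t: "t > 1" "t \<ge> 2 ^ 18 / \<sigma>" for t
  proof -
    have "(4 * R t) ^ 4 * t = 256 * ((t * (R t)\<^sup>2) * (t * (R t)\<^sup>2) / t)"
      using t by (simp add: power2_eq_square power4_eq_xxxx)
    hence eq: "(4 * R t) ^ 4 * t / \<sigma> = 256 / (t * \<sigma>)" unfolding tR[OF t(1)] by simp
    have "2 ^ 18 \<le> t * \<sigma>" using t(2) \<sigma> by (simp add: pos_divide_le_eq)
    hence "256 / (t * \<sigma>) \<le> 256 / 2 ^ 18" using \<sigma> t by (intro divide_left_mono) auto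
    hence "(256 / (t * \<sigma>))\<^sup>2 \<le> (256 / 2 ^ 18)\<^sup>2" using \<sigma> t by (intro power_mono) auto
    hence "2048 * (256 / (t * \<sigma>))\<^sup>2 \<le> 1 / 256" by (simp add: power2_eq_square)
    also have "1 / 256 = (4::real) powr (- 4)" by (simp add: powr_minus_divide powr_numeral)
    also have "\<dots> \<le> 4 powr (real n - 4)" by (intro powr_mono) auto
    finally have "2048 * (256 / (t * \<sigma>))\<^sup>2 * R t powr (real n - 4) \<le> 4 powr (real n - 4) * R t powr (real n - 4)"
      by (intro mult_right_mono) auto
    thus ?thesis unfolding eq using R0[OF t(1)] by (simp add: powr_mult)
  qed
  show "\<forall>\<^sub>F t in at_top. 2048 * ((4 * R t) ^ 4 * t / \<sigma>)\<^sup>2 * R t powr (real n - 4) \<le> (4 * R t) powr (real n - 4)"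
    using eventually_gt_at_top[of 1] eventually_ge_at_top[of "2 ^ 18 / \<sigma>"]
    by eventually_elim (rule small)
qed

text \<open>
  Here \<open>[R1, R2]\<close> is a range of \<open>r\<close> on which the solution is bounded below at time \<open>t\<close>, and \<open>m\<close>, \<open>M\<close>
  bound \<open>r\<^bsup>n-4\<^esup>\<close> on it. The conditions \<open>4 R1 \<le> R2\<close> and \<open>1 \<le> t R1\<^sup>2\<close> give the phase \<open>r\<^sup>2t\<close> room to
  oscillate, so that the error in \<open>sine_square_shell\<close> is at most half of the main term. The bound with the
  constant 2048 makes the relative error \<open>R2\<^sup>4t/\<sigma>\<close> of \<open>frequency_profile\<close> small enough, even after
  comparison of \<open>M\<close> with \<open>m\<close>. The last condition says that the main term has at least the size of the
  squared rate.
\<close>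

definition frequency_window ::
  "real \<Rightarrow> nat \<Rightarrow> real \<Rightarrow> real \<Rightarrow> real \<Rightarrow> real \<Rightarrow> real \<Rightarrow> real \<Rightarrow> bool"
where
  "frequency_window \<sigma> n \<kappa> t R1 R2 m M \<longleftrightarrow>
     0 < R1 \<and> 4 * R1 \<le> R2 \<and> 1 \<le> t * R1\<^sup>2 \<and> 0 < m \<and>
     (\<forall>r. R1 \<le> r \<longrightarrow> r \<le> R2 \<longrightarrow> m \<le> r powr (real n - 4) \<and> r powr (real n - 4) \<le> M) \<and>
     2048 * (R2 ^ 4 * t / \<sigma>)\<^sup>2 * M \<le> m \<and> \<kappa> * (decay_rate n t)\<^sup>2 \<le> m * ln (R2 / R1)"

text \<open>
  The windows are \<open>[t\<^bsup>-1/2\<^esup>, 4t\<^bsup>-1/2\<^esup>]\<close> for \<open>n \<le> 3\<close>, \<open>[t\<^bsup>-1/2\<^esup>, \<delta>t\<^bsup>-1/4\<^esup>]\<close> for \<open>n = 4\<close> and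
  \<open>[\<delta>t\<^bsup>-1/4\<^esup>, 4\<delta>t\<^bsup>-1/4\<^esup>]\<close> for \<open>n \<ge> 5\<close>, with a small constant \<open>\<delta>\<close>. They shrink to the origin, where the
  transform of \<open>u\<^sub>1\<close> is close to its value at zero, and their volume becomes negligible against the squared
  rate.
\<close>

lemma frequency_window_exists:
  fixes n :: nat
  assumes \<sigma>: "\<sigma> > 0"
  shows "\<exists>\<kappa>>0. \<exists>R1 R2 m M :: real \<Rightarrow> real.
    (R2 \<longlongrightarrow> 0) at_top \<and> ((\<lambda>t. R2 t ^ n / (decay_rate n t)\<^sup>2) \<longlongrightarrow> 0) at_top \<and>
    (\<forall>\<^sub>F t in at_top. frequency_window \<sigma> n \<kappa> t (R1 t) (R2 t) (m t) (M t))"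
proof -
  have I: ?thesis if "\<kappa> > 0" "(R2 \<longlongrightarrow> 0) at_top" "((\<lambda>t. R2 t ^ n / (decay_rate n t)\<^sup>2) \<longlongrightarrow> 0) at_top"
    "\<forall>\<^sub>F t in at_top. frequency_window \<sigma> n \<kappa> t (R1 t) (R2 t) (m t) (M t)"
    for \<kappa> and R1 R2 m M :: "real \<Rightarrow> real"
    using that by blast
  consider "n \<le> 3" | "n = 4" | "n \<ge> 5" by linarith
  thus ?thesis
  proof cases
    case 1
    define R where "R t = t powr (- 1 / 2)" for t :: real
    note W = frequency_window_low_dimension[OF \<sigma> 1, folded R_def]
    show ?thesis
    proof (rule I[where \<kappa> = "4 powr (real n - 4)" and ?R1.0 = R and ?R2.0 = "\<lambda>t. 4 * R t"
        and m = "\<lambda>t. (4 * R t) powr (real n - 4)" and M = "\<lambda>t. R t powr (real n - 4)"])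
      show "\<forall>\<^sub>F t in at_top. frequency_window \<sigma> n (4 powr (real n - 4)) t (R t) (4 * R t)
          ((4 * R t) powr (real n - 4)) (R t powr (real n - 4))"
        using W(3) eventually_gt_at_top[of 1]
      proof eventually_elim
        case (elim t)
        have R0: "R t > 0" using elim by (simp add: R_def)
        moreover have "(4 * R t) powr (real n - 4) \<le> r powr (real n - 4)" "r powr (real n - 4) \<le> R t powr (real n - 4)"
          if "R t \<le> r" "r \<le> 4 * R t" for r
          using that R0 1 by (auto intro!: powr_mono2')
        ultimately show ?case unfolding frequency_window_def using elim W(4,5)[of t] by auto
      qed
    qed (use W in auto)
  next
    case 2
    \<comment> \<open>then \<open>R2\<^sup>4t/\<sigma> = \<delta>\<^sup>4/\<sigma> = 1/64\<close>\<close>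
    define \<delta> where "\<delta> = (\<sigma> / 64) powr (1 / 4)"
    define R1 where "R1 t = t powr (- 1 / 2)" for t :: real
    define R2 where "R2 t = \<delta> * t powr (- 1 / 4)" for t :: real
    have \<delta>: "\<delta> > 0" using \<sigma> by (simp add: \<delta>_def)
    have \<delta>4: "\<delta> ^ 4 = \<sigma> / 64"
    proof -
      have "\<delta> ^ 4 = \<delta> powr real 4" using \<delta> by (subst powr_realpow) auto
      also have "\<dots> = \<sigma> / 64" using \<sigma> by (simp add: \<delta>_def powr_powr)
      finally show ?thesis .
    qed
    have R24: "R2 t ^ 4 = \<delta> ^ 4 / t" if "t > 1" for t
    proof -
      have "(t powr (- 1 / 4)) ^ 4 = (t powr (- 1 / 4)) powr real 4"
        using that by (intro powr_realpow[symmetric]) auto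
      also have "\<dots> = 1 / t"
        unfolding powr_powr using that by (simp add: powr_minus_divide)
      finally show ?thesis by (simp add: R2_def power_mult_distrib)
    qed
    show ?thesis
    proof (rule I[where \<kappa> = "1 / 8" and ?R1.0 = R1 and ?R2.0 = R2 and m = "\<lambda>_. 1" and M = "\<lambda>_. 1"])
      have "((\<lambda>t. \<delta> * t powr (- 1 / 4)) \<longlongrightarrow> \<delta> * 0) at_top" by (intro tendsto_mult tendsto_const) real_asymp
      thus "(R2 \<longlongrightarrow> 0) at_top" by (simp add: R2_def[abs_def])
      have "\<forall>\<^sub>F t in at_top. \<delta> ^ 4 * (1 / (t * ln t)) = R2 t ^ n / (decay_rate n t)\<^sup>2"
        using eventually_gt_at_top[of 1]
        by eventually_elim (simp add: 2 R24 decay_rate_squared)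
      moreover have "((\<lambda>t::real. \<delta> ^ 4 * (1 / (t * ln t))) \<longlongrightarrow> \<delta> ^ 4 * 0) at_top"
        by (intro tendsto_mult tendsto_const) real_asymp
      ultimately show "((\<lambda>t. R2 t ^ n / (decay_rate n t)\<^sup>2) \<longlongrightarrow> 0) at_top" by (simp add: tendsto_cong)
      have lim1: "filterlim (\<lambda>t::real. t powr (1 / 4)) at_top at_top" by real_asymp
      have lim2: "filterlim (\<lambda>t::real. ln t) at_top at_top" by real_asymp
      show "\<forall>\<^sub>F t in at_top. frequency_window \<sigma> n (1 / 8) t (R1 t) (R2 t) 1 1"
        using eventually_gt_at_top[of 1] filterlim_at_top[THEN iffD1, OF lim1, rule_format, of "4 / \<delta>"]
          filterlim_at_top[THEN iffD1, OF lim2, rule_format, of "- 8 * ln \<delta>"]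
      proof eventually_elim
        case (elim t)
        have t0: "t > 0" using elim by simp
        have R1: "R1 t > 0" using elim by (simp add: R1_def)
        have R21: "R2 t / R1 t = \<delta> * t powr (1 / 4)"
        proof -
          have "R2 t / R1 t = \<delta> * (t powr (- 1 / 4) / t powr (- 1 / 2))" by (simp add: R1_def R2_def)
          also have "t powr (- 1 / 4) / t powr (- 1 / 2) = t powr (1 / 4)" by (subst powr_diff[symmetric]) simp
          finally show ?thesis .
        qed
        have "4 \<le> \<delta> * t powr (1 / 4)" using elim(2) \<delta> by (simp add: pos_divide_le_eq mult.commute)
        hence a: "4 * R1 t \<le> R2 t" using R1 by (simp add: R21[symmetric] pos_le_divide_eq)
        have b: "t * (R1 t)\<^sup>2 = 1"
          using frequency_window_low_dimension(5)[OF \<sigma>, of 0 t] elim by (simp add: R1_def)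
        have c: "2048 * (R2 t ^ 4 * t / \<sigma>)\<^sup>2 \<le> 1"
          using t0 elim \<sigma> by (simp add: R24 \<delta>4 power2_eq_square)
        have "ln (R2 t / R1 t) = ln \<delta> + ln t / 4" unfolding R21 using \<delta> t0 by (simp add: ln_mult ln_powr)
        hence "1 / 8 * (decay_rate n t)\<^sup>2 \<le> ln (R2 t / R1 t)"
          using elim by (simp add: 2 decay_rate_squared)
        moreover have "r powr (real n - 4) = 1" if "R1 t \<le> r" for r using that R1 2 by simp
        ultimately show ?case unfolding frequency_window_def using a b c R1 by auto
      qed
    qed simp
  next
    case 3
    \<comment> \<open>the value of \<open>R2\<^sup>4t/\<sigma>\<close>; the power of 4 compensates for \<open>M t/m t = 4\<^bsup>n-4\<^esup>\<close>\<close>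
    define \<eta> where "\<eta> = 1 / (64 * 4 ^ n :: real)"
    define \<delta> where "\<delta> = (\<eta> * \<sigma> / 256) powr (1 / 4)"
    define R where "R t = \<delta> * t powr (- 1 / 4)" for t :: real
    have \<eta>: "\<eta> > 0" by (simp add: \<eta>_def)
    have \<delta>: "\<delta> > 0" using \<sigma> \<eta> by (simp add: \<delta>_def)
    have \<delta>4: "\<delta> ^ 4 = \<eta> * \<sigma> / 256"
    proof -
      have "\<delta> ^ 4 = \<delta> powr real 4" using \<delta> by (subst powr_realpow) auto
      also have "\<dots> = \<eta> * \<sigma> / 256" using \<sigma> \<eta> by (simp add: \<delta>_def powr_powr)
      finally show ?thesis .
    qed
    have R0: "R t > 0" if "t > 1" for t using that \<delta> by (simp add: R_def)
    have Rp: "R t powr p = \<delta> powr p * t powr (- p / 4)" if "t > 1" for t p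
      using that \<delta> by (simp add: R_def powr_mult powr_powr)
    have R4: "R t ^ 4 = \<delta> ^ 4 / t" if "t > 1" for t
    proof -
      have "(t powr (- 1 / 4)) ^ 4 = (t powr (- 1 / 4)) powr real 4"
        using that by (intro powr_realpow[symmetric]) auto
      also have "\<dots> = 1 / t"
        unfolding powr_powr using that by (simp add: powr_minus_divide)
      finally show ?thesis by (simp add: R_def power_mult_distrib)
    qed
    show ?thesis
    proof (rule I[where \<kappa> = "\<delta> powr (real n - 4)" and ?R1.0 = R and ?R2.0 = "\<lambda>t. 4 * R t"
        and m = "\<lambda>t. R t powr (real n - 4)" and M = "\<lambda>t. (4 * R t) powr (real n - 4)"])
      have "((\<lambda>t. 4 * \<delta> * t powr (- 1 / 4)) \<longlongrightarrow> 4 * \<delta> * 0) at_top" by (intro tendsto_mult tendsto_const) real_asymp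
      thus "((\<lambda>t. 4 * R t) \<longlongrightarrow> 0) at_top" by (simp add: R_def[abs_def] mult.assoc)
      have "(4 * \<delta>) ^ n * t powr (-1) = (4 * R t) ^ n / (decay_rate n t)\<^sup>2" if t: "t > 1" for t
      proof -
        have "R t ^ n = \<delta> ^ n * t powr (- real n / 4)"
          using Rp[OF t, of "real n"] R0[OF t] \<delta> by (simp add: powr_realpow)
        moreover have "t powr (- real n / 4) / t powr (1 - real n / 4) = t powr (-1)"
          by (simp add: powr_diff[symmetric])
        ultimately show ?thesis unfolding decay_rate_squared(3)[OF t 3]
          by (simp only: power_mult_distrib mult.assoc times_divide_eq_right[symmetric])
      qed
      hence "\<forall>\<^sub>F t in at_top. (4 * \<delta>) ^ n * t powr (-1) = (4 * R t) ^ n / (decay_rate n t)\<^sup>2"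
        by (intro eventually_mono[OF eventually_gt_at_top[of 1]]) auto
      moreover have "((\<lambda>t::real. (4 * \<delta>) ^ n * t powr (-1)) \<longlongrightarrow> (4 * \<delta>) ^ n * 0) at_top"
        by (intro tendsto_mult tendsto_const) real_asymp
      ultimately show "((\<lambda>t. (4 * R t) ^ n / (decay_rate n t)\<^sup>2) \<longlongrightarrow> 0) at_top" by (simp add: tendsto_cong)
      have lim: "filterlim (\<lambda>t::real. t powr (1 / 2)) at_top at_top" by real_asymp
      show "\<forall>\<^sub>F t in at_top. frequency_window \<sigma> n (\<delta> powr (real n - 4)) t (R t) (4 * R t)
          (R t powr (real n - 4)) ((4 * R t) powr (real n - 4))"
        using eventually_gt_at_top[of 1] filterlim_at_top[THEN iffD1, OF lim, rule_format, of "1 / \<delta>\<^sup>2"]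
      proof eventually_elim
        case (elim t)
        note t = elim(1)
        have "t * (R t)\<^sup>2 = \<delta>\<^sup>2 * t powr (1 / 2)"
        proof -
          have "(R t)\<^sup>2 = R t powr 2" using R0[OF t] by (simp add: powr_numeral)
          also have "\<dots> = \<delta>\<^sup>2 * t powr (- 1 / 2)" using \<delta> by (simp add: Rp[OF t] powr_numeral)
          finally have "t * (R t)\<^sup>2 = \<delta>\<^sup>2 * (t powr 1 * t powr (- 1 / 2))" using t by simp
          also have "t powr 1 * t powr (- 1 / 2) = t powr (1 / 2)" by (subst powr_add[symmetric]) simp
          finally show ?thesis .
        qed
        hence a: "1 \<le> t * (R t)\<^sup>2" using elim(2) \<delta> by (simp add: pos_divide_le_eq mult.commute)
        have b: "R t powr (real n - 4) \<le> r powr (real n - 4)" "r powr (real n - 4) \<le> (4 * R t) powr (real n - 4)"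
          if "R t \<le> r" "r \<le> 4 * R t" for r
          using that R0[OF t] 3 by (auto intro!: powr_mono2)
        have "(4 * R t) ^ 4 * t / \<sigma> = \<eta>" using t \<sigma> by (simp add: power_mult_distrib R4 \<delta>4)
        moreover have "2048 * \<eta>\<^sup>2 * 4 powr (real n - 4) \<le> 1"
        proof -
          have "4 powr (real n - 4) \<le> 4 powr real n" by (intro powr_mono) auto
          also have "\<dots> = 4 ^ n" by (simp add: powr_realpow)
          finally have "2048 * \<eta>\<^sup>2 * 4 powr (real n - 4) \<le> 2048 * \<eta>\<^sup>2 * 4 ^ n" by (intro mult_left_mono) auto
          also have "\<dots> = 1 / (2 * 4 ^ n)" by (simp add: \<eta>_def power2_eq_square)
          also have "\<dots> \<le> 1"
          proof -
            have "1 \<le> 2 * (4::real) ^ n" using one_le_power[of "4::real" n] by linarith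
            thus ?thesis by (simp only: divide_le_eq) simp
          qed
          finally show ?thesis .
        qed
        ultimately have "2048 * ((4 * R t) ^ 4 * t / \<sigma>)\<^sup>2 * 4 powr (real n - 4) * R t powr (real n - 4) \<le> 1 * R t powr (real n - 4)"
          by (intro mult_right_mono) auto
        hence c: "2048 * ((4 * R t) ^ 4 * t / \<sigma>)\<^sup>2 * (4 * R t) powr (real n - 4) \<le> R t powr (real n - 4)"
          using R0[OF t] by (simp add: powr_mult mult.assoc)
        have "R t powr (real n - 4) = \<delta> powr (real n - 4) * t powr (1 - real n / 4)"
          unfolding Rp[OF t] by (simp add: field_simps)
        hence "\<delta> powr (real n - 4) * (decay_rate n t)\<^sup>2 * 1 \<le> R t powr (real n - 4) * ln (4 * R t / R t)"
          using R0[OF t] ln_4_ge_1 unfolding decay_rate_squared(3)[OF t 3] by (intro mult_mono) auto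
        thus ?case unfolding frequency_window_def using a b c R0[OF t] by auto
      qed
    qed (use \<delta> in auto)
  qed
qed

section \<open>Pointwise bounds in frequency space\<close>

text \<open>
  Up to \<open>r = t\<^bsup>-1/2\<^esup>\<close> this is \<open>frequency_growth\<close>, above it the energy bound without its decay.
\<close>

lemma frequency_upper_low:
  assumes \<sigma>: "\<sigma> > 0" and t: "t \<ge> 1" and r: "r > 0" and sol: "frequency_ode_solution \<sigma> r a b c U \<Theta>"
    and N: "norm b \<le> N" "norm c \<le> N"
  shows "(norm (U t))\<^sup>2 \<le> 8 * ((norm a)\<^sup>2 + (norm b)\<^sup>2 + (norm c)\<^sup>2) + 12 * N\<^sup>2 * low_kernel t r"
proof -
  let ?a = "(norm a)\<^sup>2" and ?b = "(norm b)\<^sup>2" and ?c = "(norm c)\<^sup>2"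
  have N2: "?b \<le> N\<^sup>2" "?c \<le> N\<^sup>2" using N by (auto intro!: power_mono)
  consider "r \<le> t powr (- 1 / 2)" | "t powr (- 1 / 2) < r" "r \<le> 1" | "t powr (- 1 / 2) < r" "1 < r" by linarith
  thus ?thesis
  proof cases
    case 1
    have "t * r\<^sup>2 \<le> 1"
    proof -
      have "r\<^sup>2 \<le> (t powr (- 1 / 2))\<^sup>2" using 1 r by (intro power_mono) auto
      also have "\<dots> = t powr (-1)" using t by (simp only: power2_eq_square powr_add[symmetric]) simp
      also have "\<dots> = 1 / t" using t by (simp add: powr_minus_divide)
      finally show ?thesis using t by (simp add: field_simps)
    qed
    hence "(t * r\<^sup>2)\<^sup>2 \<le> 1\<^sup>2" using t r by (intro power_mono) auto
    hence tr: "t\<^sup>2 * r ^ 4 \<le> 1" by (simp add: power_mult_distrib)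
    have "(norm (U t))\<^sup>2 \<le> (norm a + t * sqrt (3 * (?b + r^4 * ?a + ?c)))\<^sup>2"
      using frequency_growth[OF \<sigma> _ sol, of t] t by (intro power_mono) auto
    also have "\<dots> \<le> 2 * ?a + 2 * (t * sqrt (3 * (?b + r^4 * ?a + ?c)))\<^sup>2"
    proof -
      have "(x + y)\<^sup>2 \<le> 2 * x\<^sup>2 + 2 * y\<^sup>2" for x y :: real
        using sum_squares_bound[of x y] by (simp add: power2_eq_square algebra_simps)
      thus ?thesis .
    qed
    also have "(t * sqrt (3 * (?b + r^4 * ?a + ?c)))\<^sup>2 = 3 * (t\<^sup>2 * ?b) + 3 * ((t\<^sup>2 * r^4) * ?a) + 3 * (t\<^sup>2 * ?c)"
      by (simp add: power_mult_distrib algebra_simps)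
    also have "\<dots> \<le> 3 * (t\<^sup>2 * N\<^sup>2) + 3 * (1 * ?a) + 3 * (t\<^sup>2 * N\<^sup>2)"
      using N2 tr by (intro add_mono mult_left_mono mult_right_mono) auto
    finally have "(norm (U t))\<^sup>2 \<le> 2 * ?a + 2 * (3 * (t\<^sup>2 * N\<^sup>2) + 3 * (1 * ?a) + 3 * (t\<^sup>2 * N\<^sup>2))" by simp
    moreover have "low_kernel t r = t\<^sup>2" using 1 by (simp add: low_kernel_def)
    ultimately have "(norm (U t))\<^sup>2 \<le> 8 * ?a + 12 * N\<^sup>2 * low_kernel t r" by (simp add: algebra_simps)
    also have "\<dots> \<le> 8 * (?a + ?b + ?c) + 12 * N\<^sup>2 * low_kernel t r" by simp
    finally show ?thesis .
  next
    case 2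
    have "r ^ 4 * (norm (U t))\<^sup>2 \<le> 3 * (?b + r^4 * ?a + ?c) * exp (- (r^4 / (64 * (r\<^sup>2 + \<sigma>))) * t)"
      using frequency_decay[OF \<sigma> _ sol, of t] t by simp
    also have "\<dots> \<le> 3 * (?b + r^4 * ?a + ?c) * 1"
      using t \<sigma> by (intro mult_left_mono) auto
    also have "\<dots> = r ^ 4 * (3 * ?a + 3 * (?b + ?c) * (1 / r ^ 4))" using r by (simp add: field_simps)
    finally have "(norm (U t))\<^sup>2 \<le> 3 * ?a + 3 * (?b + ?c) * (1 / r ^ 4)" using r by (simp add: mult_le_cancel_left_pos)
    also have "\<dots> \<le> 3 * ?a + 12 * N\<^sup>2 * (1 / r ^ 4)"
    proof -
      have "3 * (?b + ?c) \<le> 12 * N\<^sup>2" using N2(1,2) zero_le_power2[of N] by argo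
      thus ?thesis using r by (intro add_mono mult_right_mono) auto
    qed
    also have "\<dots> = 3 * ?a + 12 * N\<^sup>2 * low_kernel t r" using 2 by (simp add: low_kernel_def)
    also have "\<dots> \<le> 8 * (?a + ?b + ?c) + 12 * N\<^sup>2 * low_kernel t r"
    proof -
      have "3 * ?a \<le> 8 * (?a + ?b + ?c)"
        using zero_le_power2[of "norm a"] zero_le_power2[of "norm b"] zero_le_power2[of "norm c"] by argo
      thus ?thesis by (rule add_right_mono)
    qed
    finally show ?thesis .
  next
    case 3
    have r4: "1 \<le> r ^ 4" using 3 by (intro one_le_power) auto
    have "r ^ 4 * (norm (U t))\<^sup>2 \<le> 3 * (?b + r^4 * ?a + ?c) * exp (- (r^4 / (64 * (r\<^sup>2 + \<sigma>))) * t)"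
      using frequency_decay[OF \<sigma> _ sol, of t] t by simp
    also have "\<dots> \<le> 3 * (?b + r^4 * ?a + ?c) * 1"
      using t \<sigma> by (intro mult_left_mono) auto
    also have "\<dots> \<le> 3 * (r^4 * ?b + r^4 * ?a + r^4 * ?c) * 1"
      using r4 by (intro mult_right_mono mult_left_mono add_mono) (auto intro: mult_right_mono[of 1 "r^4", simplified])
    also have "\<dots> = r ^ 4 * (3 * (?a + ?b + ?c))" by (simp add: algebra_simps)
    finally have "(norm (U t))\<^sup>2 \<le> 3 * (?a + ?b + ?c)" using r by (simp add: mult_le_cancel_left_pos)
    also have "\<dots> \<le> 8 * (?a + ?b + ?c)" by (intro mult_right_mono) auto
    also have "\<dots> = 8 * (?a + ?b + ?c) + 12 * N\<^sup>2 * low_kernel t r" using 3 by (simp add: low_kernel_def)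
    finally show ?thesis .
  qed
qed

text \<open>
  The decay rate of the energy is at least \<open>k r\<^sup>4\<close> for \<open>r \<le> 1\<close> and at least \<open>k\<close> for \<open>r \<ge> 1\<close>.
\<close>

lemma frequency_upper_high:
  assumes \<sigma>: "\<sigma> > 0" and t: "t \<ge> 1" and r: "r > 0" and sol: "frequency_ode_solution \<sigma> r a b c U \<Theta>"
    and N: "norm a \<le> N" "norm b \<le> N" "norm c \<le> N"
  defines "k \<equiv> 1 / (64 * (1 + \<sigma>))"
  shows "(norm (U t))\<^sup>2 \<le> 3 * exp (- k * t) * ((norm a)\<^sup>2 + (norm b)\<^sup>2 + (norm c)\<^sup>2) + 9 * N\<^sup>2 * high_kernel k t r"
proof -
  let ?a = "(norm a)\<^sup>2" and ?b = "(norm b)\<^sup>2" and ?c = "(norm c)\<^sup>2"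
  let ?e = "exp (- (r^4 / (64 * (r\<^sup>2 + \<sigma>))) * t)"
  have N2: "?a \<le> N\<^sup>2" "?b \<le> N\<^sup>2" "?c \<le> N\<^sup>2" using N by (auto intro!: power_mono)
  have pos: "0 \<le> ?a" "0 \<le> ?b" "0 \<le> ?c" "0 \<le> N\<^sup>2" by auto
  have rs: "r\<^sup>2 + \<sigma> > 0" using \<sigma> by (simp add: add_nonneg_pos)
  have dec: "r ^ 4 * (norm (U t))\<^sup>2 \<le> 3 * (?b + r^4 * ?a + ?c) * ?e"
    using frequency_decay[OF \<sigma> _ sol, of t] t by simp
  show ?thesis
  proof (cases "r \<le> 1")
    case True
    have r2: "r\<^sup>2 \<le> 1" "r ^ 4 \<le> 1" using True r by (auto intro!: power_le_one)
    have "k * r ^ 4 \<le> r ^ 4 / (64 * (r\<^sup>2 + \<sigma>))"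
    proof -
      have "r ^ 4 / (64 * (1 + \<sigma>)) \<le> r ^ 4 / (64 * (r\<^sup>2 + \<sigma>))"
        using r2 rs \<sigma> by (intro divide_left_mono mult_pos_pos) auto
      thus ?thesis by (simp add: k_def)
    qed
    hence "k * r ^ 4 * t \<le> r ^ 4 / (64 * (r\<^sup>2 + \<sigma>)) * t" using t by (intro mult_right_mono) auto
    hence "?e \<le> exp (- (k * r ^ 4 * t))" by (simp only: exp_le_cancel_iff mult_minus_left neg_le_iff_le)
    have "3 * (?b + r^4 * ?a + ?c) * ?e \<le> 3 * (N\<^sup>2 + 1 * N\<^sup>2 + N\<^sup>2) * exp (- (k * r ^ 4 * t))"
      using N2 r2 pos r \<open>?e \<le> _\<close> by (intro mult_mono add_mono) auto
    also have "\<dots> = r ^ 4 * (9 * N\<^sup>2 * high_kernel k t r)" using r True by (simp add: high_kernel_def)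
    finally have "r ^ 4 * (norm (U t))\<^sup>2 \<le> r ^ 4 * (9 * N\<^sup>2 * high_kernel k t r)" using dec by simp
    hence "(norm (U t))\<^sup>2 \<le> 9 * N\<^sup>2 * high_kernel k t r" using r by (simp add: mult_le_cancel_left_pos)
    moreover have "0 \<le> 3 * exp (- k * t) * (?a + ?b + ?c)" using pos by simp
    ultimately show ?thesis by linarith
  next
    case False
    have r4: "1 \<le> r ^ 4" "r\<^sup>2 \<le> r ^ 4" "1 \<le> r\<^sup>2"
      using False by (auto intro!: one_le_power power_increasing)
    have "k \<le> r ^ 4 / (64 * (r\<^sup>2 + \<sigma>))"
    proof -
      have "r\<^sup>2 + \<sigma> \<le> r ^ 4 * 1 + r ^ 4 * \<sigma>" using r4 \<sigma> by (intro add_mono) auto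
      hence "r\<^sup>2 + \<sigma> \<le> r ^ 4 * (1 + \<sigma>)" by (simp add: algebra_simps)
      thus ?thesis unfolding k_def using rs \<sigma> by (simp add: field_simps)
    qed
    hence "k * t \<le> r ^ 4 / (64 * (r\<^sup>2 + \<sigma>)) * t" using t by (intro mult_right_mono) auto
    hence e: "?e \<le> exp (- k * t)" by (simp only: exp_le_cancel_iff mult_minus_left neg_le_iff_le)
    have "3 * (?b + r^4 * ?a + ?c) * ?e \<le> 3 * (r^4 * ?b + r^4 * ?a + r^4 * ?c) * exp (- k * t)"
      using r4 e pos by (intro mult_mono mult_left_mono add_mono) (auto intro: mult_right_mono[of 1 "r^4", simplified])
    also have "\<dots> = r ^ 4 * (3 * exp (- k * t) * (?a + ?b + ?c))" by (simp add: algebra_simps)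
    finally have "r ^ 4 * (norm (U t))\<^sup>2 \<le> r ^ 4 * (3 * exp (- k * t) * (?a + ?b + ?c))" using dec by simp
    hence "(norm (U t))\<^sup>2 \<le> 3 * exp (- k * t) * (?a + ?b + ?c)" using r by (simp add: mult_le_cancel_left_pos)
    moreover have "high_kernel k t r = 0" using False by (simp add: high_kernel_def)
    ultimately show ?thesis by simp
  qed
qed

text \<open>
  This is \<open>frequency_profile\<close>, squared and solved for the main term; \<open>P\<close> stands for the modulus of the
  transform of \<open>u\<^sub>1\<close> at the origin, and \<open>b\<close> is assumed to be comparable to it.
\<close>

lemma frequency_lower:
  assumes \<sigma>: "\<sigma> > 0" and t: "t > 0" and r: "0 < r" "r \<le> R" and small: "2 * (R^4 * t / \<sigma>) \<le> 1"
    and sol: "frequency_ode_solution \<sigma> r a b c U \<Theta>"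
    and N: "norm a \<le> N" "norm c \<le> N" and P: "P / 2 \<le> norm b" "norm b \<le> 2 * P"
  shows "P\<^sup>2 / 4 * ((sin (r\<^sup>2 * t))\<^sup>2 / r ^ 4)
    \<le> 2 * (norm (U t))\<^sup>2 + 16 * (N * (1 + 1 / \<sigma>))\<^sup>2 + 64 * (R^4 * t / \<sigma>)\<^sup>2 * P\<^sup>2 * (1 / r ^ 4)"
proof -
  define \<tau> where "\<tau> = R ^ 4 * t / \<sigma>"
  define s where "s = sin (r\<^sup>2 * t)"
  define G where "G = N * (1 + 1 / \<sigma>)"
  have P0: "0 \<le> P" using P norm_ge_zero[of b] by linarith
  have N0: "0 \<le> N" using N norm_ge_zero[of a] by linarith
  have rt: "r ^ 4 * t / \<sigma> \<le> \<tau>"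
    unfolding \<tau>_def using r t \<sigma> by (intro divide_right_mono mult_right_mono power_mono) auto
  have \<tau>0: "0 \<le> \<tau>" using t \<sigma> r by (simp add: \<tau>_def)
  have "r ^ 4 * t / \<sigma> \<le> 1 / 2" using rt small unfolding \<tau>_def by linarith
  hence "2 * r ^ 4 * t \<le> \<sigma>" using \<sigma> by (simp add: pos_divide_le_eq)
  from frequency_profile[OF \<sigma> t this sol]
  have prof: "norm (of_real (r\<^sup>2) * U t - of_real s * b) \<le> 2 * r\<^sup>2 * (norm a + norm c / \<sigma>) + 2 * (r ^ 4 * t) / \<sigma> * norm b"
    by (simp add: s_def)
  have e1: "2 * r\<^sup>2 * (norm a + norm c / \<sigma>) \<le> 2 * r\<^sup>2 * G"
  proof (intro mult_left_mono)
    have "norm c / \<sigma> \<le> N / \<sigma>" using N \<sigma> by (intro divide_right_mono) auto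
    thus "norm a + norm c / \<sigma> \<le> G" using N by (simp add: G_def algebra_simps)
  qed auto
  have e2: "2 * (r ^ 4 * t) / \<sigma> * norm b \<le> 4 * \<tau> * P"
  proof -
    have "2 * (r ^ 4 * t) / \<sigma> * norm b = 2 * (r ^ 4 * t / \<sigma>) * norm b" by simp
    also have "\<dots> \<le> 2 * \<tau> * (2 * P)" using rt P \<tau>0 t \<sigma> by (intro mult_mono) auto
    finally show ?thesis by simp
  qed
  have tri: "norm (of_real s * b) \<le> norm (of_real (r\<^sup>2) * U t) + norm (of_real (r\<^sup>2) * U t - of_real s * b)"
    using norm_triangle_sub[of "of_real s * b" "of_real (r\<^sup>2) * U t"] by (simp add: norm_minus_commute)
  have "\<bar>s\<bar> * norm b \<le> r\<^sup>2 * norm (U t) + (2 * r\<^sup>2 * G + 4 * \<tau> * P)"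
  proof -
    have n1: "norm (of_real (r\<^sup>2) * U t) = r\<^sup>2 * norm (U t)" by (simp add: norm_mult norm_power)
    have n2: "norm (of_real s * b) = \<bar>s\<bar> * norm b" by (simp add: norm_mult)
    show ?thesis using tri prof e1 e2 unfolding n1 n2 by linarith
  qed
  hence "(\<bar>s\<bar> * norm b)\<^sup>2 \<le> (r\<^sup>2 * norm (U t) + (2 * r\<^sup>2 * G + 4 * \<tau> * P))\<^sup>2" by (intro power_mono) auto
  also have "\<dots> \<le> 2 * (r\<^sup>2 * norm (U t))\<^sup>2 + 2 * (2 * (2 * r\<^sup>2 * G)\<^sup>2 + 2 * (4 * \<tau> * P)\<^sup>2)"
  proof -
    have sq: "(x + y)\<^sup>2 \<le> 2 * x\<^sup>2 + 2 * y\<^sup>2" for x y :: real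
      using sum_squares_bound[of x y] by (simp add: power2_eq_square algebra_simps)
    show ?thesis using sq[of "r\<^sup>2 * norm (U t)" "2 * r\<^sup>2 * G + 4 * \<tau> * P"] sq[of "2 * r\<^sup>2 * G" "4 * \<tau> * P"]
      by argo
  qed
  also have "\<dots> = r ^ 4 * (2 * (norm (U t))\<^sup>2 + 16 * G\<^sup>2) + 64 * \<tau>\<^sup>2 * P\<^sup>2"
    by (simp add: power_mult_distrib algebra_simps)
  finally have 1: "s\<^sup>2 * (norm b)\<^sup>2 \<le> r ^ 4 * (2 * (norm (U t))\<^sup>2 + 16 * G\<^sup>2) + 64 * \<tau>\<^sup>2 * P\<^sup>2"
    by (simp add: power_mult_distrib)
  have "(P / 2)\<^sup>2 \<le> (norm b)\<^sup>2" using P P0 by (intro power_mono) auto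
  hence "s\<^sup>2 * (P / 2)\<^sup>2 \<le> s\<^sup>2 * (norm b)\<^sup>2" by (intro mult_left_mono) auto
  with 1 have 2: "P\<^sup>2 / 4 * s\<^sup>2 \<le> r ^ 4 * (2 * (norm (U t))\<^sup>2 + 16 * G\<^sup>2) + 64 * \<tau>\<^sup>2 * P\<^sup>2"
    by (simp add: power_divide mult.commute)
  hence "P\<^sup>2 / 4 * s\<^sup>2 / r ^ 4 \<le> (r ^ 4 * (2 * (norm (U t))\<^sup>2 + 16 * G\<^sup>2) + 64 * \<tau>\<^sup>2 * P\<^sup>2) / r ^ 4"
    using r by (intro divide_right_mono) auto
  also have "\<dots> = 2 * (norm (U t))\<^sup>2 + 16 * G\<^sup>2 + 64 * \<tau>\<^sup>2 * P\<^sup>2 * (1 / r ^ 4)"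
    using r by (simp add: add_divide_distrib)
  finally show ?thesis by (simp add: \<tau>_def s_def G_def)
qed

lemma decay_rate_pos: "t > 1 \<Longrightarrow> decay_rate n t > 0"
  by (simp add: decay_rate_def)

lemma exp_decay_below_rate:
  assumes n: "n \<ge> 5" and k: "k > 0"
  shows "\<exists>C>0. \<forall>t>1. exp (- k * t) \<le> C * (decay_rate n t)\<^sup>2"
proof (intro exI conjI allI impI)
  show "0 < (fact n / k ^ n :: real)" using k by simp
  fix t :: real assume t: "t > 1"
  have "exp (- (k * t)) \<le> fact n / (k * t) ^ n" using k t by (intro exp_neg_le_power) auto
  also have "\<dots> = fact n / k ^ n * t powr (- real n)"
    using t by (simp add: power_mult_distrib powr_minus_divide powr_realpow)
  also have "\<dots> \<le> fact n / k ^ n * t powr (1 - real n / 4)"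
    using t k n by (intro mult_left_mono powr_mono) auto
  finally show "exp (- k * t) \<le> fact n / k ^ n * (decay_rate n t)\<^sup>2"
    by (simp add: decay_rate_squared(3)[OF t n])
qed

text \<open>
  A bound for \<open>|U(t)|\<^sup>2\<close> in two parts: the first one will be integrated by means of the \<open>L\<^sup>2\<close> norms of the
  data, the second one by means of the uniform bound \<open>N\<close> for their transforms.
\<close>

definition dominating_kernel :: "real \<Rightarrow> real \<Rightarrow> real \<Rightarrow> (real \<Rightarrow> real) \<Rightarrow> bool" where
  "dominating_kernel \<sigma> t A K \<longleftrightarrow> 0 \<le> A \<and> (\<forall>r. 0 \<le> K r) \<and> K \<in> borel_measurable borel \<and>
    (\<forall>r a b c U \<Theta> N. r > 0 \<longrightarrow> frequency_ode_solution \<sigma> r a b c U \<Theta> \<longrightarrow>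
       norm a \<le> N \<longrightarrow> norm b \<le> N \<longrightarrow> norm c \<le> N \<longrightarrow>
       (norm (U t))\<^sup>2 \<le> A * ((norm a)\<^sup>2 + (norm b)\<^sup>2 + (norm c)\<^sup>2) + N\<^sup>2 * K r)"

lemma dominating_kernel_exists:
  assumes \<sigma>: "\<sigma> > 0"
  shows "\<exists>C>0. \<exists>T>1. \<forall>t\<ge>T. \<exists>A K. dominating_kernel \<sigma> t A K \<and> A \<le> C * (decay_rate DIM('a::euclidean_space) t)\<^sup>2 \<and>
     (\<integral>\<^sup>+\<xi>. ennreal (K (norm \<xi>)) \<partial>(lborel :: 'a measure)) \<le> ennreal (C * (decay_rate DIM('a) t)\<^sup>2)"
proof -
  have I: ?thesis if "C > 0" "T > 1"
    "\<And>t. t \<ge> T \<Longrightarrow> \<exists>A K. dominating_kernel \<sigma> t A K \<and> A \<le> C * (decay_rate DIM('a) t)\<^sup>2 \<and>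
     (\<integral>\<^sup>+\<xi>. ennreal (K (norm \<xi>)) \<partial>(lborel :: 'a measure)) \<le> ennreal (C * (decay_rate DIM('a) t)\<^sup>2)"
    for C T :: real
    using that by blast
  show ?thesis
  proof (cases "DIM('a) \<le> 4")
    case True
    obtain C where C: "C > 0" and le: "\<And>t. t \<ge> exp 1 \<Longrightarrow> (\<integral>\<^sup>+\<xi>. ennreal (low_kernel t (norm \<xi>)) \<partial>(lborel :: 'a measure))
       \<le> ennreal (C * (decay_rate DIM('a) t)\<^sup>2)"
      using low_kernel_integral[OF True] by blast
    show ?thesis
    proof (rule I[of "12 * C + 8" "exp 1"])
      fix t :: real assume t: "t \<ge> exp 1"
      have t1: "t > 1" using t exp_gt_one[of 1] by linarith
      let ?D = "(decay_rate DIM('a) t)\<^sup>2"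
      have D1: "1 \<le> ?D"
      proof (cases "DIM('a) = 4")
        case True
        thus ?thesis using t t1 by (simp add: decay_rate_squared(2)[OF t1] ln_ge_iff)
      next
        case False
        with True have n: "DIM('a) \<le> 3" using \<open>DIM('a) \<le> 4\<close> by simp
        have "t powr 0 \<le> t powr (2 - real DIM('a) / 2)" using t1 n by (intro powr_mono) auto
        thus ?thesis using t1 by (simp add: decay_rate_squared(1)[OF t1 n])
      qed
      show "\<exists>A K. dominating_kernel \<sigma> t A K \<and> A \<le> (12 * C + 8) * ?D \<and>
       (\<integral>\<^sup>+\<xi>. ennreal (K (norm \<xi>)) \<partial>(lborel :: 'a measure)) \<le> ennreal ((12 * C + 8) * ?D)"
      proof (intro exI[of _ 8] exI[of _ "\<lambda>r. 12 * low_kernel t r"] conjI)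
        show "dominating_kernel \<sigma> t 8 (\<lambda>r. 12 * low_kernel t r)"
          unfolding dominating_kernel_def
        proof (intro conjI allI impI)
          show "(\<lambda>r. 12 * low_kernel t r) \<in> borel_measurable borel" unfolding low_kernel_def by measurable
          show "0 \<le> 12 * low_kernel t r" for r by (simp add: low_kernel_def)
          fix r N :: real and a b c and U \<Theta> :: "real \<Rightarrow> complex"
          assume "0 < r" "frequency_ode_solution \<sigma> r a b c U \<Theta>" "norm a \<le> N" "norm b \<le> N" "norm c \<le> N"
          from frequency_upper_low[OF \<sigma> _ this(1,2,4,5), of t] t1
          show "(norm (U t))\<^sup>2 \<le> 8 * ((norm a)\<^sup>2 + (norm b)\<^sup>2 + (norm c)\<^sup>2) + N\<^sup>2 * (12 * low_kernel t r)"
            by (simp add: mult_ac)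
        qed simp
        have "8 * 1 \<le> (12 * C + 8) * ?D" using C D1 by (intro mult_mono) auto
        thus "8 \<le> (12 * C + 8) * ?D" by simp
        have "(\<integral>\<^sup>+\<xi>. ennreal (12 * low_kernel t (norm \<xi>)) \<partial>(lborel :: 'a measure))
          = 12 * (\<integral>\<^sup>+\<xi>. ennreal (low_kernel t (norm \<xi>)) \<partial>(lborel :: 'a measure))"
        proof -
          have "(\<lambda>\<xi>::'a. ennreal (low_kernel t (norm \<xi>))) \<in> borel_measurable lborel" unfolding low_kernel_def by measurable
          thus ?thesis by (simp add: ennreal_mult' nn_integral_cmult)
        qed
        also have "\<dots> \<le> 12 * ennreal (C * ?D)" by (intro mult_left_mono le t) simp
        also have "\<dots> = ennreal (12 * (C * ?D))" by (subst ennreal_mult') auto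
        also have "\<dots> \<le> ennreal ((12 * C + 8) * ?D)" by (intro ennreal_leI) (simp add: algebra_simps)
        finally show "(\<integral>\<^sup>+\<xi>. ennreal (12 * low_kernel t (norm \<xi>)) \<partial>(lborel :: 'a measure)) \<le> ennreal ((12 * C + 8) * ?D)" .
      qed
    qed (use C in auto)
  next
    case False
    hence n: "DIM('a) \<ge> 5" by simp
    define k where "k = 1 / (64 * (1 + \<sigma>))"
    have k: "k > 0" using \<sigma> by (simp add: k_def)
    obtain C where C: "C > 0" and le: "\<And>t. t > 1 \<Longrightarrow> (\<integral>\<^sup>+\<xi>. ennreal (high_kernel k t (norm \<xi>)) \<partial>(lborel :: 'a measure))
       \<le> ennreal (C * (decay_rate DIM('a) t)\<^sup>2)"
      using high_kernel_integral[OF n k] by blast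
    obtain B where B: "B > 0" and exple: "\<And>t. t > 1 \<Longrightarrow> exp (- k * t) \<le> B * (decay_rate DIM('a) t)\<^sup>2"
      using exp_decay_below_rate[OF n k] by blast
    show ?thesis
    proof (rule I[of "9 * C + 3 * B" 2])
      fix t :: real assume t: "t \<ge> 2"
      hence t1: "t > 1" by simp
      let ?D = "(decay_rate DIM('a) t)\<^sup>2"
      show "\<exists>A K. dominating_kernel \<sigma> t A K \<and> A \<le> (9 * C + 3 * B) * ?D \<and>
       (\<integral>\<^sup>+\<xi>. ennreal (K (norm \<xi>)) \<partial>(lborel :: 'a measure)) \<le> ennreal ((9 * C + 3 * B) * ?D)"
      proof (intro exI[of _ "3 * exp (- k * t)"] exI[of _ "\<lambda>r. 9 * high_kernel k t r"] conjI)
        show "dominating_kernel \<sigma> t (3 * exp (- k * t)) (\<lambda>r. 9 * high_kernel k t r)"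
          unfolding dominating_kernel_def
        proof (intro conjI allI impI)
          show "(\<lambda>r. 9 * high_kernel k t r) \<in> borel_measurable borel" unfolding high_kernel_def by measurable
          show "0 \<le> 9 * high_kernel k t r" for r by (simp add: high_kernel_def)
          fix r N :: real and a b c and U \<Theta> :: "real \<Rightarrow> complex"
          assume "0 < r" "frequency_ode_solution \<sigma> r a b c U \<Theta>" "norm a \<le> N" "norm b \<le> N" "norm c \<le> N"
          from frequency_upper_high[OF \<sigma> _ this, of t] t1
          show "(norm (U t))\<^sup>2 \<le> 3 * exp (- k * t) * ((norm a)\<^sup>2 + (norm b)\<^sup>2 + (norm c)\<^sup>2) + N\<^sup>2 * (9 * high_kernel k t r)"
            unfolding k_def[symmetric] by (simp add: mult_ac)
        qed simp
        have "3 * exp (- k * t) \<le> 3 * (B * ?D)" using exple[OF t1] by simp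
        also have "\<dots> \<le> (9 * C + 3 * B) * ?D" using C by (simp add: algebra_simps)
        finally show "3 * exp (- k * t) \<le> (9 * C + 3 * B) * ?D" .
        have "(\<integral>\<^sup>+\<xi>. ennreal (9 * high_kernel k t (norm \<xi>)) \<partial>(lborel :: 'a measure))
          = 9 * (\<integral>\<^sup>+\<xi>. ennreal (high_kernel k t (norm \<xi>)) \<partial>(lborel :: 'a measure))"
        proof -
          have "(\<lambda>\<xi>::'a. ennreal (high_kernel k t (norm \<xi>))) \<in> borel_measurable lborel" unfolding high_kernel_def by measurable
          thus ?thesis by (simp add: ennreal_mult' nn_integral_cmult)
        qed
        also have "\<dots> \<le> 9 * ennreal (C * ?D)" by (intro mult_left_mono le t1) simp
        also have "\<dots> = ennreal (9 * (C * ?D))" by (subst ennreal_mult') auto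
        also have "\<dots> \<le> ennreal ((9 * C + 3 * B) * ?D)" using B by (intro ennreal_leI) (simp add: algebra_simps)
        finally show "(\<integral>\<^sup>+\<xi>. ennreal (9 * high_kernel k t (norm \<xi>)) \<partial>(lborel :: 'a measure)) \<le> ennreal ((9 * C + 3 * B) * ?D)" .
      qed
    qed (use C B in auto)
  qed
qed

section \<open>The solution of the Cauchy problem\<close>

lemma AE_nonzero_frequency: "AE \<xi> in lebesgue. norm (\<xi> :: 'a::euclidean_space) > 0"
proof -
  have "AE \<xi> in lborel. \<xi> \<noteq> (0 :: 'a)" by (rule AE_lborel_singleton)
  from AE_completion[OF this] show ?thesis by eventually_elim simp
qed

lemma L2_norm_nonneg: "0 \<le> L2_norm f" and L1_norm_nonneg: "0 \<le> L1_norm f"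
  by (simp_all add: L2_norm_def L1_norm_def)

lemma nn_integral_fourier_L2:
  fixes f :: "'a::euclidean_space \<Rightarrow> complex"
  assumes "in_L1 f" "in_L2 f"
  shows "(\<integral>\<^sup>+\<xi>. ennreal ((norm (fourier f \<xi>))\<^sup>2) \<partial>lebesgue) = ennreal ((2 * pi) ^ DIM('a) * (L2_norm f)\<^sup>2)"
  unfolding nn_integral_L2[OF plancherel(1)[OF assms]] L2_norm_squared plancherel(2)[OF assms] ..

text \<open>
  The transform of an integrable function is continuous, and its value at the origin is the integral.
\<close>

lemma fourier_near_origin:
  assumes f: "in_L1 f" and P: "(\<integral>x. f x \<partial>lebesgue) \<noteq> 0"
  shows "\<exists>d>0. \<forall>\<xi>. norm \<xi> < d \<longrightarrow> norm (\<integral>x. f x \<partial>lebesgue) / 2 \<le> norm (fourier f \<xi>)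
    \<and> norm (fourier f \<xi>) \<le> 2 * norm (\<integral>x. f x \<partial>lebesgue)"
proof -
  let ?P = "\<integral>x. f x \<partial>lebesgue"
  have f0: "fourier f 0 = ?P" by (simp add: fourier_def)
  have "continuous (at 0) (fourier f)"
    using fourier_continuous[OF f] by (simp add: continuous_on_eq_continuous_at)
  then obtain d where d: "d > 0" "\<And>\<xi>. dist \<xi> 0 < d \<Longrightarrow> dist (fourier f \<xi>) (fourier f 0) < norm ?P / 2"
    unfolding continuous_at_eps_delta using P by (metis half_gt_zero zero_less_norm_iff)
  have "norm ?P / 2 \<le> norm (fourier f \<xi>) \<and> norm (fourier f \<xi>) \<le> 2 * norm ?P" if "norm \<xi> < d" for \<xi>
  proof -
    have D: "norm (fourier f \<xi> - ?P) < norm ?P / 2" using d(2)[of \<xi>] that by (simp add: dist_norm f0)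
    have "norm ?P \<le> norm (fourier f \<xi>) + norm (fourier f \<xi> - ?P)"
      using norm_triangle_sub[of ?P "fourier f \<xi>"] by (simp add: norm_minus_commute)
    moreover have "norm (fourier f \<xi>) \<le> norm ?P + norm (fourier f \<xi> - ?P)" by (rule norm_triangle_sub)
    ultimately show ?thesis using D norm_ge_zero[of ?P] by argo
  qed
  thus ?thesis using d(1) by blast
qed

text \<open>
  Data in \<open>L\<^sup>1 \<inter> L\<^sup>2\<close> together with modes \<open>U\<close>, \<open>\<Theta>\<close> that witness \<open>plate_solution\<close>.
\<close>

locale plate =
  fixes \<sigma> :: real and u0 u1 \<theta>0 :: "'a::euclidean_space \<Rightarrow> complex" and u :: "real \<Rightarrow> 'a \<Rightarrow> complex"
    and U \<Theta> :: "real \<Rightarrow> 'a \<Rightarrow> complex"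
  assumes \<sigma>: "\<sigma> > 0"
    and data: "in_L1 u0" "in_L2 u0" "in_L1 u1" "in_L2 u1" "in_L1 \<theta>0" "in_L2 \<theta>0"
    and transform: "t \<ge> 0 \<Longrightarrow> L2_fourier (u t) (U t)"
    and modes: "AE \<xi> in lebesgue. frequency_ode_solution \<sigma> (norm \<xi>)
        (fourier u0 \<xi>) (fourier u1 \<xi>) (fourier \<theta>0 \<xi>) (\<lambda>t. U t \<xi>) (\<lambda>t. \<Theta> t \<xi>)"
begin

abbreviation "N \<equiv> data_norm u0 u1 \<theta>0"

lemma solution_norm:
  assumes "t \<ge> 0"
  shows "(\<integral>\<^sup>+\<xi>. ennreal ((norm (U t \<xi>))\<^sup>2) \<partial>lebesgue) = ennreal ((2 * pi) ^ DIM('a) * (L2_norm (u t))\<^sup>2)"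
proof -
  have "in_L2 (U t)" using transform[OF assms] by (simp add: L2_fourier_def)
  thus ?thesis using plancherel_L2[OF transform[OF assms]] by (simp add: nn_integral_L2)
qed

lemma solution_measurable: "t \<ge> 0 \<Longrightarrow> U t \<in> borel_measurable lebesgue"
  using transform by (simp add: L2_fourier_def in_L2_def)

lemma fourier_data_bounded:
  "norm (fourier u0 \<xi>) \<le> N" "norm (fourier u1 \<xi>) \<le> N" "norm (fourier \<theta>0 \<xi>) \<le> N"
  using fourier_bounded[of u0 \<xi>] fourier_bounded[of u1 \<xi>] fourier_bounded[of \<theta>0 \<xi>]
    L2_norm_nonneg[of u0] L2_norm_nonneg[of u1] L2_norm_nonneg[of \<theta>0]
    L1_norm_nonneg[of u0] L1_norm_nonneg[of u1] L1_norm_nonneg[of \<theta>0]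
  unfolding data_norm_def by linarith+

lemma fourier_data_measurable:
  "fourier u0 \<in> borel_measurable lebesgue" "fourier u1 \<in> borel_measurable lebesgue" "fourier \<theta>0 \<in> borel_measurable lebesgue"
  using plancherel(1) data by (auto simp: in_L2_def)

lemma data_energy:
  "(\<integral>\<^sup>+\<xi>. ennreal ((norm (fourier u0 \<xi>))\<^sup>2 + (norm (fourier u1 \<xi>))\<^sup>2 + (norm (fourier \<theta>0 \<xi>))\<^sup>2) \<partial>lebesgue)
    \<le> ennreal ((2 * pi) ^ DIM('a) * N\<^sup>2)"
proof -
  note [measurable] = fourier_data_measurable
  let ?P = "(2 * pi) ^ DIM('a) :: real"
  have "(\<integral>\<^sup>+\<xi>. ennreal ((norm (fourier u0 \<xi>))\<^sup>2 + (norm (fourier u1 \<xi>))\<^sup>2 + (norm (fourier \<theta>0 \<xi>))\<^sup>2) \<partial>lebesgue)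
    = (\<integral>\<^sup>+\<xi>. ennreal ((norm (fourier u0 \<xi>))\<^sup>2) + ennreal ((norm (fourier u1 \<xi>))\<^sup>2) + ennreal ((norm (fourier \<theta>0 \<xi>))\<^sup>2) \<partial>lebesgue)"
    by (simp add: ennreal_plus)
  also have "\<dots> = ennreal (?P * (L2_norm u0)\<^sup>2) + ennreal (?P * (L2_norm u1)\<^sup>2) + ennreal (?P * (L2_norm \<theta>0)\<^sup>2)"
    by (simp add: nn_integral_add nn_integral_fourier_L2 data)
  also have "\<dots> = ennreal (?P * ((L2_norm u0)\<^sup>2 + (L2_norm u1)\<^sup>2 + (L2_norm \<theta>0)\<^sup>2))"
    by (simp add: ennreal_plus[symmetric] distrib_left del: ennreal_plus)
  also have "\<dots> \<le> ennreal (?P * N\<^sup>2)"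
  proof (intro ennreal_leI mult_left_mono)
    have sq: "x\<^sup>2 + y\<^sup>2 + z\<^sup>2 \<le> (x + y + z)\<^sup>2" if "0 \<le> x" "0 \<le> y" "0 \<le> z" for x y z :: real
    proof -
      have "0 \<le> x * y + x * z + y * z" using that by (intro add_nonneg_nonneg mult_nonneg_nonneg)
      thus ?thesis by (simp add: power2_eq_square algebra_simps)
    qed
    have "(L2_norm u0)\<^sup>2 + (L2_norm u1)\<^sup>2 + (L2_norm \<theta>0)\<^sup>2 \<le> (L2_norm u0 + L2_norm u1 + L2_norm \<theta>0)\<^sup>2"
      by (intro sq L2_norm_nonneg)
    also have "\<dots> \<le> N\<^sup>2"
      unfolding data_norm_def
      using L2_norm_nonneg[of u0] L2_norm_nonneg[of u1] L2_norm_nonneg[of \<theta>0]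
        L1_norm_nonneg[of u0] L1_norm_nonneg[of u1] L1_norm_nonneg[of \<theta>0] by (intro power_mono) auto
    finally show "(L2_norm u0)\<^sup>2 + (L2_norm u1)\<^sup>2 + (L2_norm \<theta>0)\<^sup>2 \<le> N\<^sup>2" .
  qed simp
  finally show ?thesis .
qed

lemma data_norm_nonneg: "0 \<le> N"
  using fourier_data_bounded(1)[of 0] norm_ge_zero order_trans by blast

lemma upper_bound:
  assumes t: "t > 1" and K: "dominating_kernel \<sigma> t A K" and C: "C \<ge> 0" and A: "A \<le> C * (decay_rate DIM('a) t)\<^sup>2"
    and int: "(\<integral>\<^sup>+\<xi>. ennreal (K (norm \<xi>)) \<partial>(lborel :: 'a measure)) \<le> ennreal (C * (decay_rate DIM('a) t)\<^sup>2)"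
  shows "L2_norm (u t) \<le> sqrt (2 * C) * decay_rate DIM('a) t * N"
proof -
  let ?P = "(2 * pi) ^ DIM('a) :: real"
  let ?E = "\<lambda>\<xi>. (norm (fourier u0 \<xi>))\<^sup>2 + (norm (fourier u1 \<xi>))\<^sup>2 + (norm (fourier \<theta>0 \<xi>))\<^sup>2"
  let ?D = "(decay_rate DIM('a) t)\<^sup>2"
  note [measurable] = fourier_data_measurable
  have P1: "1 \<le> ?P" using pi_gt3 by (intro one_le_power) simp
  have K0: "0 \<le> A" "\<And>r. 0 \<le> K r" and Km [measurable]: "K \<in> borel_measurable borel" using K by (auto simp: dominating_kernel_def)
  have Klm: "(\<lambda>\<xi>::'a. ennreal (N\<^sup>2 * K (norm \<xi>))) \<in> borel_measurable lebesgue"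
    using Km by (intro measurable_completion) measurable
  have "AE \<xi> in lebesgue. ennreal ((norm (U t \<xi>))\<^sup>2) \<le> ennreal (A * ?E \<xi>) + ennreal (N\<^sup>2 * K (norm \<xi>))"
    using modes AE_nonzero_frequency
  proof eventually_elim
    case (elim \<xi>)
    have "(norm (U t \<xi>))\<^sup>2 \<le> A * ?E \<xi> + N\<^sup>2 * K (norm \<xi>)"
      using K elim fourier_data_bounded[of \<xi>] unfolding dominating_kernel_def by blast
    hence "ennreal ((norm (U t \<xi>))\<^sup>2) \<le> ennreal (A * ?E \<xi> + N\<^sup>2 * K (norm \<xi>))" by (rule ennreal_leI)
    thus ?case using K0 by (simp add: ennreal_plus)
  qed
  hence "(\<integral>\<^sup>+\<xi>. ennreal ((norm (U t \<xi>))\<^sup>2) \<partial>lebesgue)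
     \<le> (\<integral>\<^sup>+\<xi>. ennreal (A * ?E \<xi>) + ennreal (N\<^sup>2 * K (norm \<xi>)) \<partial>lebesgue)"
    by (rule nn_integral_mono_AE)
  also have "\<dots> = (\<integral>\<^sup>+\<xi>. ennreal (A * ?E \<xi>) \<partial>lebesgue) + (\<integral>\<^sup>+\<xi>. ennreal (N\<^sup>2 * K (norm (\<xi>::'a))) \<partial>lebesgue)"
    by (rule nn_integral_add[OF _ Klm]) measurable
  also have "\<dots> \<le> ennreal (C * ?D) * ennreal (?P * N\<^sup>2) + ennreal (N\<^sup>2) * ennreal (C * ?D)"
  proof (rule add_mono)
    have Em: "(\<lambda>\<xi>. ennreal (?E \<xi>)) \<in> borel_measurable lebesgue" by measurable
    have "(\<integral>\<^sup>+\<xi>. ennreal (A * ?E \<xi>) \<partial>lebesgue) = (\<integral>\<^sup>+\<xi>. ennreal A * ennreal (?E \<xi>) \<partial>lebesgue)"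
      by (intro nn_integral_cong ennreal_mult' K0)
    also have "\<dots> = ennreal A * (\<integral>\<^sup>+\<xi>. ennreal (?E \<xi>) \<partial>lebesgue)" by (rule nn_integral_cmult[OF Em])
    also have "\<dots> \<le> ennreal (C * ?D) * ennreal (?P * N\<^sup>2)"
      by (intro mult_mono data_energy ennreal_leI A) auto
    finally show "(\<integral>\<^sup>+\<xi>. ennreal (A * ?E \<xi>) \<partial>lebesgue) \<le> ennreal (C * ?D) * ennreal (?P * N\<^sup>2)" .
    have Kb: "(\<lambda>\<xi>::'a. ennreal (K (norm \<xi>))) \<in> borel_measurable lborel" by measurable
    have "(\<integral>\<^sup>+\<xi>. ennreal (N\<^sup>2 * K (norm (\<xi>::'a))) \<partial>lebesgue) = (\<integral>\<^sup>+\<xi>. ennreal (N\<^sup>2) * ennreal (K (norm (\<xi>::'a))) \<partial>lborel)"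
      unfolding nn_integral_completion by (intro nn_integral_cong ennreal_mult') simp
    also have "\<dots> = ennreal (N\<^sup>2) * (\<integral>\<^sup>+\<xi>. ennreal (K (norm \<xi>)) \<partial>(lborel :: 'a measure))"
      by (rule nn_integral_cmult[OF Kb])
    also have "\<dots> \<le> ennreal (N\<^sup>2) * ennreal (C * ?D)" by (intro mult_left_mono int) simp
    finally show "(\<integral>\<^sup>+\<xi>. ennreal (N\<^sup>2 * K (norm (\<xi>::'a))) \<partial>lebesgue) \<le> ennreal (N\<^sup>2) * ennreal (C * ?D)" .
  qed
  also have "ennreal (C * ?D) * ennreal (?P * N\<^sup>2) + ennreal (N\<^sup>2) * ennreal (C * ?D) = ennreal (C * ?D * (?P * N\<^sup>2) + N\<^sup>2 * (C * ?D))"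
  proof -
    have nn: "0 \<le> C * ?D" "0 \<le> ?P * N\<^sup>2" "0 \<le> N\<^sup>2" using C by auto
    have "ennreal (C * ?D) * ennreal (?P * N\<^sup>2) = ennreal (C * ?D * (?P * N\<^sup>2))"
      by (rule ennreal_mult[OF nn(1,2), symmetric])
    moreover have "ennreal (N\<^sup>2) * ennreal (C * ?D) = ennreal (N\<^sup>2 * (C * ?D))"
      by (rule ennreal_mult[OF nn(3,1), symmetric])
    moreover note ennreal_plus[OF mult_nonneg_nonneg[OF nn(1,2)] mult_nonneg_nonneg[OF nn(3,1)]]
    ultimately show ?thesis by metis
  qed
  also have "\<dots> \<le> ennreal (?P * (2 * C * ?D * N\<^sup>2))"
  proof (rule ennreal_leI)
    have "1 * (N\<^sup>2 * (C * ?D)) \<le> ?P * (N\<^sup>2 * (C * ?D))" using P1 C by (intro mult_right_mono) auto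
    thus "C * ?D * (?P * N\<^sup>2) + N\<^sup>2 * (C * ?D) \<le> ?P * (2 * C * ?D * N\<^sup>2)" by (simp add: algebra_simps)
  qed
  finally have "ennreal (?P * (L2_norm (u t))\<^sup>2) \<le> ennreal (?P * (2 * C * ?D * N\<^sup>2))"
    using solution_norm[of t] t by simp
  hence "?P * (L2_norm (u t))\<^sup>2 \<le> ?P * (2 * C * ?D * N\<^sup>2)"
    using C by (subst (asm) ennreal_le_iff) auto
  hence "(L2_norm (u t))\<^sup>2 \<le> 2 * C * ?D * N\<^sup>2" by (rule mult_left_le_imp_le) simp
  also have "\<dots> = (sqrt (2 * C))\<^sup>2 * ?D * N\<^sup>2" using C by simp
  also have "\<dots> = (sqrt (2 * C) * decay_rate DIM('a) t * N)\<^sup>2" by (simp only: power_mult_distrib)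
  finally show ?thesis
  proof (rule power2_le_imp_le)
    show "0 \<le> sqrt (2 * C) * decay_rate DIM('a) t * N"
      using C decay_rate_pos[OF t] data_norm_nonneg by (intro mult_nonneg_nonneg) (auto intro: less_imp_le)
  qed
qed

text \<open>
  Integrate \<open>frequency_lower\<close> over the window. The main term is at least \<open>P\<^sup>2/16\<close> times
  \<open>S m ln(R2/R1)\<close>, where \<open>S\<close> is the area of the unit sphere; the error proportional to \<open>P\<^sup>2\<close> takes at most
  half of this, and the error that stems from the other data is a multiple of the volume of the ball of
  radius \<open>R2\<close>.
\<close>

lemma window_mass:
  assumes t: "t > 0" and window: "frequency_window \<sigma> DIM('a) \<kappa> t R1 R2 m M"
    and P: "\<And>\<xi>. norm \<xi> \<le> R2 \<Longrightarrow> P / 2 \<le> norm (fourier u1 \<xi>) \<and> norm (fourier u1 \<xi>) \<le> 2 * P"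
  shows "P\<^sup>2 * (sphere_area DIM('a) * (m * ln (R2 / R1))) / 32
    \<le> 2 * ((2 * pi) ^ DIM('a) * (L2_norm (u t))\<^sup>2)
      + 16 * (N * (1 + 1 / \<sigma>))\<^sup>2 * (unit_ball_vol DIM('a) * R2 ^ DIM('a))"
proof -
  define S where "S = sphere_area DIM('a)"
  define q where "q = ln (R2 / R1)"
  define \<tau> where "\<tau> = R2 ^ 4 * t / \<sigma>"
  define G where "G = N * (1 + 1 / \<sigma>)"
  define x where "x = (2 * pi) ^ DIM('a) * (L2_norm (u t))\<^sup>2"
  define V where "V = unit_ball_vol DIM('a) * R2 ^ DIM('a)"
  have R: "0 < R1" "4 * R1 \<le> R2" and tR: "1 \<le> t * R1\<^sup>2" and m: "0 < m"
    and small: "2048 * (R2 ^ 4 * t / \<sigma>)\<^sup>2 * M \<le> m"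
    using window by (auto simp: frequency_window_def)
  have mM: "m \<le> r powr (real DIM('a) - 4) \<and> r powr (real DIM('a) - 4) \<le> M" if "R1 \<le> r" "r \<le> R2" for r
    using window that by (auto simp: frequency_window_def)
  let ?i = "\<lambda>\<xi>::'a. indicator {R1..R2} (norm \<xi>) :: real"
  have S: "S > 0" unfolding S_def by (rule sphere_area_pos) simp
  have R2: "R1 \<le> R2" "0 < R2" using R by linarith+
  have q: "q \<ge> 1"
  proof -
    have "4 \<le> R2 / R1" using R by (simp add: pos_le_divide_eq)
    hence "ln 4 \<le> q" unfolding q_def using R R2 by (subst ln_le_cancel_iff) auto
    thus ?thesis using ln_4_ge_1 by linarith
  qed
  have M: "m \<le> M" "M > 0" using mM[of R1] R2 m by auto
  have \<tau>0: "0 \<le> \<tau>" using t \<sigma> by (simp add: \<tau>_def)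
  have \<tau>M: "2048 * \<tau>\<^sup>2 * M \<le> m" using small by (simp add: \<tau>_def)
  have \<tau>small: "2 * (R2 ^ 4 * t / \<sigma>) \<le> 1"
  proof -
    have "(2048 * \<tau>\<^sup>2) * M \<le> 1 * M" using \<tau>M M by linarith
    hence "2048 * \<tau>\<^sup>2 \<le> 1" using M by (simp only: mult_le_cancel_right_pos)
    hence "(2 * \<tau>)\<^sup>2 \<le> 1\<^sup>2" using zero_le_power2[of \<tau>] unfolding power_mult_distrib by simp
    hence "2 * \<tau> \<le> 1" by (rule power2_le_imp_le) simp
    thus ?thesis by (simp add: \<tau>_def)
  qed
  define J where "J = (\<integral>\<^sup>+\<xi>. ennreal (?i \<xi> * ((sin ((norm \<xi>)\<^sup>2 * t))\<^sup>2 / norm \<xi> ^ 4)) \<partial>(lborel :: 'a measure))"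
  define H where "H = (\<integral>\<^sup>+\<xi>. ennreal (?i \<xi> * (1 / norm \<xi> ^ 4)) \<partial>(lborel :: 'a measure))"
  have J: "ennreal (S * (m * (q / 4))) \<le> J"
  proof -
    have "1 / (4 * (t * R1\<^sup>2)) \<le> 1 / 4" using tR by (simp add: divide_le_eq)
    hence "q / 4 \<le> q / 2 - 1 / (4 * (t * R1\<^sup>2))" using q by argo
    hence "ennreal (S * (m * (q / 4))) \<le> ennreal (S * (m * (q / 2 - 1 / (4 * (t * R1\<^sup>2)))))"
      using S m by (intro ennreal_leI mult_left_mono) auto
    also have "\<dots> \<le> J"
      unfolding J_def S_def q_def using R R2 t m mM by (intro sine_square_shell) auto
    finally show ?thesis .
  qed
  have H: "H \<le> ennreal (S * (M * q))"
    unfolding H_def S_def q_def using R R2 mM by (intro inverse_fourth_shell) auto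
  have V: "(\<integral>\<^sup>+\<xi>. ennreal (?i \<xi>) \<partial>(lborel :: 'a measure)) \<le> ennreal V"
  proof -
    have "(\<integral>\<^sup>+\<xi>. ennreal (?i \<xi>) \<partial>(lborel :: 'a measure)) \<le> (\<integral>\<^sup>+\<xi>. indicator (cball 0 R2) \<xi> \<partial>(lborel :: 'a measure))"
      by (intro nn_integral_mono) (auto split: split_indicator)
    also have "\<dots> = emeasure lborel (cball (0::'a) R2)" by (intro nn_integral_indicator) simp
    also have "\<dots> = ennreal V" using R2 by (simp add: emeasure_cball V_def)
    finally show ?thesis .
  qed
  have "AE \<xi> in lebesgue. ennreal (P\<^sup>2 / 4) * ennreal (?i \<xi> * ((sin ((norm \<xi>)\<^sup>2 * t))\<^sup>2 / norm \<xi> ^ 4))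
     \<le> 2 * ennreal ((norm (U t \<xi>))\<^sup>2) + (ennreal (16 * G\<^sup>2) * ennreal (?i \<xi>)
        + ennreal (64 * \<tau>\<^sup>2 * P\<^sup>2) * ennreal (?i \<xi> * (1 / norm \<xi> ^ 4)))"
    using modes
  proof eventually_elim
    case (elim \<xi>)
    show ?case
    proof (cases "norm \<xi> \<in> {R1..R2}")
      case True
      hence r: "0 < norm \<xi>" "norm \<xi> \<le> R2" using R by auto
      have "P\<^sup>2 / 4 * ((sin ((norm \<xi>)\<^sup>2 * t))\<^sup>2 / norm \<xi> ^ 4)
        \<le> 2 * (norm (U t \<xi>))\<^sup>2 + 16 * G\<^sup>2 + 64 * \<tau>\<^sup>2 * P\<^sup>2 * (1 / norm \<xi> ^ 4)"
        unfolding G_def \<tau>_def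
        by (rule frequency_lower[OF \<sigma> t r \<tau>small elim]) (use fourier_data_bounded P r in auto)
      hence "ennreal (P\<^sup>2 / 4 * ((sin ((norm \<xi>)\<^sup>2 * t))\<^sup>2 / norm \<xi> ^ 4))
        \<le> ennreal (2 * (norm (U t \<xi>))\<^sup>2 + (16 * G\<^sup>2 + 64 * \<tau>\<^sup>2 * P\<^sup>2 * (1 / norm \<xi> ^ 4)))"
        by (intro ennreal_leI) (simp add: add.assoc)
      also have "\<dots> = 2 * ennreal ((norm (U t \<xi>))\<^sup>2) + (ennreal (16 * G\<^sup>2) + ennreal (64 * \<tau>\<^sup>2 * P\<^sup>2) * ennreal (1 / norm \<xi> ^ 4))"
      proof -
        have "ennreal (2 * (norm (U t \<xi>))\<^sup>2) = 2 * ennreal ((norm (U t \<xi>))\<^sup>2)"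
          by (subst ennreal_mult) auto
        moreover have "ennreal (64 * \<tau>\<^sup>2 * P\<^sup>2 * (1 / norm \<xi> ^ 4)) = ennreal (64 * \<tau>\<^sup>2 * P\<^sup>2) * ennreal (1 / norm \<xi> ^ 4)"
          by (rule ennreal_mult) simp_all
        moreover have "ennreal (2 * (norm (U t \<xi>))\<^sup>2 + (16 * G\<^sup>2 + 64 * \<tau>\<^sup>2 * P\<^sup>2 * (1 / norm \<xi> ^ 4)))
          = ennreal (2 * (norm (U t \<xi>))\<^sup>2) + (ennreal (16 * G\<^sup>2) + ennreal (64 * \<tau>\<^sup>2 * P\<^sup>2 * (1 / norm \<xi> ^ 4)))"
          by (subst ennreal_plus, simp, simp, subst ennreal_plus, simp_all)
        ultimately show ?thesis by (simp only:)
      qed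
      finally have "ennreal (P\<^sup>2 / 4 * ((sin ((norm \<xi>)\<^sup>2 * t))\<^sup>2 / norm \<xi> ^ 4)) \<le> \<dots>" .
      moreover have "ennreal (P\<^sup>2 / 4 * ((sin ((norm \<xi>)\<^sup>2 * t))\<^sup>2 / norm \<xi> ^ 4))
        = ennreal (P\<^sup>2 / 4) * ennreal ((sin ((norm \<xi>)\<^sup>2 * t))\<^sup>2 / norm \<xi> ^ 4)"
        by (rule ennreal_mult) simp_all
      moreover have "?i \<xi> = 1" using True by simp
      ultimately show ?thesis by (simp only: mult_1_left ennreal_1 mult_1_right)
    qed simp
  qed
  hence ineq: "(\<integral>\<^sup>+\<xi>. ennreal (P\<^sup>2 / 4) * ennreal (?i \<xi> * ((sin ((norm \<xi>)\<^sup>2 * t))\<^sup>2 / norm \<xi> ^ 4)) \<partial>lebesgue)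
    \<le> (\<integral>\<^sup>+\<xi>. 2 * ennreal ((norm (U t \<xi>))\<^sup>2) + (ennreal (16 * G\<^sup>2) * ennreal (?i \<xi>)
        + ennreal (64 * \<tau>\<^sup>2 * P\<^sup>2) * ennreal (?i \<xi> * (1 / norm \<xi> ^ 4))) \<partial>lebesgue)" (is "?lhs \<le> ?rhs")
    by (rule nn_integral_mono_AE)
  have Um [measurable]: "U t \<in> borel_measurable lebesgue" using solution_measurable t by simp
  have U2: "(\<lambda>\<xi>. ennreal ((norm (U t \<xi>))\<^sup>2)) \<in> borel_measurable lebesgue"
    "(\<lambda>\<xi>. 2 * ennreal ((norm (U t \<xi>))\<^sup>2)) \<in> borel_measurable lebesgue" by measurable
  have im: "(\<lambda>\<xi>. ennreal (?i \<xi>)) \<in> borel_measurable lborel"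
    "(\<lambda>\<xi>. ennreal (?i \<xi> * (1 / norm \<xi> ^ 4))) \<in> borel_measurable lborel"
    "(\<lambda>\<xi>. ennreal (?i \<xi> * ((sin ((norm \<xi>)\<^sup>2 * t))\<^sup>2 / norm \<xi> ^ 4))) \<in> borel_measurable lborel"
    "(\<lambda>\<xi>. ennreal (16 * G\<^sup>2) * ennreal (?i \<xi>)) \<in> borel_measurable lborel"
    "(\<lambda>\<xi>. ennreal (64 * \<tau>\<^sup>2 * P\<^sup>2) * ennreal (?i \<xi> * (1 / norm \<xi> ^ 4))) \<in> borel_measurable lborel"
    "(\<lambda>\<xi>. ennreal (16 * G\<^sup>2) * ennreal (?i \<xi>)
        + ennreal (64 * \<tau>\<^sup>2 * P\<^sup>2) * ennreal (?i \<xi> * (1 / norm \<xi> ^ 4))) \<in> borel_measurable lborel"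
    by measurable
  have lhs: "?lhs = ennreal (P\<^sup>2 / 4) * J"
    unfolding nn_integral_completion J_def by (rule nn_integral_cmult[OF im(3)])
  have rhs1: "?rhs = (\<integral>\<^sup>+\<xi>. 2 * ennreal ((norm (U t \<xi>))\<^sup>2) \<partial>lebesgue) + (\<integral>\<^sup>+\<xi>. ennreal (16 * G\<^sup>2) * ennreal (?i \<xi>)
        + ennreal (64 * \<tau>\<^sup>2 * P\<^sup>2) * ennreal (?i \<xi> * (1 / norm \<xi> ^ 4)) \<partial>lebesgue)"
    by (rule nn_integral_add[OF U2(2) measurable_completion[OF im(6)]])
  have rhs2: "(\<integral>\<^sup>+\<xi>. 2 * ennreal ((norm (U t \<xi>))\<^sup>2) \<partial>lebesgue) = 2 * ennreal x"
    unfolding nn_integral_cmult[OF U2(1)] x_def using solution_norm[of t] t by simp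
  have rhs3: "(\<integral>\<^sup>+\<xi>. ennreal (16 * G\<^sup>2) * ennreal (?i \<xi>)
        + ennreal (64 * \<tau>\<^sup>2 * P\<^sup>2) * ennreal (?i \<xi> * (1 / norm \<xi> ^ 4)) \<partial>lebesgue)
     = ennreal (16 * G\<^sup>2) * (\<integral>\<^sup>+\<xi>. ennreal (?i \<xi>) \<partial>(lborel :: 'a measure)) + ennreal (64 * \<tau>\<^sup>2 * P\<^sup>2) * H"
    unfolding nn_integral_completion H_def nn_integral_add[OF im(4,5)]
      nn_integral_cmult[OF im(1)] nn_integral_cmult[OF im(2)] ..
  have main: "ennreal (P\<^sup>2 / 4) * J \<le> 2 * ennreal x
      + (ennreal (16 * G\<^sup>2) * (\<integral>\<^sup>+\<xi>. ennreal (?i \<xi>) \<partial>(lborel :: 'a measure)) + ennreal (64 * \<tau>\<^sup>2 * P\<^sup>2) * H)"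
    using ineq unfolding lhs rhs1 rhs2 rhs3 .
  have nonneg: "0 \<le> x" "0 \<le> V" "0 \<le> S * (m * (q / 4))" "0 \<le> S * (M * q)"
    using S m q M R2 by (simp_all add: x_def V_def)
  have "ennreal (P\<^sup>2 / 4 * (S * (m * (q / 4)))) = ennreal (P\<^sup>2 / 4) * ennreal (S * (m * (q / 4)))"
    by (rule ennreal_mult) (use nonneg in auto)
  also have "\<dots> \<le> ennreal (P\<^sup>2 / 4) * J" by (intro mult_left_mono J) simp
  also note main
  also have "2 * ennreal x + (ennreal (16 * G\<^sup>2) * (\<integral>\<^sup>+\<xi>. ennreal (?i \<xi>) \<partial>(lborel :: 'a measure)) + ennreal (64 * \<tau>\<^sup>2 * P\<^sup>2) * H)
    \<le> ennreal 2 * ennreal x + (ennreal (16 * G\<^sup>2) * ennreal V + ennreal (64 * \<tau>\<^sup>2 * P\<^sup>2) * ennreal (S * (M * q)))"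
    by (intro add_mono mult_left_mono V H) auto
  also have "\<dots> = ennreal (2 * x + (16 * G\<^sup>2 * V + 64 * \<tau>\<^sup>2 * P\<^sup>2 * (S * (M * q))))"
  proof -
    have nn: "0 \<le> 2 * x" "0 \<le> 16 * G\<^sup>2" "0 \<le> 64 * \<tau>\<^sup>2 * P\<^sup>2" using nonneg by simp_all
    have "ennreal 2 * ennreal x = ennreal (2 * x)"
      by (rule ennreal_mult[symmetric]) (use nonneg in simp_all)
    moreover have "ennreal (16 * G\<^sup>2) * ennreal V = ennreal (16 * G\<^sup>2 * V)"
      by (rule ennreal_mult[OF nn(2) nonneg(2), symmetric])
    moreover have "ennreal (64 * \<tau>\<^sup>2 * P\<^sup>2) * ennreal (S * (M * q)) = ennreal (64 * \<tau>\<^sup>2 * P\<^sup>2 * (S * (M * q)))"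
      by (rule ennreal_mult[OF nn(3) nonneg(4), symmetric])
    moreover have "ennreal (2 * x + (16 * G\<^sup>2 * V + 64 * \<tau>\<^sup>2 * P\<^sup>2 * (S * (M * q))))
      = ennreal (2 * x) + (ennreal (16 * G\<^sup>2 * V) + ennreal (64 * \<tau>\<^sup>2 * P\<^sup>2 * (S * (M * q))))"
      using ennreal_plus[OF nn(1) add_nonneg_nonneg[OF mult_nonneg_nonneg[OF nn(2) nonneg(2)] mult_nonneg_nonneg[OF nn(3) nonneg(4)]]]
        ennreal_plus[OF mult_nonneg_nonneg[OF nn(2) nonneg(2)] mult_nonneg_nonneg[OF nn(3) nonneg(4)]]
      by (simp only:)
    ultimately show ?thesis by (simp only:)
  qed
  finally have real: "P\<^sup>2 / 4 * (S * (m * (q / 4))) \<le> 2 * x + (16 * G\<^sup>2 * V + 64 * \<tau>\<^sup>2 * P\<^sup>2 * (S * (M * q)))"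
  proof (subst (asm) ennreal_le_iff)
    show "0 \<le> 2 * x + (16 * G\<^sup>2 * V + 64 * \<tau>\<^sup>2 * P\<^sup>2 * (S * (M * q)))"
      using nonneg S M q by (intro add_nonneg_nonneg mult_nonneg_nonneg) auto
  qed
  have "64 * \<tau>\<^sup>2 * P\<^sup>2 * (S * (M * q)) = P\<^sup>2 * S * q / 32 * (2048 * \<tau>\<^sup>2 * M)" by (simp add: field_simps)
  also have "\<dots> \<le> P\<^sup>2 * S * q / 32 * m" using \<tau>M S q by (intro mult_left_mono) auto
  finally have "64 * \<tau>\<^sup>2 * P\<^sup>2 * (S * (M * q)) \<le> P\<^sup>2 * (S * (m * q)) / 32" by (simp add: mult_ac)
  moreover have "P\<^sup>2 / 4 * (S * (m * (q / 4))) = P\<^sup>2 * (S * (m * q)) / 16" by simp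
  ultimately have "P\<^sup>2 * (S * (m * q)) / 32 \<le> 2 * x + 16 * G\<^sup>2 * V" using real by argo
  thus ?thesis by (simp add: S_def q_def x_def G_def V_def)
qed

text \<open>
  For large \<open>t\<close> the volume term of \<open>window_mass\<close> is at most half of the left side. How large \<open>t\<close> has to
  be depends on the data, but the constant does not.
\<close>

lemma lower_bound:
  assumes \<kappa>: "\<kappa> > 0" and R2: "(R2 \<longlongrightarrow> 0) at_top" and vol: "((\<lambda>t. R2 t ^ DIM('a) / (decay_rate DIM('a) t)\<^sup>2) \<longlongrightarrow> 0) at_top"
    and window: "\<forall>\<^sub>F t in at_top. frequency_window \<sigma> DIM('a) \<kappa> t (R1 t) (R2 t) (m t) (M t)"
    and P: "(\<integral>x. u1 x \<partial>lebesgue) \<noteq> 0"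
  shows "\<forall>\<^sub>F t in at_top. sqrt (sphere_area DIM('a) * \<kappa> / (128 * (2 * pi) ^ DIM('a))) * decay_rate DIM('a) t
     * norm (\<integral>x. u1 x \<partial>lebesgue) \<le> L2_norm (u t)"
proof -
  define p where "p = norm (\<integral>x. u1 x \<partial>lebesgue)"
  define S where "S = sphere_area DIM('a)"
  define \<omega> where "\<omega> = unit_ball_vol (real DIM('a))"
  define Q :: real where "Q = (2 * pi) ^ DIM('a)"
  define g where "g = (N * (1 + 1 / \<sigma>))\<^sup>2"
  \<comment> \<open>the ratio of volume and squared rate below which the volume term is at most half of the main
    term; the summand 1 covers vanishing data\<close>
  define e where "e = p\<^sup>2 * S * \<kappa> / (1024 * (g * \<omega> + 1))"
  have S: "S > 0" unfolding S_def by (rule sphere_area_pos) simp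
  have Q: "Q > 0" by (simp add: Q_def)
  have p: "p > 0" using P by (simp add: p_def)
  have g: "0 \<le> g * \<omega>" by (simp add: g_def \<omega>_def)
  have e: "e > 0" using p S \<kappa> g by (simp add: e_def add_nonneg_pos)
  obtain d where d: "d > 0" "\<And>\<xi>. norm \<xi> < d \<Longrightarrow> p / 2 \<le> norm (fourier u1 \<xi>) \<and> norm (fourier u1 \<xi>) \<le> 2 * p"
    using fourier_near_origin[OF data(3) P] unfolding p_def by blast
  show ?thesis
    using window order_tendstoD(2)[OF R2 d(1)] order_tendstoD(2)[OF vol e] eventually_gt_at_top[of 1]
  proof eventually_elim
    case (elim t)
    define D where "D = decay_rate DIM('a) t"
    have D: "D > 0" unfolding D_def using elim by (intro decay_rate_pos)
    have "p\<^sup>2 * (S * (m t * ln (R2 t / R1 t))) / 32 \<le> 2 * (Q * (L2_norm (u t))\<^sup>2) + 16 * g * (\<omega> * R2 t ^ DIM('a))"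
      unfolding S_def Q_def g_def \<omega>_def
    proof (rule window_mass[OF _ elim(1)])
      show "p / 2 \<le> norm (fourier u1 \<xi>) \<and> norm (fourier u1 \<xi>) \<le> 2 * p" if "norm \<xi> \<le> R2 t" for \<xi>
        using d(2)[of \<xi>] that elim by linarith
    qed (use elim(4) in simp)
    moreover have "p\<^sup>2 * (S * (\<kappa> * D\<^sup>2)) / 32 \<le> p\<^sup>2 * (S * (m t * ln (R2 t / R1 t))) / 32"
      using elim(1) S unfolding D_def frequency_window_def by (intro divide_right_mono mult_left_mono) auto
    moreover have "16 * g * (\<omega> * R2 t ^ DIM('a)) \<le> p\<^sup>2 * (S * (\<kappa> * D\<^sup>2)) / 64"
    proof -
      have "R2 t ^ DIM('a) \<le> e * D\<^sup>2"
        using elim(3) D unfolding D_def[symmetric] by (simp add: pos_divide_less_eq)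
      hence "(g * \<omega>) * R2 t ^ DIM('a) \<le> (g * \<omega>) * (e * D\<^sup>2)" using g by (intro mult_left_mono)
      also have "\<dots> \<le> (g * \<omega> + 1) * (e * D\<^sup>2)" using e by (intro mult_right_mono) auto
      also have "\<dots> = p\<^sup>2 * S * \<kappa> / 1024 * D\<^sup>2" using g by (simp add: e_def field_simps)
      finally show ?thesis by (simp add: field_simps)
    qed
    ultimately have "p\<^sup>2 * (S * (\<kappa> * D\<^sup>2)) / 64 \<le> 2 * (Q * (L2_norm (u t))\<^sup>2)" by argo
    hence "p\<^sup>2 * S * \<kappa> * D\<^sup>2 / (128 * Q) \<le> (L2_norm (u t))\<^sup>2" using Q by (simp add: field_simps)
    moreover have "p\<^sup>2 * S * \<kappa> * D\<^sup>2 / (128 * Q) = (sqrt (S * \<kappa> / (128 * Q)) * D * p)\<^sup>2"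
      using S \<kappa> Q by (simp add: power_mult_distrib)
    ultimately have "(sqrt (S * \<kappa> / (128 * Q)) * D * p)\<^sup>2 \<le> (L2_norm (u t))\<^sup>2" by simp
    hence "sqrt (S * \<kappa> / (128 * Q)) * D * p \<le> L2_norm (u t)" by (rule power2_le_imp_le[OF _ L2_norm_nonneg])
    thus ?case by (simp add: S_def Q_def D_def p_def)
  qed
qed

end

section \<open>The decay rates\<close>

theorem theorem2p1:
  fixes \<sigma> :: real
  assumes "\<sigma> > 0"
  shows "\<exists>C c T0 :: real. C > 0 \<and> c > 0 \<and> T0 > 1 \<and>
    (\<forall>(u0 :: real ^ 'n \<Rightarrow> complex) u1 \<theta>0 u \<theta>.
       in_L1 u0 \<and> in_L2 u0 \<and> in_L1 u1 \<and> in_L2 u1 \<and> in_L1 \<theta>0 \<and> in_L2 \<theta>0 \<and>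
       plate_solution \<sigma> u0 u1 \<theta>0 u \<theta> \<longrightarrow>
         (\<forall>t\<ge>T0. L2_norm (u t) \<le> C * decay_rate CARD('n) t * data_norm u0 u1 \<theta>0) \<and>
         (\<exists>T1>1. \<forall>t\<ge>T1.
            c * decay_rate CARD('n) t * norm (\<integral>x. u1 x \<partial>lebesgue) \<le> L2_norm (u t)) \<and>
         ((\<integral>x. u1 x \<partial>lebesgue) \<noteq> 0 \<longrightarrow>
            (\<exists>a b T2 :: real. a > 0 \<and> b > 0 \<and> T2 > 1 \<and>
               (\<forall>t\<ge>T2. a \<le> L2_norm (u t) / decay_rate CARD('n) t \<and>
                        L2_norm (u t) / decay_rate CARD('n) t \<le> b))))"
proof -
  let ?n = "DIM(real ^ 'n)"
  have dim: "CARD('n) = ?n" by simp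
  obtain C0 T0 where C0: "C0 > 0" and T0: "T0 > 1"
    and kernel: "\<And>t. t \<ge> T0 \<Longrightarrow> \<exists>A K. dominating_kernel \<sigma> t A K \<and> A \<le> C0 * (decay_rate ?n t)\<^sup>2 \<and>
     (\<integral>\<^sup>+\<xi>. ennreal (K (norm \<xi>)) \<partial>(lborel :: (real ^ 'n) measure)) \<le> ennreal (C0 * (decay_rate ?n t)\<^sup>2)"
    using dominating_kernel_exists[OF assms, where 'a = "real ^ 'n"] by blast
  obtain \<kappa> R1 R2 m M where \<kappa>: "\<kappa> > 0"
    and win: "(R2 \<longlongrightarrow> 0) at_top" "((\<lambda>t. R2 t ^ ?n / (decay_rate ?n t)\<^sup>2) \<longlongrightarrow> 0) at_top"
      "\<forall>\<^sub>F t in at_top. frequency_window \<sigma> ?n \<kappa> t (R1 t) (R2 t) (m t) (M t)"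
    using frequency_window_exists[OF assms, of ?n] by blast
  define C where "C = sqrt (2 * C0)"
  define c where "c = sqrt (sphere_area ?n * \<kappa> / (128 * (2 * pi) ^ ?n))"
  have C: "C > 0" using C0 by (simp add: C_def)
  have c: "c > 0" using \<kappa> sphere_area_pos[of ?n] by (simp add: c_def)
  have main: "(\<forall>t\<ge>T0. L2_norm (u t) \<le> C * decay_rate CARD('n) t * data_norm u0 u1 \<theta>0) \<and>
      (\<exists>T1>1. \<forall>t\<ge>T1. c * decay_rate CARD('n) t * norm (\<integral>x. u1 x \<partial>lebesgue) \<le> L2_norm (u t)) \<and>
      ((\<integral>x. u1 x \<partial>lebesgue) \<noteq> 0 \<longrightarrow>
            (\<exists>a b T2 :: real. a > 0 \<and> b > 0 \<and> T2 > 1 \<and>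
               (\<forall>t\<ge>T2. a \<le> L2_norm (u t) / decay_rate CARD('n) t \<and>
                        L2_norm (u t) / decay_rate CARD('n) t \<le> b)))"
    if data: "in_L1 u0" "in_L2 u0" "in_L1 u1" "in_L2 u1" "in_L1 \<theta>0" "in_L2 \<theta>0"
      and sol: "plate_solution \<sigma> u0 u1 \<theta>0 u \<theta>"
    for u0 u1 \<theta>0 :: "real ^ 'n \<Rightarrow> complex" and u \<theta>
  proof -
    let ?P = "norm (\<integral>x. u1 x \<partial>lebesgue)"
    let ?N = "data_norm u0 u1 \<theta>0"
    obtain U \<Theta> where "\<forall>t\<ge>0. L2_fourier (u t) (U t) \<and> L2_fourier (\<theta> t) (\<Theta> t)"
      "AE \<xi> in lebesgue. frequency_ode_solution \<sigma> (norm \<xi>) (fourier u0 \<xi>) (fourier u1 \<xi>) (fourier \<theta>0 \<xi>)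
             (\<lambda>t. U t \<xi>) (\<lambda>t. \<Theta> t \<xi>)"
      using sol unfolding plate_solution_def by blast
    then interpret plate \<sigma> u0 u1 \<theta>0 u U \<Theta>
      using assms data by unfold_locales auto
    have upper: "L2_norm (u t) \<le> C * decay_rate CARD('n) t * ?N" if t: "t \<ge> T0" for t
    proof -
      obtain A K where AK: "dominating_kernel \<sigma> t A K" "A \<le> C0 * (decay_rate ?n t)\<^sup>2"
        "(\<integral>\<^sup>+\<xi>. ennreal (K (norm \<xi>)) \<partial>(lborel :: (real ^ 'n) measure)) \<le> ennreal (C0 * (decay_rate ?n t)\<^sup>2)"
        using kernel[OF t] by blast
      show ?thesis unfolding C_def dim
        by (rule upper_bound[OF _ AK(1) _ AK(2,3)]) (use t T0 C0 in auto)
    qed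
    have lower: "\<exists>T1>1. \<forall>t\<ge>T1. c * decay_rate CARD('n) t * ?P \<le> L2_norm (u t)"
    proof (cases "(\<integral>x. u1 x \<partial>lebesgue) = 0")
      case True
      thus ?thesis using L2_norm_nonneg by (intro exI[of _ 2]) auto
    next
      case False
      from lower_bound[OF \<kappa> win False]
      obtain T where "\<And>t. t \<ge> T \<Longrightarrow> c * decay_rate ?n t * ?P \<le> L2_norm (u t)"
        unfolding eventually_at_top_linorder c_def by blast
      thus ?thesis by (intro exI[of _ "max 2 T"]) (auto simp: dim simp del: DIM_cart)
    qed
    moreover have "\<exists>a b T2 :: real. a > 0 \<and> b > 0 \<and> T2 > 1 \<and>
               (\<forall>t\<ge>T2. a \<le> L2_norm (u t) / decay_rate CARD('n) t \<and>
                        L2_norm (u t) / decay_rate CARD('n) t \<le> b)"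
      if P: "(\<integral>x. u1 x \<partial>lebesgue) \<noteq> 0"
    proof -
      obtain T1 where T1: "T1 > 1" "\<And>t. t \<ge> T1 \<Longrightarrow> c * decay_rate CARD('n) t * ?P \<le> L2_norm (u t)"
        using lower by blast
      \<comment> \<open>the summand 1 keeps the upper constant positive without a further argument on the data norm\<close>
      have "c * ?P \<le> L2_norm (u t) / decay_rate CARD('n) t \<and> L2_norm (u t) / decay_rate CARD('n) t \<le> C * ?N + 1"
        if t: "t \<ge> max T0 T1" for t
      proof -
        have D: "decay_rate CARD('n) t > 0" using t T0 by (intro decay_rate_pos) auto
        have "c * ?P \<le> L2_norm (u t) / decay_rate CARD('n) t"
          using T1(2)[of t] t D by (simp add: pos_le_divide_eq mult_ac)
        moreover have "L2_norm (u t) / decay_rate CARD('n) t \<le> C * ?N"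
          using upper[of t] t D by (simp add: pos_divide_le_eq mult_ac)
        ultimately show ?thesis by simp
      qed
      moreover have "c * ?P > 0" using c P by simp
      moreover have "C * ?N + 1 > 0" using C data_norm_nonneg by (simp add: add_nonneg_pos)
      moreover have "max T0 T1 > 1" using T0 by simp
      ultimately show ?thesis by blast
    qed
    ultimately show ?thesis using upper by blast
  qed
  show ?thesis
    by (rule exI[of _ C], rule exI[of _ c], rule exI[of _ T0]) (use C c T0 main in blast)
qed

end
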